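(* Let $G$ be a group and let $R$ be a graded left Artinian $G$-graded ring. Then the mapping $P\mapsto P/J^{\rm gr}(R)P$ defines a bijective correspondence between the isomorphism types of principal graded indecomposable left $R$-modules and the isomorphism types of graded simple left $R/J^{\rm gr}(R)$-modules that embed into $R/J^{\rm gr}(R)$. Moreover, the same mapping induces a bijective correspondence between the isoshift types of principal graded indecomposable left $R$-modules and the isoshift types of graded simple left $R/J^{\rm gr}(R)$-modules, and the latter are just the isoshift types of graded simple left $R$-modules.
   Context: Rings are associative with identity; a $G$-graded ring is $R=\bigoplus_{g\in G}R_g$ with $R_gR_h\subset R_{gh}$. Graded left $R$-modules are $M=\bigoplus_gM_g$ with $R_gM_h\subset M_{gh}$; isomorphisms and embeddings are degree-preserving $R$-linear maps. The shift $M(\sigma)$, $\sigma\in G$, is $M$ with grading $M(\sigma)_g=M_{g\sigma}$. Two graded left modules $M,N$ have the same isoshift type if $M\simeq N(\sigma)$ for some $\sigma\in G$. A nonzero graded module is graded simple if it has no proper nonzero graded submodules. $J^{\rm gr}(R)$ is the intersection of all maximal graded left ideals of $R$, a graded two-sided ideal. Graded left Artinian means DCC on graded left ideals. If $R$ is graded left Artinian, $R$ is a finite direct sum of indecomposable graded left submodules, uniquely up to isomorphism and permutation; the summands are the principal graded indecomposable left $R$-modules. *)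

theory Defs
  imports "HOL-Algebra.QuotRing" "HOL-Algebra.Module" "HOL-Algebra.Generated_Groups"
begin

text \<open>
  The internal direct sum of the additive subgroups \<open>D i\<close>, \<open>i \<in> I\<close> (\<open>I\<close> may be infinite): every
  element is, in exactly one way, a sum of a finitely supported family of elements of the \<open>D i\<close>.
\<close>

definition internal_direct_sum :: "('a, 'z) ring_scheme \<Rightarrow> 'i set \<Rightarrow> ('i \<Rightarrow> 'a set) \<Rightarrow> bool" where
  "internal_direct_sum M I D \<longleftrightarrow>
     (\<forall>i\<in>I. additive_subgroup (D i) M) \<and>
     (\<forall>x\<in>carrier M. \<exists>!f. f \<in> (\<Pi>\<^sub>E i\<in>I. D i) \<and> finite {i\<in>I. f i \<noteq> \<zero>\<^bsub>M\<^esub>} \<and>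
        x = finsum M f {i\<in>I. f i \<noteq> \<zero>\<^bsub>M\<^esub>})"


section \<open>Graded rings and graded left modules\<close>

record ('r, 'g) gring = "'r ring" +
  rcomp :: "'g \<Rightarrow> 'r set"

locale graded_ring = G: group G + ring R
  for G :: "('g, 'y) monoid_scheme" and R :: "('r, 'g) gring" (structure) +
  assumes ring_decomp: "internal_direct_sum R (carrier G) (rcomp R)"
    and ring_comp_mult: "\<lbrakk>g \<in> carrier G; h \<in> carrier G; a \<in> rcomp R g; b \<in> rcomp R h\<rbrakk>
      \<Longrightarrow> a \<otimes>\<^bsub>R\<^esub> b \<in> rcomp R (g \<otimes>\<^bsub>G\<^esub> h)"

text \<open>
  The library locale \<^locale>\<open>module\<close> requires commutative scalars, so only its record type is reused.
  The fields \<^const>\<open>monoid.mult\<close> and \<^const>\<open>one\<close> inherited from the ring record carry no meaning for a module.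
\<close>

record ('r, 'm, 'g) gmod = "('r, 'm) module" +
  mcomp :: "'g \<Rightarrow> 'm set"

locale graded_left_module = graded_ring G R + M: abelian_group M
  for G :: "('g, 'y) monoid_scheme" and R :: "('r, 'g) gring" (structure)
    and M :: "('r, 'm, 'g) gmod" +
  assumes smult_closed: "\<lbrakk>a \<in> carrier R; x \<in> carrier M\<rbrakk> \<Longrightarrow> a \<odot>\<^bsub>M\<^esub> x \<in> carrier M"
    and smult_l_distr: "\<lbrakk>a \<in> carrier R; b \<in> carrier R; x \<in> carrier M\<rbrakk>
      \<Longrightarrow> (a \<oplus>\<^bsub>R\<^esub> b) \<odot>\<^bsub>M\<^esub> x = a \<odot>\<^bsub>M\<^esub> x \<oplus>\<^bsub>M\<^esub> b \<odot>\<^bsub>M\<^esub> x"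
    and smult_r_distr: "\<lbrakk>a \<in> carrier R; x \<in> carrier M; y \<in> carrier M\<rbrakk>
      \<Longrightarrow> a \<odot>\<^bsub>M\<^esub> (x \<oplus>\<^bsub>M\<^esub> y) = a \<odot>\<^bsub>M\<^esub> x \<oplus>\<^bsub>M\<^esub> a \<odot>\<^bsub>M\<^esub> y"
    and smult_assoc: "\<lbrakk>a \<in> carrier R; b \<in> carrier R; x \<in> carrier M\<rbrakk>
      \<Longrightarrow> (a \<otimes>\<^bsub>R\<^esub> b) \<odot>\<^bsub>M\<^esub> x = a \<odot>\<^bsub>M\<^esub> (b \<odot>\<^bsub>M\<^esub> x)"
    and smult_one: "x \<in> carrier M \<Longrightarrow> \<one>\<^bsub>R\<^esub> \<odot>\<^bsub>M\<^esub> x = x"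
    and module_decomp: "internal_direct_sum M (carrier G) (mcomp M)"
    and smult_comp: "\<lbrakk>g \<in> carrier G; h \<in> carrier G; a \<in> rcomp R g; x \<in> mcomp M h\<rbrakk>
      \<Longrightarrow> a \<odot>\<^bsub>M\<^esub> x \<in> mcomp M (g \<otimes>\<^bsub>G\<^esub> h)"

definition regular_gmod :: "('r, 'g) gring \<Rightarrow> ('r, 'r, 'g) gmod" where
  "regular_gmod R =
     \<lparr>carrier = carrier R, monoid.mult = monoid.mult R, one = one R, ring.zero = ring.zero R, add = add R,
      smult = monoid.mult R, mcomp = rcomp R\<rparr>"

definition restrict_gmod :: "('r, 'm, 'g) gmod \<Rightarrow> 'm set \<Rightarrow> ('r, 'm, 'g) gmod" where
  "restrict_gmod M N = M\<lparr>carrier := N, mcomp := \<lambda>g. N \<inter> mcomp M g\<rparr>"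

text \<open>A graded submodule is a subset that is a graded module for the induced operations and grading;
  in particular it is the direct sum of its intersections with the components.\<close>

definition graded_submodule ::
    "('g, 'y) monoid_scheme \<Rightarrow> ('r, 'g) gring \<Rightarrow> ('r, 'm, 'g) gmod \<Rightarrow> 'm set \<Rightarrow> bool" where
  "graded_submodule G R M N \<longleftrightarrow>
     N \<subseteq> carrier M \<and> graded_left_module G R (restrict_gmod M N)"

definition gr_simple ::
    "('g, 'y) monoid_scheme \<Rightarrow> ('r, 'g) gring \<Rightarrow> ('r, 'm, 'g) gmod \<Rightarrow> bool" where
  "gr_simple G R M \<longleftrightarrow>
     graded_left_module G R M \<and> carrier M \<noteq> {\<zero>\<^bsub>M\<^esub>} \<and>
     (\<forall>N. graded_submodule G R M N \<longrightarrow> N = {\<zero>\<^bsub>M\<^esub>} \<or> N = carrier M)"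

definition gr_indecomposable ::
    "('g, 'y) monoid_scheme \<Rightarrow> ('r, 'g) gring \<Rightarrow> ('r, 'm, 'g) gmod \<Rightarrow> bool" where
  "gr_indecomposable G R M \<longleftrightarrow>
     graded_left_module G R M \<and> carrier M \<noteq> {\<zero>\<^bsub>M\<^esub>} \<and>
     (\<forall>A B. graded_submodule G R M A \<and> graded_submodule G R M B \<and>
        A \<inter> B = {\<zero>\<^bsub>M\<^esub>} \<and> A <+>\<^bsub>M\<^esub> B = carrier M \<longrightarrow> A = {\<zero>\<^bsub>M\<^esub>} \<or> B = {\<zero>\<^bsub>M\<^esub>})"


section \<open>Morphisms, shifts, isomorphism and isoshift\<close>

definition gr_hom ::
    "('g, 'y) monoid_scheme \<Rightarrow> ('r, 'g) gring \<Rightarrow> ('r, 'm, 'g) gmod \<Rightarrow> ('r, 'n, 'g) gmod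
       \<Rightarrow> ('m \<Rightarrow> 'n) set" where
  "gr_hom G R M N =
     {f \<in> carrier M \<rightarrow> carrier N.
        (\<forall>x\<in>carrier M. \<forall>y\<in>carrier M. f (x \<oplus>\<^bsub>M\<^esub> y) = f x \<oplus>\<^bsub>N\<^esub> f y) \<and>
        (\<forall>a\<in>carrier R. \<forall>x\<in>carrier M. f (a \<odot>\<^bsub>M\<^esub> x) = a \<odot>\<^bsub>N\<^esub> f x) \<and>
        (\<forall>g\<in>carrier G. f ` mcomp M g \<subseteq> mcomp N g)}"

definition gr_iso ::
    "('g, 'y) monoid_scheme \<Rightarrow> ('r, 'g) gring \<Rightarrow> ('r, 'm, 'g) gmod \<Rightarrow> ('r, 'n, 'g) gmod \<Rightarrow> bool" where
  "gr_iso G R M N \<longleftrightarrow> (\<exists>f\<in>gr_hom G R M N. bij_betw f (carrier M) (carrier N))"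

definition gr_embeds ::
    "('g, 'y) monoid_scheme \<Rightarrow> ('r, 'g) gring \<Rightarrow> ('r, 'm, 'g) gmod \<Rightarrow> ('r, 'n, 'g) gmod \<Rightarrow> bool" where
  "gr_embeds G R M N \<longleftrightarrow> (\<exists>f\<in>gr_hom G R M N. inj_on f (carrier M))"

definition gr_shift ::
    "('g, 'y) monoid_scheme \<Rightarrow> ('r, 'm, 'g) gmod \<Rightarrow> 'g \<Rightarrow> ('r, 'm, 'g) gmod" where
  "gr_shift G M \<sigma> = M\<lparr>mcomp := \<lambda>g. mcomp M (g \<otimes>\<^bsub>G\<^esub> \<sigma>)\<rparr>"

definition gr_isoshift ::
    "('g, 'y) monoid_scheme \<Rightarrow> ('r, 'g) gring \<Rightarrow> ('r, 'm, 'g) gmod \<Rightarrow> ('r, 'n, 'g) gmod \<Rightarrow> bool" where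
  "gr_isoshift G R M N \<longleftrightarrow> (\<exists>\<sigma>\<in>carrier G. gr_iso G R M (gr_shift G N \<sigma>))"


section \<open>Graded left ideals, the graded Jacobson radical, principal indecomposables\<close>

abbreviation graded_left_ideal ::
    "('g, 'y) monoid_scheme \<Rightarrow> ('r, 'g) gring \<Rightarrow> 'r set \<Rightarrow> bool" where
  "graded_left_ideal G R I \<equiv> graded_submodule G R (regular_gmod R) I"

definition maximal_graded_left_ideal ::
    "('g, 'y) monoid_scheme \<Rightarrow> ('r, 'g) gring \<Rightarrow> 'r set \<Rightarrow> bool" where
  "maximal_graded_left_ideal G R I \<longleftrightarrow>
     graded_left_ideal G R I \<and> I \<noteq> carrier R \<and>
     (\<forall>K. graded_left_ideal G R K \<and> I \<subseteq> K \<longrightarrow> K = I \<or> K = carrier R)"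

definition gr_jacobson :: "('g, 'y) monoid_scheme \<Rightarrow> ('r, 'g) gring \<Rightarrow> 'r set" where
  "gr_jacobson G R = carrier R \<inter> \<Inter>{I. maximal_graded_left_ideal G R I}"

definition gr_left_artinian :: "('g, 'y) monoid_scheme \<Rightarrow> ('r, 'g) gring \<Rightarrow> bool" where
  "gr_left_artinian G R \<longleftrightarrow>
     (\<forall>I :: nat \<Rightarrow> 'r set. (\<forall>n. graded_left_ideal G R (I n)) \<and> (\<forall>n. I (Suc n) \<subseteq> I n) \<longrightarrow>
        (\<exists>n. \<forall>k\<ge>n. I k = I n))"

definition principal_gr_indecs ::
    "('g, 'y) monoid_scheme \<Rightarrow> ('r, 'g) gring \<Rightarrow> ('r, 'r, 'g) gmod set" where
  "principal_gr_indecs G R =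
     {P. \<exists>(n::nat) D.
        (\<forall>k<n. graded_left_ideal G R (D k) \<and>
               gr_indecomposable G R (restrict_gmod (regular_gmod R) (D k))) \<and>
        internal_direct_sum R {..<n} D \<and>
        (\<exists>k<n. P = restrict_gmod (regular_gmod R) (D k))}"


section \<open>Quotients\<close>

definition quot_gring :: "('r, 'g) gring \<Rightarrow> 'r set \<Rightarrow> ('r set, 'g) gring" where
  "quot_gring R I =
     ring.extend (R Quot I) (gring.fields (\<lambda>g. (\<lambda>a. I +>\<^bsub>R\<^esub> a) ` rcomp R g))"

definition quot_gmod :: "('r, 'm, 'g) gmod \<Rightarrow> 'm set \<Rightarrow> ('r, 'm set, 'g) gmod" where
  "quot_gmod M N =
     \<lparr>carrier = a_rcosets\<^bsub>M\<^esub> N, monoid.mult = (\<lambda>X Y. undefined), one = undefined,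
      ring.zero = N, add = set_add M,
      smult = (\<lambda>a X. \<Union>x\<in>X. N +>\<^bsub>M\<^esub> (a \<odot>\<^bsub>M\<^esub> x)),
      mcomp = (\<lambda>g. (\<lambda>x. N +>\<^bsub>M\<^esub> x) ` mcomp M g)\<rparr>"

definition ideal_times :: "'r set \<Rightarrow> ('r, 'm, 'g) gmod \<Rightarrow> 'm set" where
  "ideal_times I M = generate (add_monoid M) {a \<odot>\<^bsub>M\<^esub> x | a x. a \<in> I \<and> x \<in> carrier M}"

text \<open>An \<open>R\<close>-module annihilated by \<open>I\<close>, viewed as an \<open>R/I\<close>-module: a coset \<open>A\<close> acts on \<open>x\<close> by the
  common value of \<open>a x\<close> for \<open>a \<in> A\<close>.\<close>

definition deflate_gmod :: "('r, 'm, 'g) gmod \<Rightarrow> ('r set, 'm, 'g) gmod" where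
  "deflate_gmod M =
     \<lparr>carrier = carrier M, monoid.mult = monoid.mult M, one = one M, ring.zero = ring.zero M, add = add M,
      smult = (\<lambda>A x. the_elem ((\<lambda>a. a \<odot>\<^bsub>M\<^esub> x) ` A)), mcomp = mcomp M\<rparr>"

text \<open>An \<open>R/I\<close>-module, viewed as an \<open>R\<close>-module through the projection \<open>R \<rightarrow> R/I\<close>.\<close>

definition inflate_gmod ::
    "('r, 'g) gring \<Rightarrow> 'r set \<Rightarrow> ('r set, 'm, 'g) gmod \<Rightarrow> ('r, 'm, 'g) gmod" where
  "inflate_gmod R I M =
     \<lparr>carrier = carrier M, monoid.mult = monoid.mult M, one = one M, ring.zero = ring.zero M, add = add M,
      smult = (\<lambda>a x. (I +>\<^bsub>R\<^esub> a) \<odot>\<^bsub>M\<^esub> x), mcomp = mcomp M\<rparr>"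

definition gr_jacobson_quot :: "('g, 'y) monoid_scheme \<Rightarrow> ('r, 'g) gring \<Rightarrow> ('r set, 'g) gring" where
  "gr_jacobson_quot G R = quot_gring R (gr_jacobson G R)"

text \<open>\<open>P / J P\<close> as a graded \<open>R/J\<close>-module, where \<open>J\<close> is the graded Jacobson radical of \<open>R\<close>.\<close>

definition gr_top ::
    "('g, 'y) monoid_scheme \<Rightarrow> ('r, 'g) gring \<Rightarrow> ('r, 'm, 'g) gmod \<Rightarrow> ('r set, 'm set, 'g) gmod" where
  "gr_top G R P = deflate_gmod (quot_gmod P (ideal_times (gr_jacobson G R) P))"


section \<open>Correspondences between types\<close>

definition rel_on :: "'a set \<Rightarrow> ('a \<Rightarrow> 'a \<Rightarrow> bool) \<Rightarrow> ('a \<times> 'a) set" where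
  "rel_on A E = {(x, y). x \<in> A \<and> y \<in> A \<and> E x y}"

text \<open>\<open>F\<close> maps \<open>A\<close> to \<open>B\<close> and descends to a bijection from the \<open>E\<close>-classes of \<open>A\<close> to the
  \<open>E'\<close>-classes of \<open>B\<close>.\<close>

definition induces_bijection ::
    "('a \<Rightarrow> 'b) \<Rightarrow> 'a set \<Rightarrow> ('a \<Rightarrow> 'a \<Rightarrow> bool) \<Rightarrow> 'b set \<Rightarrow> ('b \<Rightarrow> 'b \<Rightarrow> bool) \<Rightarrow> bool" where
  "induces_bijection F A E B E' \<longleftrightarrow>
     (\<exists>f. bij_betw f (A // rel_on A E) (B // rel_on B E') \<and>
          (\<forall>x\<in>A. F x \<in> B \<and> f (rel_on A E `` {x}) = rel_on B E' `` {F x}))"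

end

theory Submission
  imports Defs
begin

text \<open>
  Write \<open>J\<close> for the graded radical. A principal indecomposable module is \<open>R e\<close> for a primitive idempotent \<open>e\<close> of
  degree one, and the heart of the matter is that \<open>R e\<close> is local: every graded submodule not contained in \<open>J\<close> is
  all of \<open>R e\<close>. This is proved without lifting idempotents modulo \<open>J\<close> and without nilpotency of \<open>J\<close>. If
  \<open>U + V = R e\<close>, the descending chain condition yields \<open>N \<subseteq> U\<close> and \<open>L \<subseteq> V\<close> that are minimal supplements of
  each other, and projectivity of \<open>R e\<close> forces \<open>N \<inter> L = 0\<close>; then primitivity gives \<open>U = R e\<close> or \<open>V = R e\<close>.

  Hence \<open>R e/J e\<close> is graded simple. A nonzero degree-preserving map \<open>R e/J e \<rightarrow> (R f/J f)(\<sigma>)\<close> is given by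
  some \<open>x \<in> e R f\<close> of degree \<open>\<sigma>\<close> outside \<open>J\<close>; locality gives \<open>s\<close> with \<open>s x = f\<close>, so that \<open>x s\<close> is a
  nonzero idempotent of \<open>e R e\<close>, that is, \<open>x s = e\<close>, and right multiplication by \<open>x\<close> is an isomorphism
  \<open>R e \<rightarrow> (R f)(\<sigma>)\<close>. Conversely, if \<open>s\<close> is a nonzero element of degree \<open>\<sigma>\<close> of a graded simple module \<open>S\<close>, then some
  member \<open>e\<close> of a complete set of orthogonal primitive idempotents does not kill \<open>s\<close>, and \<open>r \<mapsto> r s\<close> induces
  \<open>R e/J e \<simeq> S(\<sigma>)\<close>. A graded simple \<open>S\<close> that embeds into \<open>R/J\<close> has such an \<open>s\<close> with \<open>\<sigma> = 1\<close>.
\<close>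

section \<open>Internal direct sums\<close>

text \<open>The grading shapes the details. Right multiplication by \<open>x\<close> is sure to send
  graded left ideals to graded left ideals only when \<open>x\<close> is homogeneous, because then
  it moves all degrees by one fixed group element. So an element found by an existence argument is
  cut down to its component of the required degree before it serves as a right factor, and claims
  about arbitrary elements are reduced to homogeneous ones. Even that \<open>J\<close>, an
  intersection of left ideals, is closed under right multiplication rests on this: for homogeneous
  \<open>a\<close> outside a maximal graded left ideal \<open>I\<close>, the set of all
  \<open>r\<close> with \<open>r a \<in> I\<close> is again maximal. Shifts enter since a graded
  simple module may have no nonzero element of degree one, and \<open>r \<mapsto> r s\<close>
  preserves degrees as a map into \<open>S(\<sigma>)\<close>. Modules over \<open>R/J\<close> are
  treated as \<open>R\<close>-modules killed by \<open>J\<close>; simplicity and isomorphisms are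
  studied over \<open>R\<close> and transferred at the end.\<close>

definition dsum_rep :: "('a, 'z) ring_scheme \<Rightarrow> 'i set \<Rightarrow> ('i \<Rightarrow> 'a set) \<Rightarrow> 'a \<Rightarrow> ('i \<Rightarrow> 'a) \<Rightarrow> bool" where
  "dsum_rep M I D x f \<longleftrightarrow> f \<in> (\<Pi>\<^sub>E i\<in>I. D i) \<and> finite {i\<in>I. f i \<noteq> \<zero>\<^bsub>M\<^esub>} \<and>
        x = finsum M f {i\<in>I. f i \<noteq> \<zero>\<^bsub>M\<^esub>}"

text \<open>\<open>THE\<close> is meaningful when the sum is direct and \<open>x\<close> lies in the
  carrier; extensionality of \<open>\<Pi>\<^sub>E\<close> makes the family unique as a function. Of
  \<open>M\<close> only carrier, addition and zero matter, so the regular module has the projections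
  of the ring and a shifted record those of the original.\<close>

definition dproj :: "('a, 'z) ring_scheme \<Rightarrow> 'i set \<Rightarrow> ('i \<Rightarrow> 'a set) \<Rightarrow> 'i \<Rightarrow> 'a \<Rightarrow> 'a" where
  "dproj M I D i x = (THE f. dsum_rep M I D x f) i"

text \<open>The regular, shifted and inflated modules are new records with the old carrier, addition
  and zero; this and the next lemmas transport additive facts between such records.\<close>

lemma additive_subgroup_cong:
  assumes "carrier M = carrier N" "add M = add N" "zero M = zero N"
  shows "additive_subgroup H M \<longleftrightarrow> additive_subgroup H N"
  unfolding additive_subgroup_def subgroup_def m_inv_def monoid.simps partial_object.simps assms ..

lemma finsum_ring_cong:
  assumes "carrier M = carrier N" "add M = add N" "zero M = zero N"
  shows "finsum M f A = finsum N f A"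
  unfolding finsum_def finprod_def monoid.simps partial_object.simps assms ..

lemma internal_direct_sum_ring_cong:
  assumes "carrier M = carrier N" "add M = add N" "zero M = zero N"
  shows "internal_direct_sum M I D \<longleftrightarrow> internal_direct_sum N I D"
  unfolding internal_direct_sum_def finsum_ring_cong[OF assms] additive_subgroup_cong[OF assms]
  using assms by simp

lemma dproj_ring_cong:
  assumes "carrier M = carrier N" "add M = add N" "zero M = zero N"
  shows "dproj M I D = dproj N I D"
  unfolding dproj_def dsum_rep_def finsum_ring_cong[OF assms] using assms by simp

lemma abelian_group_ring_cong:
  assumes "carrier M = carrier N" "add M = add N" "zero M = zero N"
  shows "abelian_group M \<longleftrightarrow> abelian_group N"
  unfolding abelian_group_def abelian_group_axioms_def abelian_monoid_def comm_group_def comm_monoid_def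
    comm_monoid_axioms_def group_def group_axioms_def monoid_def Units_def monoid.simps partial_object.simps assms ..

context abelian_group
begin

text \<open>Inverses appear as an existence claim and not through \<open>\<ominus>\<close>, whose
  definition refers to the carrier. In this form the condition can be compared between a module and
  its restriction to a smaller carrier.\<close>

lemma additive_subgroup_iff:
  "additive_subgroup H G \<longleftrightarrow> H \<subseteq> carrier G \<and> \<zero> \<in> H \<and> (\<forall>x\<in>H. \<forall>y\<in>H. x \<oplus> y \<in> H) \<and>
     (\<forall>x\<in>H. \<exists>y\<in>H. x \<oplus> y = \<zero>)" (is "?L \<longleftrightarrow> ?R")
proof
  assume L: ?L
  interpret additive_subgroup H G by fact
  have "\<exists>y\<in>H. x \<oplus> y = \<zero>" if "x \<in> H" for x
    using that by (intro bexI[of _ "\<ominus> x"]) (auto simp: r_neg)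
  then show ?R using a_subset by auto
next
  assume R: ?R
  have "\<ominus> x \<in> H" if "x \<in> H" for x
  proof -
    obtain y where "y \<in> H" "x \<oplus> y = \<zero>" using R \<open>x \<in> H\<close> by blast
    with R that have "x \<in> carrier G" "y \<in> carrier G" "y \<oplus> x = \<zero>" by (auto simp: a_comm subset_iff)
    then have "\<ominus> x = y" by (simp add: minus_equality)
    then show ?thesis using \<open>y \<in> H\<close> by simp
  qed
  then show ?L
    using R by (intro additive_subgroup.intro subgroup.intro) (auto simp: a_inv_def)
qed

lemma dsum_rep_ex1:
  assumes "internal_direct_sum G I D" "x \<in> carrier G"
  shows "\<exists>!f. dsum_rep G I D x f"
  using assms unfolding internal_direct_sum_def dsum_rep_def by blast

lemma dproj_eq:
  assumes "internal_direct_sum G I D" "x \<in> carrier G" "dsum_rep G I D x f"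
  shows "dproj G I D i x = f i"
proof -
  have "(THE f. dsum_rep G I D x f) = f"
    using dsum_rep_ex1[OF assms(1,2)] assms(3) by (simp add: HOL.the1_equality)
  then show ?thesis unfolding dproj_def by simp
qed

lemma dsum_rep_dproj:
  assumes "internal_direct_sum G I D" "x \<in> carrier G"
  shows "dsum_rep G I D x (\<lambda>i. dproj G I D i x)"
proof -
  obtain f where f: "dsum_rep G I D x f" using dsum_rep_ex1[OF assms] by blast
  then have "f = (\<lambda>i. dproj G I D i x)" using dproj_eq[OF assms f] by auto
  then show ?thesis using f by simp
qed

lemma dsum_closed:
  assumes "internal_direct_sum G I D" "i \<in> I" "x \<in> D i"
  shows "x \<in> carrier G"
  using assms unfolding internal_direct_sum_def
  by (meson additive_subgroup.a_Hcarr)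

lemma dsum_subgroup:
  assumes "internal_direct_sum G I D" "i \<in> I"
  shows "additive_subgroup (D i) G"
  using assms unfolding internal_direct_sum_def by blast

lemma dproj_in:
  assumes "internal_direct_sum G I D" "x \<in> carrier G" "i \<in> I"
  shows "dproj G I D i x \<in> D i"
  using dsum_rep_dproj[OF assms(1,2)] assms(3) unfolding dsum_rep_def by (auto simp: PiE_def Pi_def)

lemma dproj_closed:
  assumes "internal_direct_sum G I D" "x \<in> carrier G" "i \<in> I"
  shows "dproj G I D i x \<in> carrier G"
  by (rule dsum_closed[OF assms(1,3) dproj_in[OF assms]])

text \<open>\<open>F\<close> may be any finite set that contains the support, so that two families
  can be added over the union of their supports.\<close>

lemma dsum_repI:
  assumes f: "f \<in> (\<Pi>\<^sub>E i\<in>I. D i)" and F: "finite F" "F \<subseteq> I" "\<And>i. i \<in> I - F \<Longrightarrow> f i = \<zero>"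
    and D: "\<And>i. i \<in> I \<Longrightarrow> D i \<subseteq> carrier G" and x: "x = finsum G f F"
  shows "dsum_rep G I D x f"
proof -
  have sub: "{i\<in>I. f i \<noteq> \<zero>} \<subseteq> F" using F by auto
  have "finsum G f {i\<in>I. f i \<noteq> \<zero>} = finsum G f F"
  proof (rule add.finprod_mono_neutral_cong_left[OF F(1) sub])
    have "f i \<in> carrier G" if "i \<in> F" for i
      using PiE_mem[OF f, of i] D[of i] F(2) that by blast
    then show "f \<in> F \<rightarrow> carrier G" by blast
  qed (use F(2) in auto)
  then show ?thesis unfolding dsum_rep_def using f x sub F(1) finite_subset by auto
qed

lemma finsum_in:
  assumes "finite F" "f \<in> F \<rightarrow> S" "S \<subseteq> carrier G" "\<zero> \<in> S" "\<And>x y. x \<in> S \<Longrightarrow> y \<in> S \<Longrightarrow> x \<oplus> y \<in> S"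
  shows "finsum G f F \<in> S"
  using assms
proof (induction F rule: finite_induct)
  case (insert a F)
  then have "f \<in> F \<rightarrow> carrier G" "f a \<in> carrier G" by auto
  with insert show ?case by (auto simp: finsum_insert)
qed auto

lemma dsum_in:
  assumes ds: "internal_direct_sum G I D" and x: "x \<in> carrier G" and z: "\<zero> \<in> S"
    and a: "\<And>x y. x \<in> carrier G \<Longrightarrow> y \<in> carrier G \<Longrightarrow> x \<in> S \<Longrightarrow> y \<in> S \<Longrightarrow> x \<oplus> y \<in> S"
    and p: "\<And>i. i \<in> I \<Longrightarrow> dproj G I D i x \<in> S"
  shows "x \<in> S"
proof -
  let ?F = "{i\<in>I. dproj G I D i x \<noteq> \<zero>}"
  have r: "finite ?F" "x = finsum G (\<lambda>i. dproj G I D i x) ?F"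
    using dsum_rep_dproj[OF ds x] unfolding dsum_rep_def by auto
  have "finsum G (\<lambda>i. dproj G I D i x) ?F \<in> S \<inter> carrier G"
    by (rule finsum_in) (use r z a p dproj_closed[OF ds x] in auto)
  then show ?thesis using r by simp
qed

lemma dsum_induct [consumes 2, case_names zero add comp]:
  assumes ds: "internal_direct_sum G I D" and x: "x \<in> carrier G" and z: "P \<zero>"
    and a: "\<And>x y. x \<in> carrier G \<Longrightarrow> y \<in> carrier G \<Longrightarrow> P x \<Longrightarrow> P y \<Longrightarrow> P (x \<oplus> y)"
    and p: "\<And>i x. i \<in> I \<Longrightarrow> x \<in> D i \<Longrightarrow> P x"
  shows "P x"
  using dsum_in[OF ds x, of "Collect P"] z a p dproj_in[OF ds x] by auto

text \<open>The componentwise sum of two representations is a representation of the sum, and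
  representations are unique.\<close>

lemma dproj_add:
  assumes ds: "internal_direct_sum G I D" and x: "x \<in> carrier G" "y \<in> carrier G" and i: "i \<in> I"
  shows "dproj G I D i (x \<oplus> y) = dproj G I D i x \<oplus> dproj G I D i y"
proof -
  let ?p = "dproj G I D"
  let ?F = "\<lambda>x. {i\<in>I. ?p i x \<noteq> \<zero>}"
  have D: "\<And>i. i \<in> I \<Longrightarrow> D i \<subseteq> carrier G" using dsum_closed[OF ds] by auto
  have *: "dsum_rep G I D x (\<lambda>i. ?p i x)" "dsum_rep G I D y (\<lambda>i. ?p i y)"
    using dsum_rep_dproj[OF ds] x by auto
  then have fin: "finite (?F x \<union> ?F y)" unfolding dsum_rep_def by auto
  have c: "?p i x \<in> carrier G" "?p i y \<in> carrier G" if "i \<in> I" for i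
    using dproj_closed[OF ds] that x by auto
  have sx: "x = finsum G (\<lambda>i. ?p i x) (?F x \<union> ?F y)" 
  proof -
    have "finsum G (\<lambda>i. ?p i x) (?F x) = finsum G (\<lambda>i. ?p i x) (?F x \<union> ?F y)"
      using fin c by (intro add.finprod_mono_neutral_cong_left) auto
    then show ?thesis using * unfolding dsum_rep_def by auto
  qed
  have sy: "y = finsum G (\<lambda>i. ?p i y) (?F x \<union> ?F y)" 
  proof -
    have "finsum G (\<lambda>i. ?p i y) (?F y) = finsum G (\<lambda>i. ?p i y) (?F x \<union> ?F y)"
      using fin c by (intro add.finprod_mono_neutral_cong_left) auto
    then show ?thesis using * unfolding dsum_rep_def by auto
  qed
  let ?f = "\<lambda>i\<in>I. ?p i x \<oplus> ?p i y"
  have "finsum G ?f (?F x \<union> ?F y) = finsum G (\<lambda>i. ?p i x \<oplus> ?p i y) (?F x \<union> ?F y)"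
    using c by (intro finsum_cong') auto
  also have "\<dots> = x \<oplus> y"
    using c by (subst finsum_addf) (auto simp flip: sx sy)
  finally have s: "x \<oplus> y = finsum G ?f (?F x \<union> ?F y)" by simp
  have "dsum_rep G I D (x \<oplus> y) ?f"
  proof (rule dsum_repI[OF _ fin _ _ _ s])
    show "?f \<in> (\<Pi>\<^sub>E i\<in>I. D i)"
      using dproj_in[OF ds] x dsum_subgroup[OF ds] 
      by (auto intro!: additive_subgroup.a_closed)
  qed (use D in auto)
  from dproj_eq[OF ds _ this] show ?thesis using x i by simp
qed

lemma dproj_comp:
  assumes ds: "internal_direct_sum G I D" and i: "i \<in> I" "j \<in> I" and x: "x \<in> D j"
  shows "dproj G I D i x = (if i = j then x else \<zero>)"
proof -
  have D: "\<And>i. i \<in> I \<Longrightarrow> D i \<subseteq> carrier G" using dsum_closed[OF ds] by auto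
  let ?f = "\<lambda>i\<in>I. if i = j then x else \<zero>"
  have z: "\<zero> \<in> D i" if "i \<in> I" for i
    using dsum_subgroup[OF ds that] by (rule additive_subgroup.zero_closed)
  have "dsum_rep G I D x ?f"
  proof (rule dsum_repI[where F = "{j}"])
    have "x \<in> carrier G" using i x D by auto
    then show "x = finsum G ?f {j}" using i x by (subst finsum_insert) auto
  qed (use i x z D in auto)
  moreover have "x \<in> carrier G" using x i D by auto
  ultimately have "dproj G I D i x = ?f i" using dproj_eq[OF ds] by blast
  then show ?thesis using i by simp
qed

lemma dproj_zero:
  assumes ds: "internal_direct_sum G I D" and i: "i \<in> I"
  shows "dproj G I D i \<zero> = \<zero>"
  using dproj_comp[OF ds i i, of \<zero>] dsum_subgroup[OF ds i] additive_subgroup.zero_closed by fastforce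

text \<open>Uniqueness of the decomposition is expressed by the additive projections, existence by the fact that
  every additively closed set containing \<open>\<zero>\<close> and all \<open>D i\<close> is everything; so no finite sums occur
  when a direct sum has to be constructed.\<close>

lemma internal_direct_sumI:
  assumes sub: "\<And>i. i \<in> I \<Longrightarrow> additive_subgroup (D i) G"
    and span: "\<And>x S. x \<in> carrier G \<Longrightarrow> \<zero> \<in> S \<Longrightarrow> (\<And>a b. a \<in> S \<Longrightarrow> b \<in> S \<Longrightarrow> a \<oplus> b \<in> S) \<Longrightarrow>
      (\<And>i a. i \<in> I \<Longrightarrow> a \<in> D i \<Longrightarrow> a \<in> S) \<Longrightarrow> x \<in> S"
    and proj: "\<And>i. i \<in> I \<Longrightarrow> \<exists>p. p \<in> carrier G \<rightarrow> carrier G \<and>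
      (\<forall>x\<in>carrier G. \<forall>y\<in>carrier G. p (x \<oplus> y) = p x \<oplus> p y) \<and>
      (\<forall>x\<in>D i. p x = x) \<and> (\<forall>j\<in>I. j \<noteq> i \<longrightarrow> (\<forall>x\<in>D j. p x = \<zero>))"
  shows "internal_direct_sum G I D"
proof -
  have D: "\<And>i. i \<in> I \<Longrightarrow> D i \<subseteq> carrier G"
    using sub additive_subgroup.a_subset by blast
  have z: "\<zero> \<in> D i" if "i \<in> I" for i
    using sub[OF that] by (rule additive_subgroup.zero_closed)
  have c: "f i \<in> carrier G" if "f \<in> (\<Pi>\<^sub>E i\<in>I. D i)" "i \<in> I" for f i
    using that D by (auto simp: PiE_def Pi_def)
  have ex: "\<exists>f. dsum_rep G I D x f" if x: "x \<in> carrier G" for x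
  proof -
    \<comment> \<open>The set of representable elements takes the place of \<open>S\<close> in
      \<open>span\<close>.\<close>
    have "x \<in> {x. \<exists>f. dsum_rep G I D x f}"
    proof (rule span[OF x])
      have "dsum_rep G I D \<zero> (\<lambda>i\<in>I. \<zero>)"
        by (rule dsum_repI[where F = "{}"]) (use z D in auto)
      then show "\<zero> \<in> {x. \<exists>f. dsum_rep G I D x f}" by blast
    next
      fix a b assume "a \<in> {x. \<exists>f. dsum_rep G I D x f}" "b \<in> {x. \<exists>f. dsum_rep G I D x f}"
      then obtain f g where f: "dsum_rep G I D a f" and g: "dsum_rep G I D b g" by auto
      let ?F = "\<lambda>f. {i\<in>I. f i \<noteq> \<zero>}"
      have fin: "finite (?F f \<union> ?F g)" using f g unfolding dsum_rep_def by auto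
      have cc: "f i \<in> carrier G" "g i \<in> carrier G" if "i \<in> I" for i
        using c that f g unfolding dsum_rep_def by auto
      have "finsum G f (?F f) = finsum G f (?F f \<union> ?F g)"
        using fin cc by (intro add.finprod_mono_neutral_cong_left) auto
      then have sa: "a = finsum G f (?F f \<union> ?F g)" using f unfolding dsum_rep_def by auto
      have "finsum G g (?F g) = finsum G g (?F f \<union> ?F g)"
        using fin cc by (intro add.finprod_mono_neutral_cong_left) auto
      then have sb: "b = finsum G g (?F f \<union> ?F g)" using g unfolding dsum_rep_def by auto
      let ?f = "\<lambda>i\<in>I. f i \<oplus> g i"
      have "finsum G ?f (?F f \<union> ?F g) = finsum G (\<lambda>i. f i \<oplus> g i) (?F f \<union> ?F g)"
        using cc by (intro finsum_cong') auto
      also have "\<dots> = a \<oplus> b"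
        using cc by (subst finsum_addf) (auto simp flip: sa sb)
      finally have s: "a \<oplus> b = finsum G ?f (?F f \<union> ?F g)" by simp
      have "f i \<oplus> g i \<in> D i" if "i \<in> I" for i
        using that f g sub[OF that] unfolding dsum_rep_def
        by (auto intro!: additive_subgroup.a_closed simp: PiE_def Pi_def)
      then have "dsum_rep G I D (a \<oplus> b) ?f"
        by (intro dsum_repI[OF _ fin _ _ _ s]) (use D in auto)
      then show "a \<oplus> b \<in> {x. \<exists>f. dsum_rep G I D x f}" by blast
    next
      fix j a assume j: "j \<in> I" "a \<in> D j"
      let ?f = "\<lambda>i\<in>I. if i = j then a else \<zero>"
      have "dsum_rep G I D a ?f"
      proof (rule dsum_repI[where F = "{j}"])
        have "a \<in> carrier G" using j D by auto
        then show "a = finsum G ?f {j}" using j by (subst finsum_insert) auto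
      qed (use j z D in auto)
      then show "a \<in> {x. \<exists>f. dsum_rep G I D x f}" by blast
    qed
    then show ?thesis by blast
  qed
  have uniq: "f i = g i" if f: "dsum_rep G I D x f" and g: "dsum_rep G I D x g" and i: "i \<in> I" for x f g i
  proof -
    from proj[OF i] obtain p where p': "p \<in> carrier G \<rightarrow> carrier G \<and>
      (\<forall>x\<in>carrier G. \<forall>y\<in>carrier G. p (x \<oplus> y) = p x \<oplus> p y) \<and>
      (\<forall>x\<in>D i. p x = x) \<and> (\<forall>j\<in>I. j \<noteq> i \<longrightarrow> (\<forall>x\<in>D j. p x = \<zero>))" ..
    then have p: "p \<in> carrier G \<rightarrow> carrier G"
      "\<And>x y. x\<in>carrier G \<Longrightarrow> y\<in>carrier G \<Longrightarrow> p (x \<oplus> y) = p x \<oplus> p y"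
      "\<And>x. x \<in> D i \<Longrightarrow> p x = x" "\<And>j x. j \<in> I \<Longrightarrow> j \<noteq> i \<Longrightarrow> x \<in> D j \<Longrightarrow> p x = \<zero>"
      by simp_all
    \<comment> \<open>An additive \<open>p\<close> that is the identity on \<open>D i\<close> and
      zero on the other summands reads off the coefficient at \<open>i\<close>, so two
      representations of \<open>x\<close> agree there.\<close>
    have *: "p (finsum G h F) = (if i \<in> F then h i else \<zero>)"
      if "finite F" "F \<subseteq> I" "h \<in> (\<Pi>\<^sub>E i\<in>I. D i)" for h F
      using that
    proof (induction F rule: finite_induct)
      case empty
      then show ?case using p(3) z i by auto
    next
      case (insert a F)
      have h: "h \<in> F \<rightarrow> carrier G" "h a \<in> carrier G" "h a \<in> D a" "h i \<in> carrier G" "a \<in> I"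
        using insert c[OF insert.prems(2)] i by (auto simp: PiE_def Pi_def)
      have "p (finsum G h (insert a F)) = p (h a) \<oplus> p (finsum G h F)"
        using insert h by (simp add: p(2) finsum_insert)
      also have "p (finsum G h F) = (if i \<in> F then h i else \<zero>)" using insert by auto
      also have "p (h a) = (if a = i then h i else \<zero>)" using p h by auto
      finally show ?case using h insert.hyps by auto
    qed
    have "p x = h i" if "dsum_rep G I D x h" for h
    proof -
      have "x = finsum G h {i\<in>I. h i \<noteq> \<zero>}" using that unfolding dsum_rep_def by simp
      moreover have "p (finsum G h {i\<in>I. h i \<noteq> \<zero>}) = (if i \<in> {i\<in>I. h i \<noteq> \<zero>} then h i else \<zero>)"
        using that unfolding dsum_rep_def by (intro *) auto
      ultimately show ?thesis using i by auto
    qed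
    then show ?thesis using f g by metis
  qed
  have "f = g" if f: "dsum_rep G I D x f" and g: "dsum_rep G I D x g" for x f g
    using uniq[OF f g] f g unfolding dsum_rep_def by (meson PiE_ext)
  then have "\<exists>!f. dsum_rep G I D x f" if x: "x \<in> carrier G" for x
    using ex[OF x] by (meson ex1I)
  then show ?thesis
    unfolding internal_direct_sum_def dsum_rep_def using sub by simp
qed

end

section \<open>Graded modules and graded submodules\<close>

abbreviation rproj :: "('g, 'y) monoid_scheme \<Rightarrow> ('r, 'g) gring \<Rightarrow> 'g \<Rightarrow> 'r \<Rightarrow> 'r" where
  "rproj G R \<equiv> dproj R (carrier G) (rcomp R)"

abbreviation mproj :: "('g, 'y) monoid_scheme \<Rightarrow> ('r, 'm, 'g) gmod \<Rightarrow> 'g \<Rightarrow> 'm \<Rightarrow> 'm" where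
  "mproj G M \<equiv> dproj M (carrier G) (mcomp M)"

text \<open>Working form of \<open>graded_submodule\<close>, made of closure conditions only.
  Stability under the projections expresses that \<open>N\<close> is the sum of its intersections
  with the components; negatives come from the action of \<open>\<ominus> \<one>\<close>.\<close>

definition gr_closed ::
    "('g, 'y) monoid_scheme \<Rightarrow> ('r, 'g) gring \<Rightarrow> ('r, 'm, 'g) gmod \<Rightarrow> 'm set \<Rightarrow> bool" where
  "gr_closed G R M N \<longleftrightarrow> N \<subseteq> carrier M \<and> \<zero>\<^bsub>M\<^esub> \<in> N \<and> (\<forall>x\<in>N. \<forall>y\<in>N. x \<oplus>\<^bsub>M\<^esub> y \<in> N) \<and>
     (\<forall>a\<in>carrier R. \<forall>x\<in>N. a \<odot>\<^bsub>M\<^esub> x \<in> N) \<and> (\<forall>g\<in>carrier G. \<forall>x\<in>N. mproj G M g x \<in> N)"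

lemma restrict_gmod_simps [simp]:
  "carrier (restrict_gmod M N) = N" "add (restrict_gmod M N) = add M"
  "zero (restrict_gmod M N) = zero M" "smult (restrict_gmod M N) = smult M"
  "mcomp (restrict_gmod M N) g = N \<inter> mcomp M g"
  by (simp_all add: restrict_gmod_def)

lemma regular_gmod_simps [simp]:
  "carrier (regular_gmod R) = carrier R" "add (regular_gmod R) = add R"
  "zero (regular_gmod R) = zero R" "smult (regular_gmod R) = monoid.mult R"
  "mcomp (regular_gmod R) = rcomp R"
  by (simp_all add: regular_gmod_def)

lemma gr_shift_simps [simp]:
  "carrier (gr_shift G M \<sigma>) = carrier M" "add (gr_shift G M \<sigma>) = add M"
  "zero (gr_shift G M \<sigma>) = zero M" "smult (gr_shift G M \<sigma>) = smult M"
  "mcomp (gr_shift G M \<sigma>) g = mcomp M (g \<otimes>\<^bsub>G\<^esub> \<sigma>)"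
  by (simp_all add: gr_shift_def)

lemma dproj_regular_gmod [simp]: "dproj (regular_gmod R) = dproj R"
  by (intro ext) (simp add: dproj_ring_cong[of "regular_gmod R" R])

lemma dproj_gr_shift [simp]: "dproj (gr_shift G M \<sigma>) = dproj M"
  by (intro ext) (simp add: dproj_ring_cong[of "gr_shift G M \<sigma>" M])

lemma restrict_restrict_gmod:
  "A \<subseteq> N \<Longrightarrow> restrict_gmod (restrict_gmod M N) A = restrict_gmod M A"
  by (simp add: restrict_gmod_def Int_absorb2 inf.absorb1 flip: Int_assoc)

context graded_ring
begin

lemma rcomp_closed: "g \<in> carrier G \<Longrightarrow> a \<in> rcomp R g \<Longrightarrow> a \<in> carrier R"
  using dsum_closed[OF ring_decomp] .

lemma rproj_closed: "g \<in> carrier G \<Longrightarrow> a \<in> carrier R \<Longrightarrow> rproj G R g a \<in> carrier R"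
  using dproj_closed[OF ring_decomp] .

lemma rproj_in: "g \<in> carrier G \<Longrightarrow> a \<in> carrier R \<Longrightarrow> rproj G R g a \<in> rcomp R g"
  using dproj_in[OF ring_decomp] .

end

context graded_left_module
begin

lemma mcomp_closed: "g \<in> carrier G \<Longrightarrow> x \<in> mcomp M g \<Longrightarrow> x \<in> carrier M"
  using M.dsum_closed[OF module_decomp] .

lemma mproj_closed: "g \<in> carrier G \<Longrightarrow> x \<in> carrier M \<Longrightarrow> mproj G M g x \<in> carrier M"
  using M.dproj_closed[OF module_decomp] .

lemma mproj_in: "g \<in> carrier G \<Longrightarrow> x \<in> carrier M \<Longrightarrow> mproj G M g x \<in> mcomp M g"
  using M.dproj_in[OF module_decomp] .

lemma smult_l_null: "x \<in> carrier M \<Longrightarrow> \<zero> \<odot>\<^bsub>M\<^esub> x = \<zero>\<^bsub>M\<^esub>"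
  using smult_l_distr[of \<zero> \<zero> x] smult_closed[of \<zero> x] 
  by simp

lemma smult_r_null: "a \<in> carrier R \<Longrightarrow> a \<odot>\<^bsub>M\<^esub> \<zero>\<^bsub>M\<^esub> = \<zero>\<^bsub>M\<^esub>"
  using smult_r_distr[of a "\<zero>\<^bsub>M\<^esub>" "\<zero>\<^bsub>M\<^esub>"] smult_closed[of a "\<zero>\<^bsub>M\<^esub>"]
  by simp

lemma smult_minus_one: "x \<in> carrier M \<Longrightarrow> (\<ominus> \<one>) \<odot>\<^bsub>M\<^esub> x = \<ominus>\<^bsub>M\<^esub> x"
  using smult_l_distr[of "\<ominus> \<one>" \<one> x] smult_closed[of "\<ominus> \<one>" x]
  by (simp add: l_neg smult_l_null smult_one M.minus_equality)

text \<open>For \<open>a\<close> of degree \<open>k\<close> the product has degree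
  \<open>k h\<close>, and \<open>g = k h\<close> iff \<open>g h^-1 = k\<close>; the general case
  follows by additivity in \<open>a\<close>. Through this formula images and preimages under
  multiplication by a homogeneous element are seen to be graded.\<close>

lemma mproj_smult:
  assumes a: "a \<in> carrier R" and h: "h \<in> carrier G" "x \<in> mcomp M h" and g: "g \<in> carrier G"
  shows "mproj G M g (a \<odot>\<^bsub>M\<^esub> x) = rproj G R (g \<otimes>\<^bsub>G\<^esub> inv\<^bsub>G\<^esub> h) a \<odot>\<^bsub>M\<^esub> x"
  using ring_decomp a
proof (induction rule: dsum_induct)
  case zero
  then show ?case
    using h g by (simp add: smult_l_null mcomp_closed dproj_zero[OF ring_decomp] M.dproj_zero[OF module_decomp])
next
  case (add a b)
  have x: "x \<in> carrier M" using h mcomp_closed by blast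
  then show ?case
    using add h(1) g
    by (simp add: smult_l_distr smult_closed dproj_add[OF ring_decomp] M.dproj_add[OF module_decomp] rproj_closed)
next
  case (comp k a)
  have x: "x \<in> carrier M" using h mcomp_closed by blast
  have "a \<odot>\<^bsub>M\<^esub> x \<in> mcomp M (k \<otimes>\<^bsub>G\<^esub> h)" using comp h smult_comp by blast
  then have "mproj G M g (a \<odot>\<^bsub>M\<^esub> x) = (if g = k \<otimes>\<^bsub>G\<^esub> h then a \<odot>\<^bsub>M\<^esub> x else \<zero>\<^bsub>M\<^esub>)"
    using M.dproj_comp[OF module_decomp] g h comp by simp
  moreover have "g = k \<otimes>\<^bsub>G\<^esub> h \<longleftrightarrow> g \<otimes>\<^bsub>G\<^esub> inv\<^bsub>G\<^esub> h = k"
    using g h comp G.inv_solve_right by metis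
  ultimately show ?case
    using dproj_comp[OF ring_decomp _ comp(1) comp(2)] g h x by (simp add: smult_l_null)
qed

lemma abelian_group_restrict:
  assumes "gr_closed G R M N"
  shows "abelian_group (restrict_gmod M N)"
proof -
  note N = assms[unfolded gr_closed_def]
  show ?thesis
  proof (rule abelian_groupI; unfold restrict_gmod_simps)
    fix x assume x: "x \<in> N"
    then have "(\<ominus> \<one>) \<odot>\<^bsub>M\<^esub> x \<in> N" "x \<in> carrier M" using N by auto
    then show "\<exists>y\<in>N. y \<oplus>\<^bsub>M\<^esub> x = \<zero>\<^bsub>M\<^esub>" using smult_minus_one M.l_neg by metis
  qed (use N in \<open>auto simp: subset_iff M.a_ac\<close>)
qed

text \<open>The projections of \<open>M\<close> map \<open>N\<close> to itself: restricted to
  \<open>N\<close> they witness directness, and they put the components of an element of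
  \<open>N\<close> into \<open>N\<close>.\<close>

lemma graded_left_module_restrict:
  assumes "gr_closed G R M N"
  shows "graded_left_module G R (restrict_gmod M N)"
proof -
  note N = assms[unfolded gr_closed_def]
  interpret N: abelian_group "restrict_gmod M N" by (rule abelian_group_restrict[OF assms])
  have neg: "\<ominus>\<^bsub>M\<^esub> x \<in> N" if "x \<in> N" for x
  proof -
    have "(\<ominus> \<one>) \<odot>\<^bsub>M\<^esub> x \<in> N" "x \<in> carrier M" using N that by auto
    then show ?thesis using smult_minus_one by metis
  qed
  have sub: "N \<subseteq> carrier M" using N by simp
  have "internal_direct_sum (restrict_gmod M N) (carrier G) (mcomp (restrict_gmod M N))"
  proof (rule N.internal_direct_sumI; unfold restrict_gmod_simps)
    fix g assume g: "g \<in> carrier G"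
    interpret C: additive_subgroup "mcomp M g" M by (rule M.dsum_subgroup[OF module_decomp g])
    show "additive_subgroup (N \<inter> mcomp M g) (restrict_gmod M N)"
      unfolding N.additive_subgroup_iff restrict_gmod_simps
    proof (intro conjI ballI)
      fix x assume "x \<in> N \<inter> mcomp M g"
      then show "\<exists>y\<in>N \<inter> mcomp M g. x \<oplus>\<^bsub>M\<^esub> y = \<zero>\<^bsub>M\<^esub>"
        using neg sub by (intro bexI[of _ "\<ominus>\<^bsub>M\<^esub> x"]) (auto simp: M.r_neg)
    qed (use N in auto)
    have "mproj G M g x = \<zero>\<^bsub>M\<^esub>" if "h \<in> carrier G" "h \<noteq> g" "x \<in> mcomp M h" for h x
      using M.dproj_comp[OF module_decomp g that(1,3)] that by simp
    moreover have "mproj G M g x = x" if "x \<in> mcomp M g" for x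
      using M.dproj_comp[OF module_decomp g g that] by simp
    ultimately show "\<exists>p. p \<in> N \<rightarrow> N \<and> (\<forall>x\<in>N. \<forall>y\<in>N. p (x \<oplus>\<^bsub>M\<^esub> y) = p x \<oplus>\<^bsub>M\<^esub> p y) \<and>
        (\<forall>x\<in>N \<inter> mcomp M g. p x = x) \<and>
        (\<forall>j\<in>carrier G. j \<noteq> g \<longrightarrow> (\<forall>x\<in>N \<inter> mcomp M j. p x = \<zero>\<^bsub>M\<^esub>))"
      using N g sub by (intro exI[of _ "mproj G M g"]) (auto simp: subset_iff M.dproj_add[OF module_decomp])
  next
    fix x S assume x: "x \<in> N" and S: "\<zero>\<^bsub>M\<^esub> \<in> S" "\<And>a b. a \<in> S \<Longrightarrow> b \<in> S \<Longrightarrow> a \<oplus>\<^bsub>M\<^esub> b \<in> S"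
      "\<And>i a. i \<in> carrier G \<Longrightarrow> a \<in> N \<inter> mcomp M i \<Longrightarrow> a \<in> S"
    have xc: "x \<in> carrier M" using x sub by blast
    show "x \<in> S"
    proof (rule M.dsum_in[OF module_decomp xc])
      fix i assume i: "i \<in> carrier G"
      then have "mproj G M i x \<in> N \<inter> mcomp M i" using mproj_in xc x N by blast
      then show "mproj G M i x \<in> S" using S(3) i by blast
    qed (use S in auto)
  qed
  moreover have "a \<odot>\<^bsub>M\<^esub> x \<in> N" if "a \<in> carrier R" "x \<in> N" for a x using N that by blast
  ultimately show ?thesis
    using sub smult_comp N
    by (intro graded_left_module.intro graded_left_module_axioms.intro graded_ring_axioms N.abelian_group_axioms)
      (auto simp: smult_l_distr smult_r_distr smult_assoc smult_one subset_iff rcomp_closed)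
qed

text \<open>For the direction from left to right, a projection of \<open>M\<close> is the identity
  or zero on each \<open>N \<inter> mcomp M h\<close>, and every element of \<open>N\<close> is a
  sum of elements of these sets.\<close>

lemma graded_submodule_iff: "graded_submodule G R M N \<longleftrightarrow> gr_closed G R M N"
proof
  assume L: "graded_submodule G R M N"
  then have sub: "N \<subseteq> carrier M" unfolding graded_submodule_def by blast
  interpret N: graded_left_module G R "restrict_gmod M N"
    using L unfolding graded_submodule_def by blast
  have z: "\<zero>\<^bsub>M\<^esub> \<in> N" using N.M.zero_closed by simp
  have a: "x \<oplus>\<^bsub>M\<^esub> y \<in> N" if "x \<in> N" "y \<in> N" for x y using N.M.a_closed[of x y] that by simp
  have "mproj G M g x \<in> N" if x: "x \<in> N" and g: "g \<in> carrier G" for g x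
  proof -
    have "x \<in> carrier (restrict_gmod M N)" using x by simp
    with N.module_decomp show ?thesis
    proof (induction rule: N.M.dsum_induct)
      case zero
      then show ?case using M.dproj_zero[OF module_decomp g] z by simp
    next
      case (add x y)
      then have "x \<in> carrier M" "y \<in> carrier M" using sub by auto
      then show ?case using add a M.dproj_add[OF module_decomp _ _ g] by simp
    next
      case (comp h x)
      then have "x \<in> mcomp M h" "x \<in> N" by auto
      then show ?case using M.dproj_comp[OF module_decomp g comp(1)] z by simp
    qed
  qed
  then show "gr_closed G R M N"
    unfolding gr_closed_def using sub z a N.smult_closed by simp
next
  assume "gr_closed G R M N"
  then show "graded_submodule G R M N"
    unfolding graded_submodule_def by (simp add: graded_left_module_restrict gr_closed_def)
qed

end

lemma (in graded_ring) graded_left_module_regular: "graded_left_module G R (regular_gmod R)"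
proof (intro graded_left_module.intro graded_left_module_axioms.intro graded_ring_axioms)
  show "abelian_group (regular_gmod R)"
    using abelian_group_ring_cong[of "regular_gmod R" R] abelian_group_axioms by simp
  show "internal_direct_sum (regular_gmod R) (carrier G) (mcomp (regular_gmod R))"
    unfolding internal_direct_sum_ring_cong[of "regular_gmod R" R, simplified]
    using ring_decomp by simp
qed (auto simp: l_distr r_distr m_assoc ring_comp_mult)

section \<open>Graded left ideals and the graded Jacobson radical\<close>

abbreviation lgen :: "('r, 'z) ring_scheme \<Rightarrow> 'r \<Rightarrow> 'r set" where
  "lgen R x \<equiv> (\<lambda>a. a \<otimes>\<^bsub>R\<^esub> x) ` carrier R"

context abelian_group
begin

lemma minus_add_cancel: "\<lbrakk>x \<in> carrier G; y \<in> carrier G\<rbrakk> \<Longrightarrow> (x \<ominus> y) \<oplus> y = x"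
  by (simp add: a_minus_def a_assoc l_neg)

lemma add_minus_cancel_left: "\<lbrakk>x \<in> carrier G; y \<in> carrier G\<rbrakk> \<Longrightarrow> (x \<oplus> y) \<ominus> x = y"
  by (simp add: a_minus_def a_comm[of x y] a_assoc r_neg)

lemma minus_zero_right: "x \<in> carrier G \<Longrightarrow> x \<ominus> \<zero> = x"
  using minus_add_cancel[of x \<zero>] by simp

lemma minus_self: "x \<in> carrier G \<Longrightarrow> x \<ominus> x = \<zero>"
  by (simp add: a_minus_def r_neg)

end

context ring
begin

lemma l_distr_minus:
  "\<lbrakk>x \<in> carrier R; y \<in> carrier R; z \<in> carrier R\<rbrakk> \<Longrightarrow> (x \<ominus> y) \<otimes> z = x \<otimes> z \<ominus> y \<otimes> z"
  by (simp add: a_minus_def l_distr l_minus)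

lemma r_distr_minus:
  "\<lbrakk>x \<in> carrier R; y \<in> carrier R; z \<in> carrier R\<rbrakk> \<Longrightarrow> z \<otimes> (x \<ominus> y) = z \<otimes> x \<ominus> z \<otimes> y"
  by (simp add: a_minus_def r_distr r_minus)

end

context graded_ring
begin

lemma rproj_mult_right:
  "\<lbrakk>a \<in> carrier R; h \<in> carrier G; x \<in> rcomp R h; g \<in> carrier G\<rbrakk> \<Longrightarrow>
    rproj G R g (a \<otimes> x) = rproj G R (g \<otimes>\<^bsub>G\<^esub> inv\<^bsub>G\<^esub> h) a \<otimes> x"
  using graded_left_module.mproj_smult[OF graded_left_module_regular, of a h x g]
  by simp

lemma rproj_add:
  "\<lbrakk>x \<in> carrier R; y \<in> carrier R; g \<in> carrier G\<rbrakk> \<Longrightarrow> rproj G R g (x \<oplus> y) = rproj G R g x \<oplus> rproj G R g y"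
  using dproj_add[OF ring_decomp] .

lemma rproj_comp:
  "\<lbrakk>g \<in> carrier G; h \<in> carrier G; x \<in> rcomp R h\<rbrakk> \<Longrightarrow> rproj G R g x = (if g = h then x else \<zero>)"
  using dproj_comp[OF ring_decomp] .

lemma rproj_zero: "g \<in> carrier G \<Longrightarrow> rproj G R g \<zero> = \<zero>"
  using dproj_zero[OF ring_decomp] .

lemma rcomp_minus:
  "\<lbrakk>g \<in> carrier G; x \<in> rcomp R g; y \<in> rcomp R g\<rbrakk> \<Longrightarrow> x \<ominus> y \<in> rcomp R g"
  using dsum_subgroup[OF ring_decomp, of g] 
  by (simp add: a_minus_def additive_subgroup.a_closed additive_subgroup.a_inv_closed)

text \<open>The degree-one component \<open>u\<close> of \<open>\<one>\<close> is a left identity: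
  for \<open>x\<close> of degree \<open>h\<close>, comparing the components of degree
  \<open>h\<close> in \<open>x = \<one> x\<close> gives \<open>x = u x\<close>. Hence
  \<open>u = \<one>\<close>.\<close>

lemma one_in_rcomp: "\<one> \<in> rcomp R \<one>\<^bsub>G\<^esub>"
proof -
  let ?u = "rproj G R \<one>\<^bsub>G\<^esub> \<one>"
  have u: "?u \<in> carrier R" using rproj_closed by simp
  have "?u \<otimes> x = x" if "x \<in> carrier R" for x
    using ring_decomp that
  proof (induction rule: dsum_induct)
    case (comp h x)
    then have x: "x \<in> carrier R" using rcomp_closed by blast
    have "x = rproj G R h (\<one> \<otimes> x)" using comp x rproj_comp by simp
    also have "\<dots> = ?u \<otimes> x" using rproj_mult_right[OF one_closed comp(1,2,1)] comp by simp
    finally show ?case by simp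
  qed (use u in \<open>auto simp: r_distr\<close>)
  then have "?u = \<one>" using u r_one one_closed by metis
  then show ?thesis using rproj_in[of "\<one>\<^bsub>G\<^esub>" \<one>] by simp
qed

lemma gli_iff:
  "graded_left_ideal G R I \<longleftrightarrow> I \<subseteq> carrier R \<and> \<zero> \<in> I \<and> (\<forall>x\<in>I. \<forall>y\<in>I. x \<oplus> y \<in> I) \<and>
     (\<forall>a\<in>carrier R. \<forall>x\<in>I. a \<otimes> x \<in> I) \<and> (\<forall>g\<in>carrier G. \<forall>x\<in>I. rproj G R g x \<in> I)"
  using graded_left_module.graded_submodule_iff[OF graded_left_module_regular]
  by (simp add: gr_closed_def)

lemma gli_subset: "graded_left_ideal G R I \<Longrightarrow> I \<subseteq> carrier R"
  and gli_zero: "graded_left_ideal G R I \<Longrightarrow> \<zero> \<in> I"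
  and gli_add: "graded_left_ideal G R I \<Longrightarrow> x \<in> I \<Longrightarrow> y \<in> I \<Longrightarrow> x \<oplus> y \<in> I"
  and gli_mult: "graded_left_ideal G R I \<Longrightarrow> a \<in> carrier R \<Longrightarrow> x \<in> I \<Longrightarrow> a \<otimes> x \<in> I"
  and gli_proj: "graded_left_ideal G R I \<Longrightarrow> g \<in> carrier G \<Longrightarrow> x \<in> I \<Longrightarrow> rproj G R g x \<in> I"
  unfolding gli_iff by blast+

lemma gli_closed: "graded_left_ideal G R I \<Longrightarrow> x \<in> I \<Longrightarrow> x \<in> carrier R"
  using gli_subset by blast

lemma gli_uminus: "graded_left_ideal G R I \<Longrightarrow> x \<in> I \<Longrightarrow> \<ominus> x \<in> I"
  using gli_mult[of I "\<ominus> \<one>" x] gli_closed[of I x] by (simp add: l_minus)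

lemma gli_minus: "graded_left_ideal G R I \<Longrightarrow> x \<in> I \<Longrightarrow> y \<in> I \<Longrightarrow> x \<ominus> y \<in> I"
  by (simp add: a_minus_def gli_uminus gli_add)

lemma gli_one: "graded_left_ideal G R I \<Longrightarrow> \<one> \<in> I \<Longrightarrow> I = carrier R"
  using gli_mult[of I _ \<one>] gli_subset[of I] by fastforce

lemma gli_carrier: "graded_left_ideal G R (carrier R)"
  unfolding gli_iff by (auto simp: rproj_closed)

lemma gli_zero_set: "graded_left_ideal G R {\<zero>}"
  unfolding gli_iff by (auto simp: rproj_zero)

lemma gli_Int: "graded_left_ideal G R I \<Longrightarrow> graded_left_ideal G R K \<Longrightarrow> graded_left_ideal G R (I \<inter> K)"
  unfolding gli_iff by blast

lemma gli_sum:
  assumes I: "graded_left_ideal G R I" and K: "graded_left_ideal G R K"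
  shows "graded_left_ideal G R (I <+>\<^bsub>R\<^esub> K)"
proof -
  note c = gli_closed[OF I] gli_closed[OF K]
  have 1: "(i \<oplus> k) \<oplus> (i' \<oplus> k') = (i \<oplus> i') \<oplus> (k \<oplus> k')" if "i \<in> I" "i' \<in> I" "k \<in> K" "k' \<in> K" for i i' k k'
    using that c by (simp add: a_ac)
  have "x \<oplus> y \<in> I <+>\<^bsub>R\<^esub> K" if "x \<in> I <+>\<^bsub>R\<^esub> K" "y \<in> I <+>\<^bsub>R\<^esub> K" for x y
    using that 1 gli_add[OF I] gli_add[OF K] unfolding set_add_def' by clarsimp blast
  moreover have "a \<otimes> x \<in> I <+>\<^bsub>R\<^esub> K" if "a \<in> carrier R" "x \<in> I <+>\<^bsub>R\<^esub> K" for a x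
    using that gli_mult[OF I] gli_mult[OF K] c r_distr unfolding set_add_def' by clarsimp blast
  moreover have "rproj G R g x \<in> I <+>\<^bsub>R\<^esub> K" if "g \<in> carrier G" "x \<in> I <+>\<^bsub>R\<^esub> K" for g x
    using that gli_proj[OF I] gli_proj[OF K] c rproj_add unfolding set_add_def' by clarsimp blast
  moreover have "\<zero> \<in> I <+>\<^bsub>R\<^esub> K" using gli_zero I K unfolding set_add_def' by force
  ultimately show ?thesis unfolding gli_iff using c unfolding set_add_def' by auto
qed

text \<open>The component of \<open>a x\<close> in degree \<open>g\<close> is the component of
  \<open>a\<close> in degree \<open>g h^-1\<close>, times \<open>x\<close>; this is where
  homogeneity of \<open>x\<close> enters.\<close>

lemma gli_image:
  assumes C: "graded_left_ideal G R C" and h: "h \<in> carrier G" "x \<in> rcomp R h"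
  shows "graded_left_ideal G R ((\<lambda>a. a \<otimes> x) ` C)"
proof -
  have x: "x \<in> carrier R" using h rcomp_closed by blast
  show ?thesis unfolding gli_iff
  proof (intro conjI ballI; (elim imageE)?)
    show "\<zero> \<in> (\<lambda>a. a \<otimes> x) ` C" using x gli_zero[OF C] by (intro image_eqI[of _ _ \<zero>]) auto
  next
    fix u v a b assume "u = a \<otimes> x" "v = b \<otimes> x" "a \<in> C" "b \<in> C"
    then show "u \<oplus> v \<in> (\<lambda>a. a \<otimes> x) ` C"
      using x gli_add[OF C] gli_closed[OF C] by (intro image_eqI[of _ _ "a \<oplus> b"]) (auto simp: l_distr)
  next
    fix u a b assume "b \<in> carrier R" "u = a \<otimes> x" "a \<in> C"
    then show "b \<otimes> u \<in> (\<lambda>a. a \<otimes> x) ` C"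
      using x gli_mult[OF C] gli_closed[OF C] by (intro image_eqI[of _ _ "b \<otimes> a"]) (auto simp: m_assoc)
  next
    fix g u a assume g: "g \<in> carrier G" and a: "u = a \<otimes> x" "a \<in> C"
    then show "rproj G R g u \<in> (\<lambda>a. a \<otimes> x) ` C"
      using rproj_mult_right[OF gli_closed[OF C a(2)] h g] gli_proj[OF C] h
      by (intro image_eqI[of _ _ "rproj G R (g \<otimes>\<^bsub>G\<^esub> inv\<^bsub>G\<^esub> h) a"]) auto
  qed (use x gli_closed[OF C] in auto)
qed

lemma gli_lgen: "h \<in> carrier G \<Longrightarrow> x \<in> rcomp R h \<Longrightarrow> graded_left_ideal G R (lgen R x)"
  by (rule gli_image[OF gli_carrier])

lemma gli_colon:
  assumes I: "graded_left_ideal G R I" and h: "h \<in> carrier G" "x \<in> rcomp R h"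
  shows "graded_left_ideal G R {r \<in> carrier R. r \<otimes> x \<in> I}"
proof -
  have x: "x \<in> carrier R" using h rcomp_closed by blast
  have "rproj G R g r \<otimes> x \<in> I" if "g \<in> carrier G" "r \<in> carrier R" "r \<otimes> x \<in> I" for g r
  proof -
    \<comment> \<open>Reading \<open>r x\<close> in degree \<open>g h\<close> isolates the component
      of \<open>r\<close> in degree \<open>g\<close>.\<close>
    have "rproj G R (g \<otimes>\<^bsub>G\<^esub> h) (r \<otimes> x) = rproj G R (g \<otimes>\<^bsub>G\<^esub> h \<otimes>\<^bsub>G\<^esub> inv\<^bsub>G\<^esub> h) r \<otimes> x"
      using rproj_mult_right[of r h x "g \<otimes>\<^bsub>G\<^esub> h"] that h by simp
    also have "g \<otimes>\<^bsub>G\<^esub> h \<otimes>\<^bsub>G\<^esub> inv\<^bsub>G\<^esub> h = g" using that h by (simp add: G.m_assoc)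
    finally show ?thesis using gli_proj[OF I, of "g \<otimes>\<^bsub>G\<^esub> h"] that h by fastforce
  qed
  then show ?thesis unfolding gli_iff
    using x gli_zero[OF I] by (auto simp: l_distr m_assoc rproj_closed gli_add[OF I] gli_mult[OF I])
qed

section \<open>Maximal graded left ideals\<close>

lemma exists_maximal_gli:
  assumes I: "graded_left_ideal G R I" "I \<noteq> carrier R"
  shows "\<exists>K. maximal_graded_left_ideal G R K \<and> I \<subseteq> K"
proof -
  \<comment> \<open>Properness is expressed as \<open>\<one> \<notin> K\<close>, a condition that
    survives unions of chains.\<close>
  let ?A = "{K. graded_left_ideal G R K \<and> I \<subseteq> K \<and> \<one> \<notin> K}"
  have "\<exists>M\<in>?A. \<forall>X\<in>?A. M \<subseteq> X \<longrightarrow> X = M"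
  proof (rule subset_Zorn_nonempty)
    have "I \<in> ?A" using I gli_one[OF I(1)] by auto
    then show "?A \<noteq> {}" by blast
  next
    fix C assume C: "C \<noteq> {}" "subset.chain ?A C"
    then have CA: "\<And>K. K \<in> C \<Longrightarrow> graded_left_ideal G R K \<and> I \<subseteq> K \<and> \<one> \<notin> K"
      unfolding subset_chain_def by blast
    have ch: "\<And>K L. K \<in> C \<Longrightarrow> L \<in> C \<Longrightarrow> K \<subseteq> L \<or> L \<subseteq> K"
      using C(2) unfolding subset_chain_def by blast
    have a: "x \<oplus> y \<in> \<Union>C" if xy: "x \<in> K" "y \<in> L" "K \<in> C" "L \<in> C" for x y K L
    proof -
      from ch[OF xy(3,4)] obtain N where "x \<in> N" "y \<in> N" "N \<in> C" using xy by blast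
      then have "x \<oplus> y \<in> N" using gli_add CA[of N] by simp
      then show ?thesis using \<open>N \<in> C\<close> by blast
    qed
    have "graded_left_ideal G R (\<Union>C)"
      unfolding gli_iff
    proof (intro conjI ballI)
      show "\<Union>C \<subseteq> carrier R" using CA gli_subset by (simp add: Sup_le_iff)
      show "\<zero> \<in> \<Union>C" using C(1) CA by (auto intro: gli_zero)
    next
      fix x y assume "x \<in> \<Union>C" "y \<in> \<Union>C" then show "x \<oplus> y \<in> \<Union>C" using a by blast
    next
      fix b x assume "b \<in> carrier R" "x \<in> \<Union>C" then show "b \<otimes> x \<in> \<Union>C" using CA by (auto intro: gli_mult)
    next
      fix g x assume "g \<in> carrier G" "x \<in> \<Union>C" then show "rproj G R g x \<in> \<Union>C" using CA by (auto intro: gli_proj)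
    qed
    then show "\<Union>C \<in> ?A" using C(1) CA by blast
  qed
  then obtain M where M': "M \<in> ?A" "\<forall>X\<in>?A. M \<subseteq> X \<longrightarrow> X = M" ..
  then have M: "graded_left_ideal G R M" "I \<subseteq> M" "\<one> \<notin> M"
    and max: "\<And>X. graded_left_ideal G R X \<Longrightarrow> I \<subseteq> X \<Longrightarrow> \<one> \<notin> X \<Longrightarrow> M \<subseteq> X \<Longrightarrow> X = M"
    by simp_all
  have "maximal_graded_left_ideal G R M"
    unfolding maximal_graded_left_ideal_def
  proof (intro conjI allI impI)
    fix K assume K: "graded_left_ideal G R K \<and> M \<subseteq> K"
    show "K = M \<or> K = carrier R"
      using max[of K] gli_one[of K] K M(2) by (cases "\<one> \<in> K") auto
  qed (use M one_closed in auto)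
  then show ?thesis using M(2) by blast
qed

lemma maximal_gli_D:
  assumes "maximal_graded_left_ideal G R I"
  shows "graded_left_ideal G R I" "\<one> \<notin> I"
  using assms gli_one unfolding maximal_graded_left_ideal_def by blast+

lemma maximal_gli_sum:
  assumes I: "maximal_graded_left_ideal G R I" and U: "graded_left_ideal G R U" "\<not> U \<subseteq> I"
    and x: "x \<in> carrier R"
  obtains u i where "u \<in> U" "i \<in> I" "x = u \<oplus> i"
proof -
  note I' = maximal_gli_D(1)[OF I]
  have "I \<subseteq> U <+>\<^bsub>R\<^esub> I"
    unfolding set_add_def' using gli_zero[OF U(1)] gli_closed[OF I'] by force
  moreover have "U \<subseteq> U <+>\<^bsub>R\<^esub> I"
    unfolding set_add_def' using gli_zero[OF I'] gli_closed[OF U(1)] by force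
  ultimately have "U <+>\<^bsub>R\<^esub> I = carrier R"
    using I gli_sum[OF U(1) I'] U(2) unfolding maximal_graded_left_ideal_def by blast
  then show ?thesis using x that unfolding set_add_def' by blast
qed

section \<open>The graded Jacobson radical as a two-sided ideal\<close>

abbreviation J where "J \<equiv> gr_jacobson G R"

lemma J_subset_maximal: "maximal_graded_left_ideal G R I \<Longrightarrow> J \<subseteq> I"
  unfolding gr_jacobson_def by blast

lemma not_in_J: 
  assumes "x \<in> carrier R" "x \<notin> J"
  obtains I where "maximal_graded_left_ideal G R I" "x \<notin> I"
  using assms unfolding gr_jacobson_def by blast

lemma gli_J: "graded_left_ideal G R J"
proof -
  have g: "graded_left_ideal G R I" if "maximal_graded_left_ideal G R I" for I
    using that maximal_gli_D by blast
  show ?thesis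
    unfolding gli_iff gr_jacobson_def
    using g gli_zero gli_add gli_mult gli_proj by (auto simp: rproj_closed)
qed

lemma J_closed: "x \<in> J \<Longrightarrow> x \<in> carrier R"
  using gli_closed[OF gli_J] .

text \<open>Conceptually, \<open>r \<mapsto> r a\<close> identifies \<open>R\<close> modulo this
  ideal with a shift of the graded simple module \<open>R/I\<close>. The proof is
  elementwise.\<close>

lemma maximal_gli_colon:
  assumes I: "maximal_graded_left_ideal G R I" and h: "h \<in> carrier G" "a \<in> rcomp R h" and a: "a \<notin> I"
  shows "maximal_graded_left_ideal G R {r \<in> carrier R. r \<otimes> a \<in> I}" (is "maximal_graded_left_ideal G R ?K")
  unfolding maximal_graded_left_ideal_def
proof (intro conjI allI impI)
  note I' = maximal_gli_D(1)[OF I]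
  have ac: "a \<in> carrier R" using h rcomp_closed by blast
  show K0: "graded_left_ideal G R ?K" by (rule gli_colon[OF I' h])
  have "\<one> \<notin> ?K" using a ac by simp
  then show "?K \<noteq> carrier R" using one_closed by blast
  fix K assume K: "graded_left_ideal G R K \<and> ?K \<subseteq> K"
  then have K': "graded_left_ideal G R K" by blast
  show "K = ?K \<or> K = carrier R"
  proof (cases "K \<subseteq> ?K")
    case False
    then obtain k where k: "k \<in> K" "k \<notin> ?K" by blast
    then have kc: "k \<in> carrier R" using gli_closed[OF K'] by blast
    \<comment> \<open>Some homogeneous component of \<open>k\<close> already lies outside
      \<open>?K\<close>; it replaces \<open>k\<close> so that the left ideal generated by
      \<open>k a\<close> is graded.\<close>
    have "\<exists>g\<in>carrier G. rproj G R g k \<notin> ?K"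
    proof (rule ccontr)
      assume "\<not> ?thesis"
      then have "k \<in> ?K"
        using gli_zero[OF K0] gli_add[OF K0] by (intro dsum_in[OF ring_decomp kc]) blast+
      then show False using k by blast
    qed
    then obtain g where g: "g \<in> carrier G" "rproj G R g k \<notin> ?K" by blast
    let ?k = "rproj G R g k"
    have k': "?k \<in> K" "?k \<in> carrier R" "?k \<in> rcomp R g"
      using g kc k gli_proj[OF K'] rproj_closed rproj_in by auto
    have "?k \<otimes> a \<notin> I" using g k' by simp
    moreover have "?k \<otimes> a \<in> lgen R (?k \<otimes> a)" using k' ac by (intro image_eqI[of _ _ \<one>]) auto
    moreover have "graded_left_ideal G R (lgen R (?k \<otimes> a))"
      by (rule gli_lgen[of "g \<otimes>\<^bsub>G\<^esub> h"]) (use g h k' ring_comp_mult in auto)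
    ultimately obtain u i where u: "u \<in> lgen R (?k \<otimes> a)" "i \<in> I" "\<one> = u \<oplus> i"
      using maximal_gli_sum[OF I _ _ one_closed] by blast
    then obtain r where r: "r \<in> carrier R" "u = r \<otimes> (?k \<otimes> a)" by blast
    have ic: "i \<in> carrier R" using u gli_closed[OF I'] by blast
    \<comment> \<open>Multiplying \<open>\<one> = r k a + i\<close> by \<open>a\<close> on the left
      shows \<open>(\<one> - a r k) a = a i \<in> I\<close>. So \<open>\<one> - a r k\<close> lies
      in \<open>?K\<close>, hence in \<open>K\<close>, and together with
      \<open>a r k \<in> K\<close> this yields \<open>\<one> \<in> K\<close>.\<close>
    have "a = a \<otimes> (r \<otimes> (?k \<otimes> a) \<oplus> i)" using u(3) r(2) r_one[OF ac] by metis
    also have "\<dots> = a \<otimes> r \<otimes> ?k \<otimes> a \<oplus> a \<otimes> i" using ac r k' ic by (simp add: r_distr m_assoc)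
    finally have "a \<ominus> a \<otimes> r \<otimes> ?k \<otimes> a = a \<otimes> i"
      using ac r(1) k' ic add_minus_cancel_left by (metis m_closed)
    then have "(\<one> \<ominus> a \<otimes> r \<otimes> ?k) \<otimes> a = a \<otimes> i"
      using ac r(1) k' by (simp add: l_distr_minus)
    also have "\<dots> \<in> I" using gli_mult[OF I' ac u(2)] .
    finally have "\<one> \<ominus> a \<otimes> r \<otimes> ?k \<in> K" using ac r(1) k' K by auto
    moreover have "a \<otimes> r \<otimes> ?k \<in> K" using gli_mult[OF K'] ac r(1) k' by simp
    ultimately have "(\<one> \<ominus> a \<otimes> r \<otimes> ?k) \<oplus> a \<otimes> r \<otimes> ?k \<in> K" using gli_add[OF K'] by blast
    then have "\<one> \<in> K" using ac r(1) k' by (simp add: minus_add_cancel)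
    then show ?thesis using gli_one[OF K'] by blast
  qed (use K in blast)
qed

text \<open>For homogeneous \<open>a\<close>: if \<open>x a\<close> avoids a maximal
  \<open>I\<close>, then so does \<open>a\<close>, and \<open>maximal_gli_colon\<close> makes the
  ideal of all \<open>r\<close> with \<open>r a \<in> I\<close> maximal; it contains
  \<open>J\<close> and hence \<open>x\<close>, a contradiction.\<close>

lemma J_mult_right:
  assumes x: "x \<in> J" and a: "a \<in> carrier R"
  shows "x \<otimes> a \<in> J"
  using ring_decomp a
proof (induction rule: dsum_induct)
  case zero
  then show ?case using x gli_zero[OF gli_J] J_closed by simp
next
  case (add a b)
  then show ?case using x J_closed gli_add[OF gli_J] by (simp add: r_distr)
next
  case (comp h a)
  have ac: "a \<in> carrier R" and xc: "x \<in> carrier R" using comp rcomp_closed x J_closed by auto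
  show ?case
  proof (rule ccontr)
    assume "x \<otimes> a \<notin> J"
    then obtain I where I: "maximal_graded_left_ideal G R I" "x \<otimes> a \<notin> I"
      using not_in_J xc ac by blast
    then have "a \<notin> I" using gli_mult maximal_gli_D xc by blast
    then have "x \<in> {r \<in> carrier R. r \<otimes> a \<in> I}"
      using J_subset_maximal[OF maximal_gli_colon[OF I(1) comp]] x by blast
    then show False using I by blast
  qed
qed

lemma ideal_J: "ideal J R"
proof (rule idealI)
  show "ring R" by (rule ring_axioms)
  have "additive_subgroup J R"
    unfolding additive_subgroup_iff
    using gli_subset[OF gli_J] gli_zero[OF gli_J] gli_add[OF gli_J] gli_uminus[OF gli_J] r_neg J_closed by blast
  then show "subgroup J (add_monoid R)" by (simp add: additive_subgroup_def)
qed (auto intro: J_mult_right gli_mult[OF gli_J])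

text \<open>As \<open>(\<one> - e) e = \<zero>\<close> and \<open>e \<noteq> \<zero>\<close>, the
  ideal \<open>R (\<one> - e)\<close> is proper and lies in a maximal one. If \<open>e\<close> were
  in \<open>J\<close>, that maximal ideal would contain \<open>e\<close> too, hence
  \<open>\<one>\<close>.\<close>

lemma idem_notin_J:
  assumes e: "e \<in> rcomp R \<one>\<^bsub>G\<^esub>" "e \<otimes> e = e" "e \<noteq> \<zero>"
  shows "e \<notin> J"
proof
  assume eJ: "e \<in> J"
  have ec: "e \<in> carrier R" using e rcomp_closed by blast
  have f: "\<one> \<ominus> e \<in> rcomp R \<one>\<^bsub>G\<^esub>" using e one_in_rcomp rcomp_minus by simp
  have "\<one> \<notin> lgen R (\<one> \<ominus> e)"
  proof
    assume "\<one> \<in> lgen R (\<one> \<ominus> e)"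
    then obtain r where r: "r \<in> carrier R" "\<one> = r \<otimes> (\<one> \<ominus> e)" by blast
    then have "e = r \<otimes> (\<one> \<ominus> e) \<otimes> e" using ec by (metis l_one)
    also have "\<dots> = r \<otimes> ((\<one> \<ominus> e) \<otimes> e)" using r(1) ec by (simp add: m_assoc)
    also have "(\<one> \<ominus> e) \<otimes> e = \<zero>" using ec e by (simp add: l_distr_minus minus_self)
    finally show False using r e by simp
  qed
  then have "lgen R (\<one> \<ominus> e) \<noteq> carrier R" using one_closed by blast
  then obtain I where I: "maximal_graded_left_ideal G R I" "lgen R (\<one> \<ominus> e) \<subseteq> I"
    using exists_maximal_gli gli_lgen[OF _ f] G.one_closed by blast
  have "\<one> \<ominus> e \<in> lgen R (\<one> \<ominus> e)" using ec by (intro image_eqI[of _ _ \<one>]) auto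
  then have "(\<one> \<ominus> e) \<oplus> e \<in> I"
    using I(2) eJ J_subset_maximal[OF I(1)] gli_add[OF maximal_gli_D(1)[OF I(1)]] by blast
  moreover have "(\<one> \<ominus> e) \<oplus> e = \<one>" using ec by (simp add: a_minus_def a_assoc l_neg)
  ultimately show False using maximal_gli_D(2)[OF I(1)] by simp
qed

text \<open>The chain condition turned into a minimum condition: strict inclusion on
  \<open>S\<close> is well-founded.\<close>

lemma minimal_gli:
  assumes art: "gr_left_artinian G R" and S: "N0 \<in> S" "\<And>N. N \<in> S \<Longrightarrow> graded_left_ideal G R N"
  obtains N where "N \<in> S" "\<And>K. K \<in> S \<Longrightarrow> K \<subseteq> N \<Longrightarrow> K = N"
proof -
  let ?r = "{(A, B). A \<in> S \<and> B \<in> S \<and> A \<subset> B}"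
  have "wf ?r"
    unfolding wf_iff_no_infinite_down_chain
  proof
    assume "\<exists>f. \<forall>i. (f (Suc i), f i) \<in> ?r"
    then obtain f where f': "\<forall>i. (f (Suc i), f i) \<in> ?r" ..
    then have f: "\<And>i. f i \<in> S" "\<And>i. f (Suc i) \<subset> f i" by auto
    then have "\<exists>n. \<forall>k\<ge>n. f k = f n"
      using art S(2) unfolding gr_left_artinian_def by (metis psubset_imp_subset)
    then show False using f(2) by (metis le_Suc_eq order_refl psubset_eq)
  qed
  from this[unfolded wf_eq_minimal, rule_format, OF S(1)] obtain N where N: "N \<in> S" "\<forall>K. (K, N) \<in> ?r \<longrightarrow> K \<notin> S" ..
  have "K = N" if "K \<in> S" "K \<subseteq> N" for K using N(1) N(2)[rule_format, of K] \<open>K \<in> S\<close> \<open>K \<subseteq> N\<close> by auto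
  with N(1) show ?thesis by (rule that)
qed

end

section \<open>Primitive idempotents of degree one\<close>

text \<open>The idempotents \<open>f\<close> tested are those of degree one in the corner
  \<open>e R e\<close>. By \<open>gr_indecomposable_lgen_iff\<close> this captures graded
  indecomposability of \<open>R e\<close>.\<close>

definition primitive_idem :: "('g, 'y) monoid_scheme \<Rightarrow> ('r, 'g) gring \<Rightarrow> 'r \<Rightarrow> bool" where
  "primitive_idem G R e \<longleftrightarrow> e \<in> rcomp R \<one>\<^bsub>G\<^esub> \<and> e \<otimes>\<^bsub>R\<^esub> e = e \<and> e \<noteq> \<zero>\<^bsub>R\<^esub> \<and>
     (\<forall>f\<in>rcomp R \<one>\<^bsub>G\<^esub>. f \<otimes>\<^bsub>R\<^esub> f = f \<and> e \<otimes>\<^bsub>R\<^esub> f = f \<and> f \<otimes>\<^bsub>R\<^esub> e = f \<longrightarrow> f = \<zero>\<^bsub>R\<^esub> \<or> f = e)"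

lemma graded_submodule_restrict:
  assumes "N \<subseteq> carrier M"
  shows "graded_submodule G R (restrict_gmod M N) A \<longleftrightarrow> A \<subseteq> N \<and> graded_submodule G R M A"
proof (cases "A \<subseteq> N")
  case True
  then show ?thesis using assms
    by (auto simp: graded_submodule_def restrict_restrict_gmod)
qed (simp add: graded_submodule_def)

context graded_ring
begin

lemma rcomp_mult_deg_one:
  "\<lbrakk>a \<in> rcomp R \<one>\<^bsub>G\<^esub>; b \<in> rcomp R \<one>\<^bsub>G\<^esub>\<rbrakk> \<Longrightarrow> a \<otimes> b \<in> rcomp R \<one>\<^bsub>G\<^esub>"
  using ring_comp_mult[of "\<one>\<^bsub>G\<^esub>" "\<one>\<^bsub>G\<^esub>" a b] by simp

lemma lgen_idem_iff:
  assumes "e \<in> carrier R" "e \<otimes> e = e"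
  shows "x \<in> lgen R e \<longleftrightarrow> x \<in> carrier R \<and> x \<otimes> e = x"
proof
  assume "x \<in> lgen R e"
  then show "x \<in> carrier R \<and> x \<otimes> e = x" using assms by (auto simp: m_assoc)
next
  assume "x \<in> carrier R \<and> x \<otimes> e = x"
  then show "x \<in> lgen R e" by (intro image_eqI[of _ _ x]) auto
qed

lemma primitive_idemD:
  assumes "primitive_idem G R e"
  shows "e \<in> rcomp R \<one>\<^bsub>G\<^esub>" "e \<in> carrier R" "e \<otimes> e = e" "e \<noteq> \<zero>" "graded_left_ideal G R (lgen R e)"
    "e \<in> lgen R e"
proof -
  show e: "e \<in> rcomp R \<one>\<^bsub>G\<^esub>" and i: "e \<otimes> e = e" and "e \<noteq> \<zero>"
    using assms by (auto simp: primitive_idem_def)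
  then show c: "e \<in> carrier R" and "graded_left_ideal G R (lgen R e)" 
    using rcomp_closed[OF G.one_closed e] gli_lgen[OF G.one_closed e] by auto
  show "e \<in> lgen R e" unfolding lgen_idem_iff[OF c i] using c i by simp
qed

lemma primitive_idem_cases:
  assumes "primitive_idem G R e" "f \<in> rcomp R \<one>\<^bsub>G\<^esub>" "f \<otimes> f = f" "e \<otimes> f = f" "f \<otimes> e = f"
  shows "f = \<zero> \<or> f = e"
  using assms by (auto simp: primitive_idem_def)

text \<open>In the proof \<open>e = x + y\<close> with \<open>x \<in> N\<close>, \<open>y \<in> L\<close>, and \<open>p \<mapsto> (p x, p y)\<close> splits the sum map
  \<open>N \<oplus> L \<rightarrow> R e\<close>. Its image is everything: the two minimality arguments show that first all of \<open>N\<close> and then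
  all of \<open>L\<close> is reached. Hence \<open>y = q y\<close> for some \<open>q\<close> with \<open>q x = 0\<close>, so \<open>q e = y\<close> and \<open>y\<close> is idempotent.\<close>

lemma primitive_supplement:
  assumes art: "gr_left_artinian G R" and prim: "primitive_idem G R e"
    and U: "graded_left_ideal G R U" "U \<subseteq> lgen R e" and V: "graded_left_ideal G R V" "V \<subseteq> lgen R e"
    and uv: "u \<in> U" "v \<in> V" "e = u \<oplus> v"
  shows "e \<in> U \<or> e \<in> V"
proof -
  note e = primitive_idemD[OF prim]
  let ?A = "{N. graded_left_ideal G R N \<and> N \<subseteq> U \<and> (\<exists>n\<in>N. \<exists>v\<in>V. e = n \<oplus> v)}"
  have "U \<in> ?A" using U uv by blast
  then obtain N where NA: "N \<in> ?A" and Nmin0: "\<And>K. K \<in> ?A \<Longrightarrow> K \<subseteq> N \<Longrightarrow> K = N"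
    by (rule minimal_gli[OF art]) auto
  \<comment> \<open>\<open>L\<close> is minimal as a supplement of the chosen \<open>N\<close>, not
    of \<open>U\<close>. Conversely \<open>N\<close> stays minimal relative to \<open>L\<close>,
    since \<open>L \<subseteq> V\<close> makes every supplement of \<open>L\<close> inside
    \<open>N\<close> a competitor in \<open>?A\<close>.\<close>
  let ?B = "{L. graded_left_ideal G R L \<and> L \<subseteq> V \<and> (\<exists>n\<in>N. \<exists>l\<in>L. e = n \<oplus> l)}"
  have "V \<in> ?B" using NA V by auto
  then obtain L where LB: "L \<in> ?B" and Lmin0: "\<And>K. K \<in> ?B \<Longrightarrow> K \<subseteq> L \<Longrightarrow> K = L"
    by (rule minimal_gli[OF art]) auto
  have N: "graded_left_ideal G R N" "N \<subseteq> U" and L: "graded_left_ideal G R L" "L \<subseteq> V"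
    using NA LB by auto
  have Nmin: "K = N" if "graded_left_ideal G R K" "K \<subseteq> N" "k \<in> K" "l \<in> L" "e = k \<oplus> l" for K k l
  proof (rule Nmin0[OF _ that(2)])
    have "K \<subseteq> U" "l \<in> V" using that N L by auto
    then show "K \<in> ?A" using that by blast
  qed
  have Lmin: "K = L" if "graded_left_ideal G R K" "K \<subseteq> L" "n \<in> N" "k \<in> K" "e = n \<oplus> k" for K n k
  proof (rule Lmin0[OF _ that(2)])
    have "K \<subseteq> V" using that L by auto
    then show "K \<in> ?B" using that by blast
  qed
  obtain n0 l0 where nl: "n0 \<in> N" "l0 \<in> L" "e = n0 \<oplus> l0" using LB by auto
  have nlc: "n0 \<in> carrier R" "l0 \<in> carrier R" using nl gli_closed N L by auto
  \<comment> \<open>Degree-one components make right multiplication by \<open>x\<close> and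
    \<open>y\<close> graded; the factor \<open>e\<close> on the left brings both into
    \<open>e R e\<close>.\<close>
  define x where "x = e \<otimes> rproj G R \<one>\<^bsub>G\<^esub> n0"
  define y where "y = e \<otimes> rproj G R \<one>\<^bsub>G\<^esub> l0"
  have x: "x \<in> N" "x \<in> rcomp R \<one>\<^bsub>G\<^esub>"
    unfolding x_def using nl gli_mult[OF N(1)] gli_proj[OF N(1)] e nlc rproj_in rcomp_mult_deg_one by auto
  have y: "y \<in> L" "y \<in> rcomp R \<one>\<^bsub>G\<^esub>"
    unfolding y_def using nl gli_mult[OF L(1)] gli_proj[OF L(1)] e nlc rproj_in rcomp_mult_deg_one by auto
  have c: "x \<in> carrier R" "y \<in> carrier R" using gli_closed[OF N(1) x(1)] gli_closed[OF L(1) y(1)] by auto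
  have "e = rproj G R \<one>\<^bsub>G\<^esub> e" using rproj_comp[OF _ _ e(1)] by simp
  also have "\<dots> = rproj G R \<one>\<^bsub>G\<^esub> n0 \<oplus> rproj G R \<one>\<^bsub>G\<^esub> l0" using nl nlc rproj_add by simp
  finally have "e \<otimes> e = x \<oplus> y" unfolding x_def y_def using e nlc r_distr rproj_closed by simp
  then have exy: "e = x \<oplus> y" using e by simp
  have ex: "e \<otimes> x = x" "e \<otimes> y = y"
    unfolding x_def y_def using e nlc by (simp_all add: rproj_closed flip: m_assoc)
  have xe: "x \<otimes> e = x" "y \<otimes> e = y"
    using x y N L U V lgen_idem_iff[OF e(2,3)] by blast+
  have xs: "x = x \<otimes> x \<oplus> x \<otimes> y" using xe(1) c unfolding exy by (simp add: r_distr)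
  have ys: "y = y \<otimes> x \<oplus> y \<otimes> y" using xe(2) c unfolding exy by (simp add: r_distr)
  have xyN: "x \<otimes> y \<in> N"
  proof -
    have "x \<otimes> y = x \<ominus> x \<otimes> x" using add_minus_cancel_left[of "x \<otimes> x" "x \<otimes> y"] c xs by simp
    then show ?thesis using gli_minus[OF N(1) x(1)] gli_mult[OF N(1) c(1) x(1)] by simp
  qed
  have xyL: "x \<otimes> y \<in> L" using gli_mult[OF L(1) c(1) y(1)] .
  have yxN: "y \<otimes> x \<in> N" using gli_mult[OF N(1) c(2) x(1)] .
  \<comment> \<open>\<open>?N\<close> contains \<open>x x\<close> because
    \<open>x y \<in> N\<close>, and \<open>x y + y \<in> L\<close> completes \<open>x x\<close> to
    \<open>e\<close>; so minimality of \<open>N\<close> gives \<open>?N = N\<close>. Since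
    \<open>y x \<in> N\<close>, this provides a \<open>p\<close> for which \<open>y - p\<close>
    kills \<open>x\<close>.\<close>
  let ?N = "(\<lambda>p. p \<otimes> x) ` {p \<in> carrier R. p \<otimes> y \<in> N}"
  have "?N = N"
  proof (rule Nmin)
    show "graded_left_ideal G R ?N"
      using gli_image[OF gli_colon[OF N(1) _ y(2)] _ x(2)] by simp
    show "?N \<subseteq> N" using gli_mult[OF N(1) _ x(1)] by auto
    show "x \<otimes> x \<in> ?N" using c xyN by auto
    show "x \<otimes> y \<oplus> y \<in> L" using xyL y gli_add[OF L(1)] by simp
    have "e = (x \<otimes> x \<oplus> x \<otimes> y) \<oplus> y" using exy xs by simp
    then show "e = x \<otimes> x \<oplus> (x \<otimes> y \<oplus> y)" using c by (simp add: a_assoc)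
  qed
  then obtain p where p: "p \<in> carrier R" "p \<otimes> y \<in> N" "y \<otimes> x = p \<otimes> x" using yxN by blast
  \<comment> \<open>\<open>?L\<close> contains \<open>(y - p) y\<close>, and the remaining part
    \<open>x + y x + p y\<close> of \<open>e\<close> lies in \<open>N\<close>; so minimality of
    \<open>L\<close> gives \<open>?L = L\<close>.\<close>
  let ?L = "(\<lambda>p. p \<otimes> y) ` {p \<in> carrier R. p \<otimes> x \<in> {\<zero>}}"
  have "?L = L"
  proof (rule Lmin)
    show "graded_left_ideal G R ?L"
      using gli_image[OF gli_colon[OF gli_zero_set _ x(2)] _ y(2)] by simp
    show "?L \<subseteq> L" using gli_mult[OF L(1) _ y(1)] by auto
    have "(y \<ominus> p) \<otimes> x = \<zero>" using p c by (simp add: l_distr_minus minus_self)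
    then show "(y \<ominus> p) \<otimes> y \<in> ?L" using p c by (intro imageI) simp
    show "x \<oplus> y \<otimes> x \<oplus> p \<otimes> y \<in> N" using x yxN p gli_add[OF N(1)] by simp
    have "p \<otimes> y \<oplus> (y \<ominus> p) \<otimes> y = y \<otimes> y" 
      using p(1) c minus_add_cancel[of "y \<otimes> y" "p \<otimes> y"] by (simp add: l_distr_minus a_comm)
    moreover have "e = x \<oplus> (y \<otimes> x \<oplus> y \<otimes> y)" using exy ys by simp
    ultimately show "e = (x \<oplus> y \<otimes> x \<oplus> p \<otimes> y) \<oplus> (y \<ominus> p) \<otimes> y" 
      using c p(1) by (simp add: a_assoc)
  qed
  then obtain q where q: "q \<in> carrier R" "q \<otimes> x = \<zero>" "y = q \<otimes> y" using y(1) by blast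
  have "q \<otimes> e = y" using q c unfolding exy by (simp add: r_distr)
  then have "y \<otimes> x = \<zero>" using q(1,2) ex(1) e(2) c by (metis m_assoc)
  then have "y \<otimes> y = y" using ys c by simp
  then have "y = \<zero> \<or> y = e" using primitive_idem_cases[OF prim y(2)] ex xe by blast
  then show ?thesis
  proof
    assume "y = \<zero>"
    then have "e \<in> N" using exy c x by simp
    then show ?thesis using N by blast
  next
    assume "y = e" then show ?thesis using y L by blast
  qed
qed

text \<open>Take a maximal graded left ideal \<open>I\<close> that omits some element of
  \<open>U\<close>. Then \<open>e = u + i\<close> with \<open>u \<in> U\<close> and
  \<open>i \<in> I \<inter> R e\<close>, and \<open>primitive_supplement\<close> places
  \<open>e\<close> in \<open>U\<close> or in \<open>I\<close>. The latter would give
  \<open>U \<subseteq> R e \<subseteq> I\<close>.\<close>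

lemma primitive_local:
  assumes art: "gr_left_artinian G R" and prim: "primitive_idem G R e"
    and U: "graded_left_ideal G R U" "U \<subseteq> lgen R e" "\<not> U \<subseteq> J"
  shows "U = lgen R e"
proof -
  note e = primitive_idemD[OF prim]
  obtain z where z: "z \<in> U" "z \<notin> J" using U by blast
  then obtain I where I: "maximal_graded_left_ideal G R I" "z \<notin> I"
    using not_in_J gli_closed[OF U(1)] by blast
  note I' = maximal_gli_D(1)[OF I(1)]
  have "\<not> U \<subseteq> I" using z I by blast
  then obtain u i where u: "u \<in> U" "i \<in> I" "e = u \<oplus> i"
    using maximal_gli_sum[OF I(1) U(1) _ e(2)] by blast
  have "i = e \<ominus> u" using u add_minus_cancel_left gli_closed[OF U(1)] gli_closed[OF I'] by simp
  then have "i \<in> lgen R e" using gli_minus[OF e(5,6)] u U(2) by blast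
  then have "e \<in> U \<or> e \<in> I \<inter> lgen R e"
    using u by (intro primitive_supplement[OF art prim U(1,2) gli_Int[OF I' e(5)] _ u(1) _ u(3)]) auto
  moreover have "e \<notin> I"
  proof
    assume "e \<in> I"
    then have "lgen R e \<subseteq> I" using gli_mult[OF I'] by blast
    then show False using z U I by blast
  qed
  ultimately have "e \<in> U" by blast
  then have "lgen R e \<subseteq> U" using gli_mult[OF U(1)] by blast
  then show ?thesis using U by blast
qed

text \<open>An idempotent \<open>f\<close> of degree one in \<open>e R e\<close> gives
  \<open>R e = R f \<oplus> R (e - f)\<close>. Conversely, a decomposition
  \<open>R e = A \<oplus> B\<close> yields such an idempotent, the part of \<open>e\<close> in
  \<open>A\<close>.\<close>

lemma gr_indecomposable_lgen_iff:
  assumes e: "e \<in> rcomp R \<one>\<^bsub>G\<^esub>" "e \<otimes> e = e"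
  shows "gr_indecomposable G R (restrict_gmod (regular_gmod R) (lgen R e)) \<longleftrightarrow> primitive_idem G R e"
    (is "gr_indecomposable G R ?P \<longleftrightarrow> _")
proof -
  have ec: "e \<in> carrier R" using e rcomp_closed[OF G.one_closed] by blast
  note gP = gli_lgen[OF G.one_closed e(1)]
  note iff = lgen_idem_iff[OF ec e(2)]
  have eP: "e \<in> lgen R e" using iff ec e by blast
  have sub: "graded_submodule G R ?P A \<longleftrightarrow> A \<subseteq> lgen R e \<and> graded_left_ideal G R A" for A
    by (rule graded_submodule_restrict) (use gli_subset[OF gP] in simp)
  have gm: "graded_left_module G R ?P"
    using gP unfolding graded_submodule_def by blast
  have plus: "A <+>\<^bsub>?P\<^esub> B = A <+>\<^bsub>R\<^esub> B" for A B by (simp add: set_add_def')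
  show ?thesis
  proof
    assume ind: "gr_indecomposable G R ?P"
    show "primitive_idem G R e"
      unfolding primitive_idem_def
    proof (intro conjI ballI impI e)
      show "e \<noteq> \<zero>"
      proof
        assume "e = \<zero>"
        then have "lgen R e = {\<zero>}" by force
        then show False using ind unfolding gr_indecomposable_def by simp
      qed
    next
      fix f assume f: "f \<in> rcomp R \<one>\<^bsub>G\<^esub>" and ff: "f \<otimes> f = f \<and> e \<otimes> f = f \<and> f \<otimes> e = f"
      have fc: "f \<in> carrier R" using f rcomp_closed[OF G.one_closed] by blast
      have g: "e \<ominus> f \<in> rcomp R \<one>\<^bsub>G\<^esub>" using e f rcomp_minus by simp
      have gc: "e \<ominus> f \<in> carrier R" using ec fc by simp
      have gf: "(e \<ominus> f) \<otimes> f = \<zero>" using ec fc ff by (simp add: l_distr_minus minus_self)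
      have ge: "(e \<ominus> f) \<otimes> e = e \<ominus> f" using ec fc ff e by (simp add: l_distr_minus)
      have "(e \<ominus> f) \<otimes> (e \<ominus> f) = (e \<ominus> f) \<otimes> e \<ominus> (e \<ominus> f) \<otimes> f"
        using ec fc gc by (simp only: r_distr_minus)
      then have gg: "(e \<ominus> f) \<otimes> (e \<ominus> f) = e \<ominus> f"
        unfolding ge gf using gc by (simp add: a_minus_def)
      have A: "lgen R f \<subseteq> lgen R e" "lgen R (e \<ominus> f) \<subseteq> lgen R e"
        using ff ge ec fc gc by (auto simp: iff m_assoc)
      have "lgen R f \<inter> lgen R (e \<ominus> f) = {\<zero>}"
      proof -
        have "x = \<zero>" if "x \<in> lgen R f" "x \<in> lgen R (e \<ominus> f)" for x
        proof -
          have x: "x \<in> carrier R" "x \<otimes> f = x" "x \<otimes> (e \<ominus> f) = x"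
            using that lgen_idem_iff[OF fc] lgen_idem_iff[OF gc gg] ff by auto
          then have "x = (x \<otimes> (e \<ominus> f)) \<otimes> f" by simp
          also have "\<dots> = \<zero>" using x(1) gc fc gf by (simp only: m_assoc r_null)
          finally show ?thesis .
        qed
        then show ?thesis
          using gli_zero[OF gli_lgen[OF G.one_closed f]] gli_zero[OF gli_lgen[OF G.one_closed g]] by blast
      qed
      moreover have "lgen R f <+>\<^bsub>R\<^esub> lgen R (e \<ominus> f) = lgen R e"
      proof
        show "lgen R f <+>\<^bsub>R\<^esub> lgen R (e \<ominus> f) \<subseteq> lgen R e"
          using A gli_add[OF gP] unfolding set_add_def' by blast
        show "lgen R e \<subseteq> lgen R f <+>\<^bsub>R\<^esub> lgen R (e \<ominus> f)"
        proof
          fix x assume "x \<in> lgen R e"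
          then have x: "x \<in> carrier R" "x \<otimes> e = x" using iff by auto
          then have "x = x \<otimes> f \<oplus> x \<otimes> (e \<ominus> f)"
            using fc ec minus_add_cancel[of x "x \<otimes> f"] by (simp add: r_distr_minus a_comm)
          then show "x \<in> lgen R f <+>\<^bsub>R\<^esub> lgen R (e \<ominus> f)"
            unfolding set_add_def' using x by blast
        qed
      qed
      ultimately have "lgen R f = {\<zero>} \<or> lgen R (e \<ominus> f) = {\<zero>}"
        using ind sub A gli_lgen[OF G.one_closed f] gli_lgen[OF G.one_closed g]
        unfolding gr_indecomposable_def plus by simp
      moreover have "f \<in> lgen R f" "e \<ominus> f \<in> lgen R (e \<ominus> f)"
        using fc gc by (auto intro: image_eqI[of _ _ \<one>])
      ultimately have "f = \<zero> \<or> e \<ominus> f = \<zero>" by blast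
      then show "f = \<zero> \<or> f = e"
      proof
        assume "e \<ominus> f = \<zero>"
        then show ?thesis using minus_add_cancel[OF ec fc] fc by simp
      qed simp
    qed
  next
    assume prim: "primitive_idem G R e"
    show "gr_indecomposable G R ?P"
      unfolding gr_indecomposable_def
    proof (intro conjI allI impI gm)
      show "carrier ?P \<noteq> {\<zero>\<^bsub>?P\<^esub>}" using eP primitive_idemD[OF prim] by auto
      fix A B
      assume "graded_submodule G R ?P A \<and> graded_submodule G R ?P B \<and>
        A \<inter> B = {\<zero>\<^bsub>?P\<^esub>} \<and> A <+>\<^bsub>?P\<^esub> B = carrier ?P"
      then have A: "A \<subseteq> lgen R e" "graded_left_ideal G R A" and B: "B \<subseteq> lgen R e" "graded_left_ideal G R B"
        and AB: "A \<inter> B = {\<zero>}" "A <+>\<^bsub>R\<^esub> B = lgen R e"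
        unfolding sub plus by auto
      have "e \<in> A <+>\<^bsub>R\<^esub> B" using eP AB by simp
      then obtain a0 b0 where ab0: "a0 \<in> A" "b0 \<in> B" "e = a0 \<oplus> b0"
        unfolding set_add_def' by blast
      \<comment> \<open>Passing to degree one keeps the summands in \<open>A\<close> and
        \<open>B\<close>, since these are graded, and keeps their sum, since \<open>e\<close> has
        degree one.\<close>
      define a where "a = rproj G R \<one>\<^bsub>G\<^esub> a0"
      define b where "b = rproj G R \<one>\<^bsub>G\<^esub> b0"
      have c0: "a0 \<in> carrier R" "b0 \<in> carrier R" using ab0 gli_closed A B by auto
      have a: "a \<in> A" "a \<in> rcomp R \<one>\<^bsub>G\<^esub>" "a \<in> carrier R" and b: "b \<in> B" "b \<in> carrier R"
        unfolding a_def b_def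
        using gli_proj[OF A(2)] gli_proj[OF B(2)] ab0 c0 rproj_in rproj_closed by auto
      have eab: "e = a \<oplus> b"
        unfolding a_def b_def using rproj_comp[OF _ _ e(1)] ab0 c0 rproj_add[of a0 b0] by simp
      have ae: "a \<otimes> e = a" "b \<otimes> e = b" using a b A B iff by blast+
      have z: "x = \<zero>" if "x \<in> A" "x \<in> B" for x using AB that by blast
      \<comment> \<open>\<open>a b = a - a a\<close> lies in \<open>A \<inter> B\<close> and
        therefore vanishes; the same argument applies to \<open>b a\<close>.\<close>
      have "a \<otimes> a \<oplus> a \<otimes> b = a" using ae(1) a b unfolding eab by (simp add: r_distr)
      then have "a \<otimes> b = a \<ominus> a \<otimes> a" using add_minus_cancel_left[of "a \<otimes> a" "a \<otimes> b"] a b by simp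
      then have "a \<otimes> b \<in> A" using gli_minus[OF A(2)] gli_mult[OF A(2)] a by simp
      then have ab: "a \<otimes> b = \<zero>" using z gli_mult[OF B(2)] a b by simp
      have "b \<otimes> b \<oplus> b \<otimes> a = b" using ae(2) a b unfolding eab by (simp add: r_distr a_comm)
      then have "b \<otimes> a = b \<ominus> b \<otimes> b" using add_minus_cancel_left[of "b \<otimes> b" "b \<otimes> a"] a b by simp
      then have "b \<otimes> a \<in> B" using gli_minus[OF B(2)] gli_mult[OF B(2)] b by simp
      then have ba: "b \<otimes> a = \<zero>" using z gli_mult[OF A(2)] a b by simp
      have aa: "a \<otimes> a = a" using ae(1) a b ab unfolding eab by (simp add: r_distr)
      have "e \<otimes> a = a" using a b ba aa unfolding eab by (simp add: l_distr)
      then have "a = \<zero> \<or> a = e" using primitive_idem_cases[OF prim a(2) aa] ae by blast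
      then show "A = {\<zero>\<^bsub>?P\<^esub>} \<or> B = {\<zero>\<^bsub>?P\<^esub>}"
      proof
        assume "a = \<zero>"
        then have "e \<in> B" using eab b by simp
        then have "lgen R e \<subseteq> B" using gli_mult[OF B(2)] by blast
        then have "A \<inter> B = A" using A by blast
        then show ?thesis using AB by simp
      next
        assume "a = e"
        then have "lgen R e \<subseteq> A" using gli_mult[OF A(2)] a(1) by blast
        then have "A \<inter> B = B" using B by blast
        then show ?thesis using AB by simp
      qed
    qed
  qed
qed

end

section \<open>Principal indecomposable modules\<close>

context graded_ring
begin

text \<open>The projection \<open>p\<close> onto the summand \<open>D k\<close> is
  \<open>R\<close>-linear, so on \<open>D k\<close> the identity is right multiplication by
  \<open>e = p \<one>\<close>. Hence \<open>e\<close> is idempotent and generates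
  \<open>D k\<close>, and primitivity comes from indecomposability.\<close>

lemma principal_gr_indecsE:
  assumes "P \<in> principal_gr_indecs G R"
  obtains e where "primitive_idem G R e" "P = restrict_gmod (regular_gmod R) (lgen R e)"
proof -
  obtain n :: nat and D k where D: "\<And>k. k < n \<Longrightarrow> graded_left_ideal G R (D k)"
      and ind: "\<And>k. k < n \<Longrightarrow> gr_indecomposable G R (restrict_gmod (regular_gmod R) (D k))"
      and ds: "internal_direct_sum R {..<n} D" and k: "k < n"
      and P: "P = restrict_gmod (regular_gmod R) (D k)"
    using assms unfolding principal_gr_indecs_def by auto
  define p where "p = dproj R {..<n} D k"
  have pD: "p x \<in> D k" if "x \<in> carrier R" for x
    using dproj_in[OF ds that] k unfolding p_def by simp
  have pc: "p x \<in> carrier R" if "x \<in> carrier R" for x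
    using gli_closed[OF D[OF k] pD[OF that]] .
  have padd: "p (x \<oplus> y) = p x \<oplus> p y" if "x \<in> carrier R" "y \<in> carrier R" for x y
    using dproj_add[OF ds that] k unfolding p_def by simp
  have pcomp: "p x = (if k = i then x else \<zero>)" if "i < n" "x \<in> D i" for i x
    using dproj_comp[OF ds _ _ that(2)] that k unfolding p_def by simp
  have p0: "p \<zero> = \<zero>" using dproj_zero[OF ds] k unfolding p_def by simp
  have pmult: "p (a \<otimes> x) = a \<otimes> p x" if a: "a \<in> carrier R" and x: "x \<in> carrier R" for a x
    using ds x
  proof (induction rule: dsum_induct)
    case zero
    then show ?case using a p0 by simp
  next
    case (add x y)
    then show ?case using a padd pc by (simp add: r_distr)
  next
    case (comp i x)
    then have "a \<otimes> x \<in> D i" using gli_mult[OF D a] by simp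
    then show ?case using comp pcomp[of i] a by simp
  qed
  have pproj: "p (rproj G R g x) = rproj G R g (p x)" if g: "g \<in> carrier G" and x: "x \<in> carrier R" for g x
    using ds x
  proof (induction rule: dsum_induct)
    case zero
    then show ?case using g p0 rproj_zero by simp
  next
    case (add x y)
    then show ?case using g padd pc rproj_add rproj_closed by simp
  next
    case (comp i x)
    then have "rproj G R g x \<in> D i" using gli_proj[OF D g] by simp
    then show ?case using comp pcomp[of i] g rproj_zero by simp
  qed
  define e where "e = p \<one>"
  have ec: "e \<in> carrier R" and eD: "e \<in> D k" unfolding e_def using pc pD by auto
  have xe: "x \<otimes> e = x" if "x \<in> D k" for x
  proof -
    have xc: "x \<in> carrier R" using gli_closed[OF D[OF k] that] .
    have "x \<otimes> e = p (x \<otimes> \<one>)" unfolding e_def using pmult[OF xc] by simp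
    also have "\<dots> = x" using pcomp[OF k that] xc by simp
    finally show ?thesis .
  qed
  have ee: "e \<otimes> e = e" using xe[OF eD] .
  \<comment> \<open>\<open>p\<close> commutes with the degree projections because the summands are
    graded, and \<open>\<one>\<close> has degree one.\<close>
  have "e = rproj G R \<one>\<^bsub>G\<^esub> e"
    unfolding e_def using pproj[of "\<one>\<^bsub>G\<^esub>" \<one>] rproj_comp[OF _ _ one_in_rcomp] by simp
  then have e1: "e \<in> rcomp R \<one>\<^bsub>G\<^esub>" using rproj_in[OF G.one_closed ec] by simp
  have "D k = lgen R e"
  proof
    show "D k \<subseteq> lgen R e" using xe gli_closed[OF D[OF k]] lgen_idem_iff[OF ec ee] by blast
    show "lgen R e \<subseteq> D k" using gli_mult[OF D[OF k] _ eD] by blast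
  qed
  then show ?thesis
    using that[of e] ind[OF k] gr_indecomposable_lgen_iff[OF e1 ee] P by simp
qed

text \<open>The last clause is a sum-free form of \<open>e = E 0 + \<dots> + E (n - 1)\<close>.\<close>

definition orthogonal_primitive_sum where
  "orthogonal_primitive_sum e (n :: nat) E \<longleftrightarrow>
     (\<forall>k<n. primitive_idem G R (E k) \<and> e \<otimes> E k = E k \<and> E k \<otimes> e = E k) \<and>
     (\<forall>i<n. \<forall>j<n. i \<noteq> j \<longrightarrow> E i \<otimes> E j = \<zero>) \<and>
     (\<forall>S. \<zero> \<in> S \<longrightarrow> (\<forall>a\<in>S. \<forall>b\<in>S. a \<oplus> b \<in> S) \<longrightarrow> (\<forall>k<n. lgen R (E k) \<subseteq> S) \<longrightarrow> lgen R e \<subseteq> S)"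

lemma orthogonal_primitive_sum_add:
  assumes f: "f \<in> carrier R" "f \<otimes> f = f" and g: "g \<in> carrier R" "g \<otimes> g = g"
    and fg: "f \<otimes> g = \<zero>" "g \<otimes> f = \<zero>"
    and E: "orthogonal_primitive_sum f n E" and F: "orthogonal_primitive_sum g m F"
  shows "orthogonal_primitive_sum (f \<oplus> g) (n + m) (\<lambda>k. if k < n then E k else F (k - n))"
    (is "orthogonal_primitive_sum _ _ ?H")
proof -
  have E': "primitive_idem G R (E k)" "f \<otimes> E k = E k" "E k \<otimes> f = E k" "E k \<in> carrier R" if "k < n" for k
    using E that primitive_idemD unfolding orthogonal_primitive_sum_def by auto
  have F': "primitive_idem G R (F k)" "g \<otimes> F k = F k" "F k \<otimes> g = F k" "F k \<in> carrier R" if "k < m" for k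
    using F that primitive_idemD unfolding orthogonal_primitive_sum_def by auto
  \<comment> \<open>\<open>E k\<close> is absorbed by \<open>f\<close> on both sides, and
    \<open>f g = g f = \<zero>\<close>. The products with \<open>F k\<close> vanish for the same
    reason.\<close>
  have gE: "g \<otimes> E k = \<zero>" "E k \<otimes> g = \<zero>" if "k < n" for k
    using E'[OF that] f g fg by (metis m_assoc l_null) (metis E'[OF that] f(1) g(1) fg m_assoc r_null)
  have fF: "f \<otimes> F k = \<zero>" "F k \<otimes> f = \<zero>" if "k < m" for k
    using F'[OF that] f g fg by (metis m_assoc l_null) (metis F'[OF that] f(1) g(1) fg m_assoc r_null)
  have EF: "E i \<otimes> F j = \<zero>" "F j \<otimes> E i = \<zero>" if "i < n" "j < m" for i j
    using E'[OF that(1)] F'[OF that(2)] gE[OF that(1)] fF[OF that(2)] f g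
    by (metis m_assoc l_null) (metis E'[OF that(1)] F'[OF that(2)] fF[OF that(2)] f(1) m_assoc l_null)
  show ?thesis
    unfolding orthogonal_primitive_sum_def
  proof (intro conjI allI impI)
    fix k assume k: "k < n + m"
    show "primitive_idem G R (?H k)" using E'(1)[of k] F'(1)[of "k - n"] k by auto
    show "(f \<oplus> g) \<otimes> ?H k = ?H k"
      using E'[of k] F'[of "k - n"] gE[of k] fF[of "k - n"] k f g by (auto simp: l_distr)
    show "?H k \<otimes> (f \<oplus> g) = ?H k"
      using E'[of k] F'[of "k - n"] gE[of k] fF[of "k - n"] k f g by (auto simp: r_distr)
  next
    fix i j assume "i < n + m" "j < n + m" "i \<noteq> j"
    moreover have "E i \<otimes> E j = \<zero>" if "i < n" "j < n" "i \<noteq> j" for i j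
      using E that unfolding orthogonal_primitive_sum_def by blast
    moreover have "F i \<otimes> F j = \<zero>" if "i < m" "j < m" "i \<noteq> j" for i j
      using F that unfolding orthogonal_primitive_sum_def by blast
    ultimately show "?H i \<otimes> ?H j = \<zero>" using EF by auto
  next
    fix S assume S: "\<zero> \<in> S" "\<forall>a\<in>S. \<forall>b\<in>S. a \<oplus> b \<in> S" "\<forall>k<n + m. lgen R (?H k) \<subseteq> S"
    have "\<forall>k<n. lgen R (E k) \<subseteq> S"
    proof (intro allI impI)
      fix k assume "k < n" then show "lgen R (E k) \<subseteq> S" using S(3)[rule_format, of k] by simp
    qed
    then have "lgen R f \<subseteq> S" using E S(1,2) unfolding orthogonal_primitive_sum_def by simp
    moreover have "\<forall>k<m. lgen R (F k) \<subseteq> S"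
    proof (intro allI impI)
      fix k assume "k < m" then show "lgen R (F k) \<subseteq> S" using S(3)[rule_format, of "n + k"] by simp
    qed
    then have "lgen R g \<subseteq> S" using F S(1,2) unfolding orthogonal_primitive_sum_def by simp
    ultimately show "lgen R (f \<oplus> g) \<subseteq> S" using S(2) f g by (auto simp: r_distr)
  qed
qed

text \<open>Minimal counterexample: among the idempotents without such a family choose one with
  \<open>R e\<close> minimal. It is not primitive, so it splits as \<open>f + g\<close> with
  \<open>R f\<close> and \<open>R g\<close> strictly smaller, and the families of \<open>f\<close>
  and \<open>g\<close> combine to one for \<open>e\<close>.\<close>

lemma exists_orthogonal_primitive_sum:
  assumes art: "gr_left_artinian G R" and e: "e \<in> rcomp R \<one>\<^bsub>G\<^esub>" "e \<otimes> e = e"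
  shows "\<exists>n E. orthogonal_primitive_sum e n E"
proof (rule ccontr)
  let ?bad = "\<lambda>e. e \<in> rcomp R \<one>\<^bsub>G\<^esub> \<and> e \<otimes> e = e \<and> (\<nexists>n E. orthogonal_primitive_sum e n E)"
  assume "\<nexists>n E. orthogonal_primitive_sum e n E"
  then have "lgen R e \<in> {lgen R e | e. ?bad e}" using e by blast
  then obtain N where N: "N \<in> {lgen R e | e. ?bad e}" and min: "\<And>K. K \<in> {lgen R e | e. ?bad e} \<Longrightarrow> K \<subseteq> N \<Longrightarrow> K = N"
    by (rule minimal_gli[OF art]) (auto intro: gli_lgen[OF G.one_closed])
  obtain e where e: "e \<in> rcomp R \<one>\<^bsub>G\<^esub>" "e \<otimes> e = e" and bad: "\<nexists>n E. orthogonal_primitive_sum e n E"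
    and Ne: "N = lgen R e" using N by blast
  have ec: "e \<in> carrier R" using e rcomp_closed[OF G.one_closed] by blast
  note iff = lgen_idem_iff[OF ec e(2)]
  have eP: "e \<in> lgen R e" using iff ec e by blast
  have e0: "e \<noteq> \<zero>"
  proof
    assume "e = \<zero>"
    then have "orthogonal_primitive_sum e 0 (\<lambda>_. \<zero>)" unfolding orthogonal_primitive_sum_def by auto
    then show False using bad by blast
  qed
  have "\<not> primitive_idem G R e"
  proof
    assume "primitive_idem G R e"
    then have "orthogonal_primitive_sum e 1 (\<lambda>_. e)" unfolding orthogonal_primitive_sum_def using e by auto
    then show False using bad by blast
  qed
  then obtain f where f: "f \<in> rcomp R \<one>\<^bsub>G\<^esub>" "f \<otimes> f = f" "e \<otimes> f = f" "f \<otimes> e = f" "f \<noteq> \<zero>" "f \<noteq> e"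
    unfolding primitive_idem_def using e e0 by blast
  define g where "g = e \<ominus> f"
  have fc: "f \<in> carrier R" using f rcomp_closed[OF G.one_closed] by blast
  have g: "g \<in> rcomp R \<one>\<^bsub>G\<^esub>" "g \<in> carrier R" unfolding g_def using e f ec fc rcomp_minus by simp_all
  have gf: "g \<otimes> f = \<zero>" unfolding g_def using ec fc f by (simp add: l_distr_minus minus_self)
  have fg: "f \<otimes> g = \<zero>" unfolding g_def using ec fc f by (simp add: r_distr_minus minus_self)
  have ge: "g \<otimes> e = g" unfolding g_def using ec fc f e by (simp add: l_distr_minus)
  have "g \<otimes> g = g \<otimes> e \<ominus> g \<otimes> f" using g ec fc by (subst (2) g_def) (simp only: r_distr_minus)
  then have gg: "g \<otimes> g = g" unfolding ge gf using g by (simp add: a_minus_def)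
  have efg: "f \<oplus> g = e" unfolding g_def using minus_add_cancel[OF ec fc] ec fc by (simp add: a_comm)
  have sub: "lgen R f \<subseteq> N" "lgen R g \<subseteq> N"
    unfolding Ne using f ge ec fc g by (auto simp: iff m_assoc)
  \<comment> \<open>Equality would put \<open>e\<close> into \<open>R f\<close>, so
    \<open>e f = e\<close>; but \<open>e f = f \<noteq> e\<close>.\<close>
  have "lgen R f \<noteq> N"
  proof
    assume "lgen R f = N"
    then have "e \<otimes> f = e" using eP lgen_idem_iff[OF fc f(2)] unfolding Ne by blast
    then show False using f by simp
  qed
  then have "\<exists>n E. orthogonal_primitive_sum f n E" using min[OF _ sub(1)] f by blast
  moreover have "lgen R g \<noteq> N"
  proof
    assume "lgen R g = N"
    then have "e \<otimes> g = e" using eP lgen_idem_iff[OF g(2) gg] unfolding Ne by blast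
    moreover have "e \<otimes> g = g" unfolding g_def using ec fc f e by (simp add: r_distr_minus)
    ultimately have "e \<otimes> f = \<zero>" using gf by simp
    then show False using f by simp
  qed
  then have "\<exists>n E. orthogonal_primitive_sum g n E" using min[OF _ sub(2)] g gg by blast
  ultimately show False
    using orthogonal_primitive_sum_add[OF fc f(2) g(2) gg fg gf] bad unfolding efg by blast
qed

text \<open>The case \<open>e = \<one>\<close>. The last clause says in sum-free form that
  \<open>\<one>\<close> is the sum of the \<open>E k\<close>; it later supplies an
  \<open>E k\<close> outside a given proper graded left ideal.\<close>

lemma exists_principal_decomposition:
  assumes art: "gr_left_artinian G R"
  obtains n :: nat and E where "\<And>k. k < n \<Longrightarrow> primitive_idem G R (E k)"
    "\<And>k. k < n \<Longrightarrow> restrict_gmod (regular_gmod R) (lgen R (E k)) \<in> principal_gr_indecs G R"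
    "\<And>I. graded_left_ideal G R I \<Longrightarrow> (\<And>k. k < n \<Longrightarrow> E k \<in> I) \<Longrightarrow> I = carrier R"
proof -
  obtain n E where ops: "orthogonal_primitive_sum \<one> n E"
    using exists_orthogonal_primitive_sum[OF art one_in_rcomp] by auto
  have E: "primitive_idem G R (E k)" if "k < n" for k
    using ops that unfolding orthogonal_primitive_sum_def by blast
  note Ek = primitive_idemD[OF E]
  have orth: "E i \<otimes> E j = \<zero>" if "i < n" "j < n" "i \<noteq> j" for i j
    using ops that unfolding orthogonal_primitive_sum_def by blast
  have "lgen R \<one> = (\<lambda>a. a) ` carrier R" by (rule image_cong) auto
  then have l1: "lgen R \<one> = carrier R" by simp
  have span: "carrier R \<subseteq> S" if "\<zero> \<in> S" "\<And>a b. a \<in> S \<Longrightarrow> b \<in> S \<Longrightarrow> a \<oplus> b \<in> S"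
      "\<And>k. k < n \<Longrightarrow> lgen R (E k) \<subseteq> S" for S
    using ops that unfolding orthogonal_primitive_sum_def l1 by simp
  have ds: "internal_direct_sum R {..<n} (\<lambda>k. lgen R (E k))"
  proof (rule internal_direct_sumI)
    fix i assume "i \<in> {..<n}"
    then have i: "i < n" by simp
    note g = Ek(5)[OF i]
    show "additive_subgroup (lgen R (E i)) R"
      unfolding additive_subgroup_iff
    proof (intro conjI ballI)
      fix x assume "x \<in> lgen R (E i)"
      then show "\<exists>y\<in>lgen R (E i). x \<oplus> y = \<zero>"
        using gli_uminus[OF g] gli_closed[OF g] r_neg by (intro bexI[of _ "\<ominus> x"]) auto
    qed (use g in \<open>auto simp: gli_iff\<close>)
    \<comment> \<open>Right multiplication by \<open>E i\<close> is the projection onto the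
      \<open>i\<close>-th summand.\<close>
    have "a \<otimes> E i \<otimes> E i = a \<otimes> E i" if "a \<in> carrier R" for a
      using that Ek[OF i] by (simp add: m_assoc)
    moreover have "a \<otimes> E j \<otimes> E i = \<zero>" if "a \<in> carrier R" "j < n" "j \<noteq> i" for a j
      using that orth[OF that(2) i that(3)] Ek[OF i] Ek[OF that(2)] by (simp add: m_assoc)
    ultimately show "\<exists>p. p \<in> carrier R \<rightarrow> carrier R \<and>
        (\<forall>x\<in>carrier R. \<forall>y\<in>carrier R. p (x \<oplus> y) = p x \<oplus> p y) \<and>
        (\<forall>x\<in>lgen R (E i). p x = x) \<and> (\<forall>j\<in>{..<n}. j \<noteq> i \<longrightarrow> (\<forall>x\<in>lgen R (E j). p x = \<zero>))"
      using Ek(2)[OF i] by (intro exI[of _ "\<lambda>x. x \<otimes> E i"]) (auto simp: l_distr)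
  next
    fix x S assume x: "x \<in> carrier R" and S: "\<zero> \<in> S" "\<And>a b. a \<in> S \<Longrightarrow> b \<in> S \<Longrightarrow> a \<oplus> b \<in> S"
      "\<And>i a. i \<in> {..<n} \<Longrightarrow> a \<in> lgen R (E i) \<Longrightarrow> a \<in> S"
    have "carrier R \<subseteq> S"
    proof (rule span[OF S(1,2)])
      fix k assume "k < n" then show "lgen R (E k) \<subseteq> S" using S(3)[of k] by (simp add: subset_iff)
    qed
    then show "x \<in> S" using x by blast
  qed
  show ?thesis
  proof (rule that[of n E])
    fix k assume k: "k < n"
    show "primitive_idem G R (E k)" using E k by blast
    have "\<forall>k<n. graded_left_ideal G R (lgen R (E k)) \<and>
        gr_indecomposable G R (restrict_gmod (regular_gmod R) (lgen R (E k)))"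
      using gr_indecomposable_lgen_iff[OF Ek(1,3)] E Ek(5) by simp
    then show "restrict_gmod (regular_gmod R) (lgen R (E k)) \<in> principal_gr_indecs G R"
      unfolding principal_gr_indecs_def mem_Collect_eq
      using ds k by (intro exI[of _ n] exI[of _ "\<lambda>k. lgen R (E k)"] conjI exI[of _ k]) simp_all
  next
    fix I assume I: "graded_left_ideal G R I" and EI: "\<And>k. k < n \<Longrightarrow> E k \<in> I"
    have "carrier R \<subseteq> I"
      by (rule span[OF gli_zero[OF I] gli_add[OF I]]) (auto intro!: gli_mult[OF I] EI)
    then show "I = carrier R" using gli_subset[OF I] by blast
  qed
qed

end

section \<open>Quotient modules\<close>

context abelian_group
begin

lemma a_coset_eq_iff:
  assumes H: "additive_subgroup H G" and xy: "x \<in> carrier G" "y \<in> carrier G"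
  shows "H +> x = H +> y \<longleftrightarrow> x \<ominus> y \<in> H"
proof -
  interpret H: additive_subgroup H G by fact
  have s: "subgroup H (add_monoid G)" by (rule H.a_subgroup)
  show ?thesis
  proof
    assume "H +> x = H +> y"
    moreover have "x \<in> H +> x"
      using xy H.zero_closed unfolding a_r_coset_def' by (auto intro!: exI[of _ \<zero>] bexI[of _ \<zero>])
    ultimately obtain h where "h \<in> H" "x = h \<oplus> y" unfolding a_r_coset_def' by blast
    then show "x \<ominus> y \<in> H" using xy add_minus_cancel_left[of y h] a_comm[of h y] H.a_Hcarr by simp
  next
    assume h: "x \<ominus> y \<in> H"
    then have "(x \<ominus> y) \<oplus> y \<in> H +> y" using xy H.a_subset by (intro a_rcosI) auto
    then have "x \<in> H +> y" using minus_add_cancel xy by simp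
    then show "H +> x = H +> y" using a_repr_independence[OF _ xy(2) s] by blast
  qed
qed

lemma a_coset_add:
  assumes H: "additive_subgroup H G" and xy: "x \<in> carrier G" "y \<in> carrier G"
  shows "(H +> x) <+>\<^bsub>G\<^esub> (H +> y) = H +> (x \<oplus> y)"
proof -
  interpret abelian_subgroup H G by (rule abelian_subgroupI3[OF H abelian_group_axioms])
  show ?thesis using a_rcos_sum xy by simp
qed

lemma a_rcosets_eq_image: "a_rcosets H = (\<lambda>x. H +> x) ` carrier G"
  unfolding A_RCOSETS_def RCOSETS_def a_r_coset_def by auto

lemma a_coset_zero:
  assumes "additive_subgroup H G"
  shows "H +> \<zero> = H"
  using assms additive_subgroup.a_subset by (intro a_coset_add_zero) blast

lemma abelian_group_image:
  assumes c: "carrier Q = \<pi> ` carrier G" and z: "zero Q = \<pi> \<zero>"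
    and a: "\<And>x y. x \<in> carrier G \<Longrightarrow> y \<in> carrier G \<Longrightarrow> \<pi> x \<oplus>\<^bsub>Q\<^esub> \<pi> y = \<pi> (x \<oplus> y)"
  shows "abelian_group Q"
proof (rule abelian_groupI; unfold c z; (elim imageE)?)
  fix u x assume "u = \<pi> x" "x \<in> carrier G"
  then show "\<exists>v\<in>\<pi> ` carrier G. v \<oplus>\<^bsub>Q\<^esub> u = \<pi> \<zero>" by (intro bexI[of _ "\<pi> (\<ominus> x)"]) (auto simp: a l_neg)
qed (auto simp: a a_ac)

text \<open>Assumption \<open>p\<close> says that the projections descend along
  \<open>\<pi>\<close>, which keeps the image sum direct. Serves both the quotient modules and the
  quotient ring.\<close>

lemma internal_direct_sum_image:
  assumes ds: "internal_direct_sum G I D"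
    and c: "carrier Q = \<pi> ` carrier G" and z: "zero Q = \<pi> \<zero>"
    and a: "\<And>x y. x \<in> carrier G \<Longrightarrow> y \<in> carrier G \<Longrightarrow> \<pi> x \<oplus>\<^bsub>Q\<^esub> \<pi> y = \<pi> (x \<oplus> y)"
    and p: "\<And>x y i. x \<in> carrier G \<Longrightarrow> y \<in> carrier G \<Longrightarrow> \<pi> x = \<pi> y \<Longrightarrow> i \<in> I \<Longrightarrow>
      \<pi> (dproj G I D i x) = \<pi> (dproj G I D i y)"
  shows "internal_direct_sum Q I (\<lambda>i. \<pi> ` D i)"
proof -
  interpret Q: abelian_group Q by (rule abelian_group_image[OF c z a])
  show ?thesis
  proof (rule Q.internal_direct_sumI)
    fix i assume i: "i \<in> I"
    have D: "D i \<subseteq> carrier G" "\<zero> \<in> D i" "\<And>x y. x \<in> D i \<Longrightarrow> y \<in> D i \<Longrightarrow> x \<oplus> y \<in> D i"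
      "\<And>x. x \<in> D i \<Longrightarrow> \<exists>y\<in>D i. x \<oplus> y = \<zero>"
      using dsum_subgroup[OF ds i] unfolding additive_subgroup_iff by auto
    show "additive_subgroup (\<pi> ` D i) Q"
      unfolding Q.additive_subgroup_iff c z
    proof (intro conjI ballI; (elim imageE)?)
      fix u x assume u: "u = \<pi> x" "x \<in> D i"
      then obtain y where "y \<in> D i" "x \<oplus> y = \<zero>" using D by blast
      then show "\<exists>v\<in>\<pi> ` D i. u \<oplus>\<^bsub>Q\<^esub> v = \<pi> \<zero>" using u D a[of x y] by (intro bexI[of _ "\<pi> y"]) auto
    next
      fix u v x y assume "u = \<pi> x" "x \<in> D i" "v = \<pi> y" "y \<in> D i"
      then show "u \<oplus>\<^bsub>Q\<^esub> v \<in> \<pi> ` D i" using a[of x y] D by auto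
    qed (use D in auto)
    \<comment> \<open>The induced projection, computed on an arbitrary representative; assumption
      \<open>p\<close> makes the choice irrelevant.\<close>
    define q where "q X = \<pi> (dproj G I D i (SOME m. m \<in> carrier G \<and> \<pi> m = X))" for X
    have q: "q (\<pi> x) = \<pi> (dproj G I D i x)" if "x \<in> carrier G" for x
    proof -
      have "(SOME m. m \<in> carrier G \<and> \<pi> m = \<pi> x) \<in> carrier G \<and> \<pi> (SOME m. m \<in> carrier G \<and> \<pi> m = \<pi> x) = \<pi> x"
        by (rule someI[of _ x]) (use that in simp)
      then show ?thesis unfolding q_def by (intro p i that) simp_all
    qed
    have Dc: "x \<in> carrier G" if "j \<in> I" "x \<in> D j" for j x using dsum_closed[OF ds that] .
    show "\<exists>p. p \<in> carrier Q \<rightarrow> carrier Q \<and>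
        (\<forall>x\<in>carrier Q. \<forall>y\<in>carrier Q. p (x \<oplus>\<^bsub>Q\<^esub> y) = p x \<oplus>\<^bsub>Q\<^esub> p y) \<and>
        (\<forall>x\<in>\<pi> ` D i. p x = x) \<and> (\<forall>j\<in>I. j \<noteq> i \<longrightarrow> (\<forall>x\<in>\<pi> ` D j. p x = zero Q))"
      unfolding c z
    proof (intro exI[of _ q] conjI ballI impI; (elim imageE)?)
      show "q \<in> \<pi> ` carrier G \<rightarrow> \<pi> ` carrier G"
        using dproj_closed[OF ds _ i] by (auto simp: q)
    next
      fix u v x y assume "u = \<pi> x" "x \<in> carrier G" "v = \<pi> y" "y \<in> carrier G"
      then show "q (u \<oplus>\<^bsub>Q\<^esub> v) = q u \<oplus>\<^bsub>Q\<^esub> q v"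
        using dproj_closed[OF ds _ i] dproj_add[OF ds _ _ i] by (simp add: a q)
    next
      fix u x assume "u = \<pi> x" "x \<in> D i"
      then show "q u = u" using q[of x] D(1) dproj_comp[OF ds i i] by auto
    next
      fix j u x assume j: "j \<in> I" "j \<noteq> i" and x: "u = \<pi> x" "x \<in> D j"
      then show "q u = \<pi> \<zero>" using q[OF Dc[OF j(1) x(2)]] dproj_comp[OF ds i j(1) x(2)] by simp
    qed
  next
    fix X S assume X: "X \<in> carrier Q" and S: "zero Q \<in> S" "\<And>a b. a \<in> S \<Longrightarrow> b \<in> S \<Longrightarrow> a \<oplus>\<^bsub>Q\<^esub> b \<in> S"
      "\<And>i a. i \<in> I \<Longrightarrow> a \<in> \<pi> ` D i \<Longrightarrow> a \<in> S"
    obtain x where x: "x \<in> carrier G" "X = \<pi> x" using X c by auto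
    have "\<pi> x \<in> S"
      using ds x(1)
    proof (induction rule: dsum_induct)
      case zero
      then show ?case using S(1) z by simp
    next
      case (add x y)
      then show ?case using S(2)[of "\<pi> x" "\<pi> y"] a by simp
    next
      case (comp i x)
      then show ?case using S(3) by blast
    qed
    then show "X \<in> S" using x by simp
  qed
qed

end

lemma quot_gmod_simps [simp]:
  "carrier (quot_gmod M N) = a_rcosets\<^bsub>M\<^esub> N" "add (quot_gmod M N) = set_add M"
  "zero (quot_gmod M N) = N" "smult (quot_gmod M N) a X = (\<Union>x\<in>X. N +>\<^bsub>M\<^esub> (a \<odot>\<^bsub>M\<^esub> x))"
  "mcomp (quot_gmod M N) g = (\<lambda>x. N +>\<^bsub>M\<^esub> x) ` mcomp M g"
  by (simp_all add: quot_gmod_def)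

context graded_left_module
begin

lemma gr_closed_subgroup:
  assumes "gr_closed G R M N"
  shows "additive_subgroup N M"
proof -
  note N = assms[unfolded gr_closed_def]
  show ?thesis unfolding M.additive_subgroup_iff
  proof (intro conjI ballI)
    fix x assume x: "x \<in> N"
    then have "(\<ominus> \<one>) \<odot>\<^bsub>M\<^esub> x \<in> N" "x \<in> carrier M" using N by auto
    then show "\<exists>y\<in>N. x \<oplus>\<^bsub>M\<^esub> y = \<zero>\<^bsub>M\<^esub>" using smult_minus_one M.r_neg by metis
  qed (use N in auto)
qed

lemma smult_l_minus:
  "\<lbrakk>a \<in> carrier R; b \<in> carrier R; x \<in> carrier M\<rbrakk> \<Longrightarrow>
    (a \<ominus> b) \<odot>\<^bsub>M\<^esub> x = a \<odot>\<^bsub>M\<^esub> x \<ominus>\<^bsub>M\<^esub> b \<odot>\<^bsub>M\<^esub> x"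
  using M.add_minus_cancel_left[of "b \<odot>\<^bsub>M\<^esub> x" "(a \<ominus> b) \<odot>\<^bsub>M\<^esub> x"]
    smult_l_distr[of b "a \<ominus> b" x] minus_add_cancel[of a b]
  by (simp add: smult_closed a_comm)

lemma mproj_minus:
  "\<lbrakk>x \<in> carrier M; y \<in> carrier M; g \<in> carrier G\<rbrakk> \<Longrightarrow>
    mproj G M g (x \<ominus>\<^bsub>M\<^esub> y) = mproj G M g x \<ominus>\<^bsub>M\<^esub> mproj G M g y"
  using M.add_minus_cancel_left[of "mproj G M g y" "mproj G M g (x \<ominus>\<^bsub>M\<^esub> y)"]
    M.dproj_add[OF module_decomp, of y "x \<ominus>\<^bsub>M\<^esub> y" g] M.minus_add_cancel[of x y]
  by (simp add: mproj_closed M.a_comm)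

text \<open>The action on a coset is defined as a union over its elements. All members of this union
  coincide, since two representatives differ by some \<open>n \<in> N\<close> and
  \<open>a n \<in> N\<close>.\<close>

lemma quot_smult:
  assumes N: "gr_closed G R M N" and a: "a \<in> carrier R" and x: "x \<in> carrier M"
  shows "a \<odot>\<^bsub>quot_gmod M N\<^esub> (N +>\<^bsub>M\<^esub> x) = N +>\<^bsub>M\<^esub> (a \<odot>\<^bsub>M\<^esub> x)"
proof -
  note s = gr_closed_subgroup[OF N]
  interpret additive_subgroup N M by (rule s)
  have "N +>\<^bsub>M\<^esub> (a \<odot>\<^bsub>M\<^esub> y) = N +>\<^bsub>M\<^esub> (a \<odot>\<^bsub>M\<^esub> x)" if y: "y \<in> N +>\<^bsub>M\<^esub> x" for y
  proof -
    obtain n where n: "n \<in> N" "y = n \<oplus>\<^bsub>M\<^esub> x" using y unfolding a_r_coset_def' by blast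
    have nc: "n \<in> carrier M" using n a_Hcarr by blast
    have "a \<odot>\<^bsub>M\<^esub> y \<ominus>\<^bsub>M\<^esub> a \<odot>\<^bsub>M\<^esub> x = a \<odot>\<^bsub>M\<^esub> n"
      using n nc a x M.add_minus_cancel_left[of "a \<odot>\<^bsub>M\<^esub> x" "a \<odot>\<^bsub>M\<^esub> n"]
      by (simp add: smult_r_distr smult_closed M.a_comm)
    also have "\<dots> \<in> N" using N a n unfolding gr_closed_def by blast
    finally show ?thesis using M.a_coset_eq_iff[OF s] n nc a x smult_closed by simp
  qed
  moreover have "x \<in> N +>\<^bsub>M\<^esub> x"
    using M.a_rcosI[OF zero_closed a_subset x] x by simp
  ultimately show ?thesis unfolding quot_gmod_simps by (intro UN_constant_eq) blast+
qed

lemma graded_left_module_quot: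
  assumes N: "gr_closed G R M N"
  shows "graded_left_module G R (quot_gmod M N)"
proof -
  let ?Q = "quot_gmod M N"
  let ?\<pi> = "\<lambda>x. N +>\<^bsub>M\<^esub> x"
  note s = gr_closed_subgroup[OF N]
  have c: "carrier ?Q = ?\<pi> ` carrier M" by (simp add: M.a_rcosets_eq_image)
  have z: "zero ?Q = ?\<pi> \<zero>\<^bsub>M\<^esub>" using M.a_coset_zero[OF s] by simp
  have ad: "?\<pi> x \<oplus>\<^bsub>?Q\<^esub> ?\<pi> y = ?\<pi> (x \<oplus>\<^bsub>M\<^esub> y)" if "x \<in> carrier M" "y \<in> carrier M" for x y
    using M.a_coset_add[OF s that] by simp
  have pr: "?\<pi> (mproj G M g x) = ?\<pi> (mproj G M g y)"
    if "x \<in> carrier M" "y \<in> carrier M" "?\<pi> x = ?\<pi> y" "g \<in> carrier G" for x y g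
  proof -
    have "x \<ominus>\<^bsub>M\<^esub> y \<in> N" using M.a_coset_eq_iff[OF s that(1,2)] that(3) by simp
    then have "mproj G M g (x \<ominus>\<^bsub>M\<^esub> y) \<in> N" using N that(4) unfolding gr_closed_def by blast
    then show ?thesis using M.a_coset_eq_iff[OF s] mproj_closed mproj_minus that by simp
  qed
  have mc: "mcomp ?Q = (\<lambda>g. ?\<pi> ` mcomp M g)" by (rule ext) simp
  note sm = quot_smult[OF N]
  note cl = smult_closed M.a_closed
  show ?thesis
  proof (intro graded_left_module.intro graded_left_module_axioms.intro graded_ring_axioms)
    show "abelian_group ?Q" by (rule M.abelian_group_image[OF c z ad])
    show "internal_direct_sum ?Q (carrier G) (mcomp ?Q)"
      unfolding mc by (rule M.internal_direct_sum_image[OF module_decomp c z ad pr])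
  next
    fix a X assume a: "a \<in> carrier R" and "X \<in> carrier ?Q"
    then obtain x where x: "x \<in> carrier M" "X = ?\<pi> x" unfolding c by blast
    show "a \<odot>\<^bsub>?Q\<^esub> X \<in> carrier ?Q" unfolding c x(2) sm[OF a x(1)] by (intro imageI cl a x)
  next
    fix a b X assume a: "a \<in> carrier R" "b \<in> carrier R" and "X \<in> carrier ?Q"
    then obtain x where x: "x \<in> carrier M" "X = ?\<pi> x" unfolding c by blast
    show "(a \<oplus> b) \<odot>\<^bsub>?Q\<^esub> X = a \<odot>\<^bsub>?Q\<^esub> X \<oplus>\<^bsub>?Q\<^esub> b \<odot>\<^bsub>?Q\<^esub> X"
      unfolding x(2) sm[OF a(1) x(1)] sm[OF a(2) x(1)] sm[OF a_closed[OF a] x(1)] ad[OF cl(1)[OF a(1) x(1)] cl(1)[OF a(2) x(1)]]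
        smult_l_distr[OF a x(1)] ..
    show "(a \<otimes> b) \<odot>\<^bsub>?Q\<^esub> X = a \<odot>\<^bsub>?Q\<^esub> (b \<odot>\<^bsub>?Q\<^esub> X)"
      unfolding x(2) sm[OF a(2) x(1)] sm[OF m_closed[OF a] x(1)] sm[OF a(1) cl(1)[OF a(2) x(1)]]
        smult_assoc[OF a x(1)] ..
  next
    fix a X Y assume a: "a \<in> carrier R" and "X \<in> carrier ?Q" "Y \<in> carrier ?Q"
    then obtain x y where x: "x \<in> carrier M" "X = ?\<pi> x" and y: "y \<in> carrier M" "Y = ?\<pi> y" unfolding c by blast
    show "a \<odot>\<^bsub>?Q\<^esub> (X \<oplus>\<^bsub>?Q\<^esub> Y) = a \<odot>\<^bsub>?Q\<^esub> X \<oplus>\<^bsub>?Q\<^esub> a \<odot>\<^bsub>?Q\<^esub> Y"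
      unfolding x(2) y(2) ad[OF x(1) y(1)] sm[OF a x(1)] sm[OF a y(1)] sm[OF a cl(2)[OF x(1) y(1)]]
        ad[OF cl(1)[OF a x(1)] cl(1)[OF a y(1)]] smult_r_distr[OF a x(1) y(1)] ..
  next
    fix X assume "X \<in> carrier ?Q"
    then obtain x where x: "x \<in> carrier M" "X = ?\<pi> x" unfolding c by blast
    show "\<one> \<odot>\<^bsub>?Q\<^esub> X = X" unfolding x(2) sm[OF one_closed x(1)] smult_one[OF x(1)] ..
  next
    fix g h a X assume g: "g \<in> carrier G" "h \<in> carrier G" "a \<in> rcomp R g" and "X \<in> mcomp ?Q h"
    then obtain x where x: "x \<in> mcomp M h" "X = ?\<pi> x" unfolding mc by blast
    show "a \<odot>\<^bsub>?Q\<^esub> X \<in> mcomp ?Q (g \<otimes>\<^bsub>G\<^esub> h)"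
      unfolding mc x(2) sm[OF rcomp_closed[OF g(1,3)] mcomp_closed[OF g(2) x(1)]]
      by (intro imageI smult_comp g x)
  qed
qed

end

section \<open>Bijections between sets of classes\<close>

text \<open>The equivalence laws are required on \<open>A\<close> and \<open>B\<close> only:
  symmetry of \<open>gr_iso\<close> is available for graded modules, not for arbitrary
  records.\<close>

lemma induces_bijectionI:
  assumes reflA: "\<And>x. x \<in> A \<Longrightarrow> E x x" and symA: "\<And>x y. x \<in> A \<Longrightarrow> y \<in> A \<Longrightarrow> E x y \<Longrightarrow> E y x"
    and transA: "\<And>x y z. x \<in> A \<Longrightarrow> y \<in> A \<Longrightarrow> z \<in> A \<Longrightarrow> E x y \<Longrightarrow> E y z \<Longrightarrow> E x z"
    and reflB: "\<And>x. x \<in> B \<Longrightarrow> E' x x" and symB: "\<And>x y. x \<in> B \<Longrightarrow> y \<in> B \<Longrightarrow> E' x y \<Longrightarrow> E' y x"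
    and transB: "\<And>x y z. x \<in> B \<Longrightarrow> y \<in> B \<Longrightarrow> z \<in> B \<Longrightarrow> E' x y \<Longrightarrow> E' y z \<Longrightarrow> E' x z"
    and F: "\<And>x. x \<in> A \<Longrightarrow> F x \<in> B" and inj: "\<And>x y. x \<in> A \<Longrightarrow> y \<in> A \<Longrightarrow> E x y \<longleftrightarrow> E' (F x) (F y)"
    and surj: "\<And>b. b \<in> B \<Longrightarrow> \<exists>a\<in>A. E' b (F a)"
  shows "induces_bijection F A E B E'"
proof -
  let ?cA = "\<lambda>x. rel_on A E `` {x}"
  let ?cB = "\<lambda>x. rel_on B E' `` {x}"
  have eqA: "equiv A (rel_on A E)"
    by (rule equivI) (auto simp: rel_on_def refl_on_def sym_def trans_def intro: reflA symA transA)
  have eqB: "equiv B (rel_on B E')"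
    by (rule equivI) (auto simp: rel_on_def refl_on_def sym_def trans_def intro: reflB symB transB)
  have cA: "?cA x = ?cA y \<longleftrightarrow> E x y" if "x \<in> A" "y \<in> A" for x y
    using eq_equiv_class_iff[OF eqA that] that by (simp add: rel_on_def)
  have cB: "?cB x = ?cB y \<longleftrightarrow> E' x y" if "x \<in> B" "y \<in> B" for x y
    using eq_equiv_class_iff[OF eqB that] that by (simp add: rel_on_def)
  \<comment> \<open>On a class of \<open>A\<close> all sets in this union are equal, so the union is
    their common value and no representative has to be chosen.\<close>
  define f where "f X = (\<Union>x\<in>X. ?cB (F x))" for X
  have f: "f (?cA x) = ?cB (F x)" if x: "x \<in> A" for x
    unfolding f_def
  proof (rule UN_constant_eq)
    show "x \<in> ?cA x" using x reflA by (simp add: rel_on_def)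
    show "\<forall>y\<in>?cA x. ?cB (F y) = ?cB (F x)"
    proof
      fix y assume "y \<in> ?cA x"
      then have y: "y \<in> A" "E x y" by (auto simp: rel_on_def)
      then show "?cB (F y) = ?cB (F x)" using cB[OF F[OF y(1)] F[OF x]] inj[OF y(1) x] symA[OF x y] by simp
    qed
  qed
  have "bij_betw f (A // rel_on A E) (B // rel_on B E')"
  proof (rule bij_betw_imageI)
    show "inj_on f (A // rel_on A E)"
    proof (rule inj_onI)
      fix X Y assume "X \<in> A // rel_on A E" "Y \<in> A // rel_on A E" and XY: "f X = f Y"
      then obtain x y where x: "x \<in> A" "X = ?cA x" and y: "y \<in> A" "Y = ?cA y"
        by (auto elim!: quotientE)
      then show "X = Y" using XY f cA[OF x(1) y(1)] cB[OF F[OF x(1)] F[OF y(1)]] inj[OF x(1) y(1)] by simp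
    qed
    show "f ` (A // rel_on A E) = B // rel_on B E'"
    proof
      show "f ` (A // rel_on A E) \<subseteq> B // rel_on B E'"
        using f F by (auto elim!: quotientE intro!: quotientI)
      show "B // rel_on B E' \<subseteq> f ` (A // rel_on A E)"
      proof
        fix Y assume "Y \<in> B // rel_on B E'"
        then obtain b where b: "b \<in> B" "Y = ?cB b" by (auto elim!: quotientE)
        then obtain a where a: "a \<in> A" "E' b (F a)" using surj by blast
        then have "Y = f (?cA a)" using f b cB[OF b(1) F[OF a(1)]] by simp
        then show "Y \<in> f ` (A // rel_on A E)" using a by (auto intro!: quotientI)
      qed
    qed
  qed
  then show ?thesis unfolding induces_bijection_def using f F by blast
qed

section \<open>Homomorphisms and shifts\<close>

lemma gr_homD:
  assumes "f \<in> gr_hom G R M T"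
  shows "x \<in> carrier M \<Longrightarrow> f x \<in> carrier T"
    "x \<in> carrier M \<Longrightarrow> y \<in> carrier M \<Longrightarrow> f (x \<oplus>\<^bsub>M\<^esub> y) = f x \<oplus>\<^bsub>T\<^esub> f y"
    "a \<in> carrier R \<Longrightarrow> x \<in> carrier M \<Longrightarrow> f (a \<odot>\<^bsub>M\<^esub> x) = a \<odot>\<^bsub>T\<^esub> f x"
    "g \<in> carrier G \<Longrightarrow> x \<in> mcomp M g \<Longrightarrow> f x \<in> mcomp T g"
  using assms unfolding gr_hom_def by (auto simp: image_subset_iff)

lemma gr_homI:
  assumes "\<And>x. x \<in> carrier M \<Longrightarrow> f x \<in> carrier T"
    "\<And>x y. x \<in> carrier M \<Longrightarrow> y \<in> carrier M \<Longrightarrow> f (x \<oplus>\<^bsub>M\<^esub> y) = f x \<oplus>\<^bsub>T\<^esub> f y"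
    "\<And>a x. a \<in> carrier R \<Longrightarrow> x \<in> carrier M \<Longrightarrow> f (a \<odot>\<^bsub>M\<^esub> x) = a \<odot>\<^bsub>T\<^esub> f x"
    "\<And>g x. g \<in> carrier G \<Longrightarrow> x \<in> mcomp M g \<Longrightarrow> f x \<in> mcomp T g"
  shows "f \<in> gr_hom G R M T"
  using assms unfolding gr_hom_def by auto

locale gr_hom_pair = M: graded_left_module G R M + T: graded_left_module G R T
  for G :: "('g, 'y) monoid_scheme" and R :: "('r, 'g) gring" (structure)
    and M :: "('r, 'm, 'g) gmod" and T :: "('r, 'n, 'g) gmod" +
  fixes f assumes f: "f \<in> gr_hom G R M T"
begin

lemmas fD = gr_homD[OF f]

lemma f_zero: "f \<zero>\<^bsub>M\<^esub> = \<zero>\<^bsub>T\<^esub>"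
  using fD(2)[of "\<zero>\<^bsub>M\<^esub>" "\<zero>\<^bsub>M\<^esub>"] fD(1)[of "\<zero>\<^bsub>M\<^esub>"] by simp

lemma f_minus: "x \<in> carrier M \<Longrightarrow> y \<in> carrier M \<Longrightarrow> f (x \<ominus>\<^bsub>M\<^esub> y) = f x \<ominus>\<^bsub>T\<^esub> f y"
  using T.M.add_minus_cancel_left[of "f y" "f (x \<ominus>\<^bsub>M\<^esub> y)"] fD(2)[of "x \<ominus>\<^bsub>M\<^esub> y" y]
    M.M.minus_add_cancel[of x y] fD(1)
  by (simp add: T.M.a_comm)

lemma f_mproj:
  assumes "x \<in> carrier M" and g: "g \<in> carrier G"
  shows "f (mproj G M g x) = mproj G T g (f x)"
  using M.module_decomp assms(1)
proof (induction rule: M.M.dsum_induct)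
  case zero
  then show ?case by (simp add: f_zero M.M.dproj_zero[OF M.module_decomp g] T.M.dproj_zero[OF T.module_decomp g])
next
  case (add x y)
  then show ?case
    by (simp add: fD M.M.dproj_add[OF M.module_decomp _ _ g] T.M.dproj_add[OF T.module_decomp _ _ g] M.mproj_closed g)
next
  case (comp h x)
  then show ?case
    using M.M.dproj_comp[OF M.module_decomp g comp] T.M.dproj_comp[OF T.module_decomp g comp(1) fD(4)[OF comp]]
    by (simp add: f_zero)
qed

abbreviation "ker \<equiv> {x \<in> carrier M. f x = \<zero>\<^bsub>T\<^esub>}"

lemma gr_closed_preimage:
  assumes N: "gr_closed G R T N"
  shows "gr_closed G R M {x \<in> carrier M. f x \<in> N}"
  using N unfolding gr_closed_def
  by (simp add: f_zero fD M.smult_closed f_mproj M.mproj_closed)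

lemma gr_closed_ker: "gr_closed G R M ker"
proof -
  have "gr_closed G R T {\<zero>\<^bsub>T\<^esub>}"
    unfolding gr_closed_def by (simp add: T.smult_r_null T.M.dproj_zero[OF T.module_decomp])
  from gr_closed_preimage[OF this] show ?thesis by simp
qed

text \<open>The homomorphism theorem without surjectivity. The map is \<open>f\<close> evaluated at
  a chosen representative, well-defined and injective because cosets of \<open>ker\<close> agree
  exactly when the values of \<open>f\<close> do; the last clause lets the image be computed from
  that of \<open>f\<close>.\<close>

lemma quotient_embedding:
  "\<exists>h. h \<in> gr_hom G R (quot_gmod M ker) T \<and> inj_on h (carrier (quot_gmod M ker)) \<and>
     (\<forall>x\<in>carrier M. h (ker +>\<^bsub>M\<^esub> x) = f x)"
proof -
  note K = gr_closed_ker
  note s = M.gr_closed_subgroup[OF K]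
  define h where "h X = f (SOME m. m \<in> carrier M \<and> ker +>\<^bsub>M\<^esub> m = X)" for X
  have eq: "ker +>\<^bsub>M\<^esub> x = ker +>\<^bsub>M\<^esub> y \<longleftrightarrow> f x = f y" if xy: "x \<in> carrier M" "y \<in> carrier M" for x y
  proof -
    have "ker +>\<^bsub>M\<^esub> x = ker +>\<^bsub>M\<^esub> y \<longleftrightarrow> f x \<ominus>\<^bsub>T\<^esub> f y = \<zero>\<^bsub>T\<^esub>"
      using M.M.a_coset_eq_iff[OF s xy] f_minus[OF xy] xy by simp
    also have "\<dots> \<longleftrightarrow> f x = f y"
      using T.M.minus_add_cancel[OF fD(1)[OF xy(1)] fD(1)[OF xy(2)]] T.M.minus_self[OF fD(1)[OF xy(2)]]
        fD(1)[OF xy(2)] by auto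
    finally show ?thesis .
  qed
  have h: "h (ker +>\<^bsub>M\<^esub> x) = f x" if x: "x \<in> carrier M" for x
  proof -
    let ?m = "SOME m. m \<in> carrier M \<and> ker +>\<^bsub>M\<^esub> m = ker +>\<^bsub>M\<^esub> x"
    have "?m \<in> carrier M \<and> ker +>\<^bsub>M\<^esub> ?m = ker +>\<^bsub>M\<^esub> x"
      by (rule someI[of _ x]) (simp add: x)
    then have "f ?m = f x" using eq[of ?m x] x by blast
    then show ?thesis unfolding h_def .
  qed
  have c: "carrier (quot_gmod M ker) = (\<lambda>x. ker +>\<^bsub>M\<^esub> x) ` carrier M"
    by (simp add: M.M.a_rcosets_eq_image)
  show ?thesis
  proof (intro exI[of _ h] conjI ballI)
    show "inj_on h (carrier (quot_gmod M ker))"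
      unfolding c by (rule inj_onI; elim imageE) (simp add: h eq)
    show "h \<in> gr_hom G R (quot_gmod M ker) T"
    proof (rule gr_homI; (unfold c)?; (elim imageE)?)
      fix X x assume "X = ker +>\<^bsub>M\<^esub> x" "x \<in> carrier M"
      then show "h X \<in> carrier T" using h fD(1) by simp
    next
      fix X Y x y assume "X = ker +>\<^bsub>M\<^esub> x" "Y = ker +>\<^bsub>M\<^esub> y" and xy: "x \<in> carrier M" "y \<in> carrier M"
      then show "h (X \<oplus>\<^bsub>quot_gmod M ker\<^esub> Y) = h X \<oplus>\<^bsub>T\<^esub> h Y"
        using M.M.a_coset_add[OF s xy] by (simp add: h fD)
    next
      fix a X x assume a: "a \<in> carrier R" and X: "X = ker +>\<^bsub>M\<^esub> x" and x: "x \<in> carrier M"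
      show "h (a \<odot>\<^bsub>quot_gmod M ker\<^esub> X) = a \<odot>\<^bsub>T\<^esub> h X"
        unfolding X M.quot_smult[OF K a x] h[OF x] h[OF M.smult_closed[OF a x]] fD(3)[OF a x] ..
    next
      fix g X assume g: "g \<in> carrier G" and "X \<in> mcomp (quot_gmod M ker) g"
      then obtain x where "x \<in> mcomp M g" "X = ker +>\<^bsub>M\<^esub> x" unfolding quot_gmod_simps by blast
      then show "h X \<in> mcomp T g" using h M.mcomp_closed[OF g] fD(4)[OF g] by simp
    qed
  qed (rule h)
qed

end

context graded_ring
begin

lemma graded_left_module_shift:
  assumes M: "graded_left_module G R M" and \<sigma>: "\<sigma> \<in> carrier G"
  shows "graded_left_module G R (gr_shift G M \<sigma>)"
proof -
  interpret M: graded_left_module G R M by fact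
  have ab: "abelian_group (gr_shift G M \<sigma>)"
    using abelian_group_ring_cong[of "gr_shift G M \<sigma>" M] M.M.abelian_group_axioms by simp
  interpret S: abelian_group "gr_shift G M \<sigma>" by (rule ab)
  have "internal_direct_sum (gr_shift G M \<sigma>) (carrier G) (mcomp (gr_shift G M \<sigma>))"
  proof (rule S.internal_direct_sumI; unfold gr_shift_simps)
    fix g assume g: "g \<in> carrier G"
    let ?g = "g \<otimes>\<^bsub>G\<^esub> \<sigma>"
    have gs: "?g \<in> carrier G" using g \<sigma> by simp
    have "mcomp M ?g = mcomp (gr_shift G M \<sigma>) g" by simp
    show "additive_subgroup (mcomp M ?g) (gr_shift G M \<sigma>)"
      using M.M.dsum_subgroup[OF M.module_decomp gs] additive_subgroup_cong[of "gr_shift G M \<sigma>" M] by simp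
    have "mproj G M ?g x = \<zero>\<^bsub>M\<^esub>" if "h \<in> carrier G" "h \<noteq> g" "x \<in> mcomp M (h \<otimes>\<^bsub>G\<^esub> \<sigma>)" for h x
      using M.M.dproj_comp[OF M.module_decomp gs _ that(3)] that g \<sigma> by simp
    moreover have "mproj G M ?g x = x" if "x \<in> mcomp M ?g" for x
      using M.M.dproj_comp[OF M.module_decomp gs gs that] by simp
    moreover have "mproj G M ?g (x \<oplus>\<^bsub>M\<^esub> y) = mproj G M ?g x \<oplus>\<^bsub>M\<^esub> mproj G M ?g y"
      if "x \<in> carrier M" "y \<in> carrier M" for x y using M.M.dproj_add[OF M.module_decomp that gs] .
    ultimately show "\<exists>p. p \<in> carrier M \<rightarrow> carrier M \<and> (\<forall>x\<in>carrier M. \<forall>y\<in>carrier M. p (x \<oplus>\<^bsub>M\<^esub> y) = p x \<oplus>\<^bsub>M\<^esub> p y) \<and>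
        (\<forall>x\<in>mcomp M (g \<otimes>\<^bsub>G\<^esub> \<sigma>). p x = x) \<and>
        (\<forall>j\<in>carrier G. j \<noteq> g \<longrightarrow> (\<forall>x\<in>mcomp M (j \<otimes>\<^bsub>G\<^esub> \<sigma>). p x = \<zero>\<^bsub>M\<^esub>))"
      using M.mproj_closed[OF gs] by (intro exI[of _ "mproj G M ?g"]) simp
  next
    fix x S assume x: "x \<in> carrier M" and S: "\<zero>\<^bsub>M\<^esub> \<in> S" "\<And>a b. a \<in> S \<Longrightarrow> b \<in> S \<Longrightarrow> a \<oplus>\<^bsub>M\<^esub> b \<in> S"
      "\<And>i a. i \<in> carrier G \<Longrightarrow> a \<in> mcomp M (i \<otimes>\<^bsub>G\<^esub> \<sigma>) \<Longrightarrow> a \<in> S"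
    show "x \<in> S"
      using M.module_decomp x
    proof (induction rule: M.M.dsum_induct)
      case (comp h x)
      \<comment> \<open>Degree \<open>h\<close> of \<open>M\<close> is degree
        \<open>h \<sigma>^-1\<close> of the shift.\<close>
      then show ?case using S(3)[of "h \<otimes>\<^bsub>G\<^esub> inv\<^bsub>G\<^esub> \<sigma>" x] \<sigma> by (simp add: G.m_assoc)
    qed (use S in auto)
  qed
  moreover have "a \<odot>\<^bsub>M\<^esub> x \<in> mcomp M ((g \<otimes>\<^bsub>G\<^esub> h) \<otimes>\<^bsub>G\<^esub> \<sigma>)"
    if "g \<in> carrier G" "h \<in> carrier G" "a \<in> rcomp R g" "x \<in> mcomp M (h \<otimes>\<^bsub>G\<^esub> \<sigma>)" for g h a x
    using M.smult_comp[OF that(1) _ that(3,4)] that \<sigma> by (simp add: G.m_assoc)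
  ultimately show ?thesis
    by (intro graded_left_module.intro graded_left_module_axioms.intro graded_ring_axioms ab)
      (simp_all add: M.smult_closed M.smult_l_distr M.smult_r_distr M.smult_assoc M.smult_one)
qed

lemma gr_iso_refl: "gr_iso G R M M"
  unfolding gr_iso_def by (intro bexI[of _ id] gr_homI) auto

lemma gr_iso_trans: "gr_iso G R M T \<Longrightarrow> gr_iso G R T U \<Longrightarrow> gr_iso G R M U"
  unfolding gr_iso_def
proof (elim bexE)
  fix f h assume f: "f \<in> gr_hom G R M T" "bij_betw f (carrier M) (carrier T)"
    and h: "h \<in> gr_hom G R T U" "bij_betw h (carrier T) (carrier U)"
  show "\<exists>f\<in>gr_hom G R M U. bij_betw f (carrier M) (carrier U)"
    by (intro bexI[of _ "h \<circ> f"] gr_homI bij_betw_trans[OF f(2) h(2)]) (auto simp: gr_homD[OF f(1)] gr_homD[OF h(1)])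
qed

lemma gr_iso_sym:
  assumes M: "graded_left_module G R M" and T: "graded_left_module G R T" and iso: "gr_iso G R M T"
  shows "gr_iso G R T M"
proof -
  interpret M: graded_left_module G R M by fact
  interpret T: graded_left_module G R T by fact
  obtain f where f: "f \<in> gr_hom G R M T" and bij: "bij_betw f (carrier M) (carrier T)"
    using iso unfolding gr_iso_def by blast
  interpret gr_hom_pair G R M T f by unfold_locales (rule f)
  let ?h = "inv_into (carrier M) f"
  have hc: "?h y \<in> carrier M" "f (?h y) = y" if "y \<in> carrier T" for y
    using bij that bij_betw_imp_surj_on by (metis inv_into_into) (metis bij bij_betw_imp_surj_on f_inv_into_f that)
  have inj: "x = y" if "f x = f y" "x \<in> carrier M" "y \<in> carrier M" for x y
    using bij that unfolding bij_betw_def inj_on_def by blast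
  have "?h \<in> gr_hom G R T M"
  proof (rule gr_homI)
    fix x y assume "x \<in> carrier T" "y \<in> carrier T"
    then show "?h (x \<oplus>\<^bsub>T\<^esub> y) = ?h x \<oplus>\<^bsub>M\<^esub> ?h y" by (intro inj) (auto simp: hc fD)
  next
    fix a x assume "a \<in> carrier R" "x \<in> carrier T"
    then show "?h (a \<odot>\<^bsub>T\<^esub> x) = a \<odot>\<^bsub>M\<^esub> ?h x"
      by (intro inj) (auto simp: hc fD M.smult_closed T.smult_closed)
  next
    fix g y assume g: "g \<in> carrier G" and y: "y \<in> mcomp T g"
    have yc: "y \<in> carrier T" using T.mcomp_closed[OF g y] .
    \<comment> \<open>The inverse preserves degrees: the preimage of \<open>y\<close> and its
      component of degree \<open>g\<close> have the same image, hence are equal.\<close>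
    have "f (mproj G M g (?h y)) = y"
      using f_mproj[OF hc(1)[OF yc] g] T.M.dproj_comp[OF T.module_decomp g g y] hc(2)[OF yc] by simp
    then have "?h y = mproj G M g (?h y)" using g hc yc by (intro inj) (auto simp: M.mproj_closed)
    then show "?h y \<in> mcomp M g" using M.mproj_in[OF g hc(1)[OF yc]] by simp
  qed (rule hc)
  moreover have "bij_betw ?h (carrier T) (carrier M)" by (rule bij_betw_inv_into[OF bij])
  ultimately show ?thesis unfolding gr_iso_def by blast
qed

lemma gr_hom_shift_one: "gr_hom G R M (gr_shift G T \<one>\<^bsub>G\<^esub>) = gr_hom G R M T"
  unfolding gr_hom_def by simp

lemma gr_iso_shift_one: "gr_iso G R M (gr_shift G T \<one>\<^bsub>G\<^esub>) \<longleftrightarrow> gr_iso G R M T"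
  unfolding gr_iso_def gr_hom_shift_one by simp

lemma gr_iso_imp_isoshift: "gr_iso G R M T \<Longrightarrow> gr_isoshift G R M T"
  unfolding gr_isoshift_def using gr_iso_shift_one by blast

lemma gr_isoshift_refl: "gr_isoshift G R M M"
  using gr_iso_refl gr_iso_imp_isoshift by blast

lemma gr_isoshift_sym:
  assumes M: "graded_left_module G R M" and T: "graded_left_module G R T" and iso: "gr_isoshift G R M T"
  shows "gr_isoshift G R T M"
proof -
  obtain \<sigma> where \<sigma>: "\<sigma> \<in> carrier G" and "gr_iso G R M (gr_shift G T \<sigma>)"
    using iso unfolding gr_isoshift_def by blast
  then have "gr_iso G R (gr_shift G T \<sigma>) M"
    using gr_iso_sym[OF M graded_left_module_shift[OF T \<sigma>]] by blast
  then obtain h where h: "h \<in> gr_hom G R (gr_shift G T \<sigma>) M" "bij_betw h (carrier T) (carrier M)"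
    unfolding gr_iso_def by auto
  \<comment> \<open>A degree-preserving map from \<open>T(\<sigma>)\<close> to \<open>M\<close> is
    one from \<open>T\<close> to the shift of \<open>M\<close> by
    \<open>\<sigma>^-1\<close>.\<close>
  have "h x \<in> mcomp M (g \<otimes>\<^bsub>G\<^esub> inv\<^bsub>G\<^esub> \<sigma>)" if "g \<in> carrier G" "x \<in> mcomp T g" for g x
    using gr_homD(4)[OF h(1), of "g \<otimes>\<^bsub>G\<^esub> inv\<^bsub>G\<^esub> \<sigma>" x] that \<sigma> by (simp add: G.m_assoc)
  then have "h \<in> gr_hom G R T (gr_shift G M (inv\<^bsub>G\<^esub> \<sigma>))"
    using gr_homD(1-3)[OF h(1)] by (intro gr_homI) simp_all
  then have "gr_iso G R T (gr_shift G M (inv\<^bsub>G\<^esub> \<sigma>))" unfolding gr_iso_def using h(2) by auto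
  then show ?thesis unfolding gr_isoshift_def using \<sigma> G.inv_closed by blast
qed

lemma gr_isoshift_trans:
  assumes "gr_isoshift G R M T" "gr_isoshift G R T U"
  shows "gr_isoshift G R M U"
proof -
  obtain \<sigma> f where \<sigma>: "\<sigma> \<in> carrier G" and f: "f \<in> gr_hom G R M (gr_shift G T \<sigma>)" "bij_betw f (carrier M) (carrier T)"
    using assms(1) unfolding gr_isoshift_def gr_iso_def by auto
  obtain \<tau> h where \<tau>: "\<tau> \<in> carrier G" and h: "h \<in> gr_hom G R T (gr_shift G U \<tau>)" "bij_betw h (carrier T) (carrier U)"
    using assms(2) unfolding gr_isoshift_def gr_iso_def by auto
  note fD = gr_homD[OF f(1), simplified] and hD = gr_homD[OF h(1), simplified]
  have "h (f x) \<in> mcomp U (g \<otimes>\<^bsub>G\<^esub> (\<sigma> \<otimes>\<^bsub>G\<^esub> \<tau>))" if "g \<in> carrier G" "x \<in> mcomp M g" for g x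
    using hD(4)[of "g \<otimes>\<^bsub>G\<^esub> \<sigma>" "f x"] fD(4)[OF that] that \<sigma> \<tau> by (simp add: G.m_assoc)
  then have "h \<circ> f \<in> gr_hom G R M (gr_shift G U (\<sigma> \<otimes>\<^bsub>G\<^esub> \<tau>))"
    by (intro gr_homI) (simp_all add: fD hD)
  then have "gr_iso G R M (gr_shift G U (\<sigma> \<otimes>\<^bsub>G\<^esub> \<tau>))"
    unfolding gr_iso_def using bij_betw_trans[OF f(2) h(2)] by auto
  then show ?thesis unfolding gr_isoshift_def using \<sigma> \<tau> G.m_closed by blast
qed

end

section \<open>Modules over the quotient by the graded radical\<close>

text \<open>Inflating a deflated module changes the scalar multiplication outside the carriers, so the result is not
  equal to the original record.\<close>

definition gmod_agree :: "('r, 'g) gring \<Rightarrow> ('r, 'm, 'g) gmod \<Rightarrow> ('r, 'm, 'g) gmod \<Rightarrow> bool" where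
  "gmod_agree R M M' \<longleftrightarrow> carrier M = carrier M' \<and> add M = add M' \<and> zero M = zero M' \<and> mcomp M = mcomp M' \<and>
     (\<forall>a\<in>carrier R. \<forall>x\<in>carrier M. a \<odot>\<^bsub>M\<^esub> x = a \<odot>\<^bsub>M'\<^esub> x)"

lemma gmod_agree_sym: "gmod_agree R M M' \<Longrightarrow> gmod_agree R M' M"
  unfolding gmod_agree_def by auto

lemma gmod_agree_graded_left_module:
  assumes A: "gmod_agree R M M'" and M: "graded_left_module G R M"
  shows "graded_left_module G R M'"
proof -
  interpret M: graded_left_module G R M by fact
  note A' = A[unfolded gmod_agree_def]
  have e: "carrier M' = carrier M" "add M' = add M" "zero M' = zero M" "mcomp M' = mcomp M" using A' by auto
  have s: "a \<odot>\<^bsub>M'\<^esub> x = a \<odot>\<^bsub>M\<^esub> x" if "a \<in> carrier R" "x \<in> carrier M" for a x using A' that by auto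
  show ?thesis
  proof (intro graded_left_module.intro graded_left_module_axioms.intro M.graded_ring_axioms; (unfold e)?)
    show "abelian_group M'" using abelian_group_ring_cong[OF e(1-3)] M.M.abelian_group_axioms by simp
    show "internal_direct_sum M' (carrier G) (mcomp M)"
      using internal_direct_sum_ring_cong[OF e(1-3)] M.module_decomp by blast
  qed (simp_all add: s M.smult_closed M.smult_l_distr M.smult_r_distr M.smult_assoc M.smult_one
      M.smult_comp M.rcomp_closed M.mcomp_closed)
qed

lemma gmod_agree_graded_left_module_iff:
  "gmod_agree R M M' \<Longrightarrow> graded_left_module G R M \<longleftrightarrow> graded_left_module G R M'"
  using gmod_agree_graded_left_module gmod_agree_sym by metis

lemma gmod_agree_restrict:
  "gmod_agree R M M' \<Longrightarrow> N \<subseteq> carrier M \<Longrightarrow> gmod_agree R (restrict_gmod M N) (restrict_gmod M' N)"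
  unfolding gmod_agree_def by (auto simp: restrict_gmod_def)

lemma gmod_agree_graded_submodule:
  assumes "gmod_agree R M M'"
  shows "graded_submodule G R M N \<longleftrightarrow> graded_submodule G R M' N"
proof (cases "N \<subseteq> carrier M")
  case True
  then show ?thesis
    using gmod_agree_graded_left_module_iff[OF gmod_agree_restrict[OF assms True]] assms
    unfolding graded_submodule_def gmod_agree_def by simp
next
  case False
  then show ?thesis using assms unfolding graded_submodule_def gmod_agree_def by simp
qed

lemma gmod_agree_gr_simple:
  assumes "gmod_agree R M M'"
  shows "gr_simple G R M \<longleftrightarrow> gr_simple G R M'"
  unfolding gr_simple_def gmod_agree_graded_submodule[OF assms] gmod_agree_graded_left_module_iff[OF assms]
  using assms unfolding gmod_agree_def by simp

lemma gmod_agree_gr_hom_subset: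
  assumes "gmod_agree R M M'" "gmod_agree R T T'"
  shows "gr_hom G R M T \<subseteq> gr_hom G R M' T'"
proof
  fix f assume f: "f \<in> gr_hom G R M T"
  note A = assms[unfolded gmod_agree_def]
  show "f \<in> gr_hom G R M' T'"
    by (rule gr_homI) (use A gr_homD[OF f] in auto)
qed

lemma gmod_agree_gr_hom:
  assumes "gmod_agree R M M'" "gmod_agree R T T'"
  shows "gr_hom G R M T = gr_hom G R M' T'"
  using gmod_agree_gr_hom_subset[OF assms] gmod_agree_gr_hom_subset[OF assms[THEN gmod_agree_sym]] by blast

lemma gmod_agree_gr_iso:
  assumes "gmod_agree R M M'" "gmod_agree R T T'"
  shows "gr_iso G R M T \<longleftrightarrow> gr_iso G R M' T'"
  unfolding gr_iso_def gmod_agree_gr_hom[OF assms] using assms unfolding gmod_agree_def by simp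

lemma gmod_agree_shift:
  "gmod_agree R M M' \<Longrightarrow> gmod_agree R (gr_shift G M \<sigma>) (gr_shift G M' \<sigma>)"
  unfolding gmod_agree_def by (simp add: gr_shift_def)

lemma gmod_agree_gr_isoshift:
  assumes "gmod_agree R M M'" "gmod_agree R T T'"
  shows "gr_isoshift G R M T \<longleftrightarrow> gr_isoshift G R M' T'"
  unfolding gr_isoshift_def by (simp add: gmod_agree_gr_iso[OF assms(1) gmod_agree_shift[OF assms(2)]])

lemma gmod_agree_refl: "gmod_agree R M M"
  unfolding gmod_agree_def by simp

section \<open>Passing between \<open>R\<close>-modules killed by \<open>J\<close> and
  \<open>R/J\<close>-modules\<close>

lemma inflate_gmod_simps [simp]:
  "carrier (inflate_gmod R I M) = carrier M" "add (inflate_gmod R I M) = add M"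
  "zero (inflate_gmod R I M) = zero M" "mcomp (inflate_gmod R I M) = mcomp M"
  "smult (inflate_gmod R I M) a x = (I +>\<^bsub>R\<^esub> a) \<odot>\<^bsub>M\<^esub> x"
  by (simp_all add: inflate_gmod_def)

lemma deflate_gmod_simps [simp]:
  "carrier (deflate_gmod M) = carrier M" "add (deflate_gmod M) = add M"
  "zero (deflate_gmod M) = zero M" "mcomp (deflate_gmod M) = mcomp M"
  "smult (deflate_gmod M) A x = the_elem ((\<lambda>a. a \<odot>\<^bsub>M\<^esub> x) ` A)"
  by (simp_all add: deflate_gmod_def)

lemma restrict_inflate: "restrict_gmod (inflate_gmod R I M) N = inflate_gmod R I (restrict_gmod M N)"
  by (simp add: restrict_gmod_def inflate_gmod_def)

lemma shift_inflate: "gr_shift G (inflate_gmod R I M) \<sigma> = inflate_gmod R I (gr_shift G M \<sigma>)"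
  by (simp add: gr_shift_def inflate_gmod_def)

lemma quot_gring_simps [simp]:
  "carrier (quot_gring R I) = a_rcosets\<^bsub>R\<^esub> I" "add (quot_gring R I) = set_add R"
  "zero (quot_gring R I) = I" "one (quot_gring R I) = I +>\<^bsub>R\<^esub> one R"
  "monoid.mult (quot_gring R I) = rcoset_mult R I"
  "rcomp (quot_gring R I) g = (\<lambda>a. I +>\<^bsub>R\<^esub> a) ` rcomp R g"
  by (simp_all add: quot_gring_def FactRing_def ring.defs gring.defs)

context graded_ring
begin

abbreviation RJ where "RJ \<equiv> gr_jacobson_quot G R"
abbreviation cs where "cs \<equiv> (\<lambda>a. J +> a)"

lemma additive_subgroup_J: "additive_subgroup J R"
  using ideal_J by (simp add: ideal.axioms(1))

lemma RJ_carrier: "carrier RJ = cs ` carrier R"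
  and RJ_zero: "zero RJ = cs \<zero>"
  and RJ_one: "one RJ = cs \<one>"
  and RJ_rcomp: "rcomp RJ = (\<lambda>g. cs ` rcomp R g)"
  unfolding gr_jacobson_quot_def
  by (simp_all add: a_rcosets_eq_image a_coset_zero[OF additive_subgroup_J] fun_eq_iff)

lemma RJ_add: "a \<in> carrier R \<Longrightarrow> b \<in> carrier R \<Longrightarrow> cs a \<oplus>\<^bsub>RJ\<^esub> cs b = cs (a \<oplus> b)"
  unfolding gr_jacobson_quot_def by (simp add: a_coset_add[OF additive_subgroup_J])

lemma RJ_mult: "a \<in> carrier R \<Longrightarrow> b \<in> carrier R \<Longrightarrow> cs a \<otimes>\<^bsub>RJ\<^esub> cs b = cs (a \<otimes> b)"
  unfolding gr_jacobson_quot_def by (simp add: ideal.rcoset_mult_add[OF ideal_J])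

lemma cs_eq_iff: "a \<in> carrier R \<Longrightarrow> b \<in> carrier R \<Longrightarrow> cs a = cs b \<longleftrightarrow> a \<ominus> b \<in> J"
  by (rule a_coset_eq_iff[OF additive_subgroup_J])

lemma rproj_minus:
  "\<lbrakk>x \<in> carrier R; y \<in> carrier R; g \<in> carrier G\<rbrakk> \<Longrightarrow> rproj G R g (x \<ominus> y) = rproj G R g x \<ominus> rproj G R g y"
  using add_minus_cancel_left[of "rproj G R g y" "rproj G R g (x \<ominus> y)"]
    rproj_add[of y "x \<ominus> y" g] minus_add_cancel[of x y]
  by (simp add: rproj_closed a_comm)

lemma graded_ring_RJ: "graded_ring G RJ"
proof -
  have p: "cs (rproj G R g x) = cs (rproj G R g y)"
    if "x \<in> carrier R" "y \<in> carrier R" "cs x = cs y" "g \<in> carrier G" for x y g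
    using that gli_proj[OF gli_J that(4), of "x \<ominus> y"] by (simp add: cs_eq_iff rproj_closed rproj_minus)
  have mon: "monoid RJ"
    by (rule monoidI; (unfold RJ_carrier RJ_one)?; (elim imageE)?) (auto simp: RJ_mult m_assoc)
  have "ring RJ"
    by (rule ringI[OF abelian_group_image[OF RJ_carrier RJ_zero RJ_add] mon]; (unfold RJ_carrier)?; (elim imageE)?)
      (auto simp: RJ_mult RJ_add l_distr r_distr)
  moreover have "internal_direct_sum RJ (carrier G) (rcomp RJ)"
    unfolding RJ_rcomp by (rule internal_direct_sum_image[OF ring_decomp RJ_carrier RJ_zero RJ_add p])
  moreover have "A \<otimes>\<^bsub>RJ\<^esub> B \<in> rcomp RJ (g \<otimes>\<^bsub>G\<^esub> h)"
    if g: "g \<in> carrier G" "h \<in> carrier G" and A: "A \<in> rcomp RJ g" "B \<in> rcomp RJ h" for g h A B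
  proof -
    obtain a b where a: "a \<in> rcomp R g" "A = cs a" and b: "b \<in> rcomp R h" "B = cs b"
      using A unfolding RJ_rcomp by blast
    show ?thesis
      unfolding a(2) b(2) RJ_mult[OF rcomp_closed[OF g(1) a(1)] rcomp_closed[OF g(2) b(1)]] RJ_rcomp
      by (intro imageI ring_comp_mult g a b)
  qed
  ultimately show ?thesis
    by (intro graded_ring.intro graded_ring_axioms.intro G.group_axioms)
qed

abbreviation infl where "infl S \<equiv> inflate_gmod R J S"

text \<open>Every element of \<open>RJ\<close> has the form \<open>cs a\<close>, so both sets of
  axioms speak about the same operators on the same additive group. For the same reason submodules,
  simplicity, homomorphisms and shifts transfer below.\<close>

lemma inflate_graded_left_module_iff: "graded_left_module G R (infl S) \<longleftrightarrow> graded_left_module G RJ S"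
proof
  assume "graded_left_module G RJ S"
  then interpret S: graded_left_module G RJ S .
  have c: "cs a \<in> carrier RJ" if "a \<in> carrier R" for a using that unfolding RJ_carrier by blast
  show "graded_left_module G R (infl S)"
  proof (intro graded_left_module.intro graded_left_module_axioms.intro graded_ring_axioms; (unfold inflate_gmod_simps)?)
    show "abelian_group (infl S)"
      using abelian_group_ring_cong[of "infl S" S] S.M.abelian_group_axioms by simp
    show "internal_direct_sum (infl S) (carrier G) (mcomp S)"
      unfolding internal_direct_sum_ring_cong[of "infl S" S, simplified] by (rule S.module_decomp)
  next
    fix g h a x assume g: "g \<in> carrier G" "h \<in> carrier G" "a \<in> rcomp R g" "x \<in> mcomp S h"
    then show "cs a \<odot>\<^bsub>S\<^esub> x \<in> mcomp S (g \<otimes>\<^bsub>G\<^esub> h)"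
      by (intro S.smult_comp) (auto simp: RJ_rcomp)
  qed (simp_all add: c S.smult_closed S.smult_r_distr S.smult_one[unfolded RJ_one]
      S.smult_l_distr S.smult_assoc flip: RJ_add RJ_mult)
next
  assume "graded_left_module G R (infl S)"
  then interpret S: graded_left_module G R "infl S" .
  note ax = S.smult_closed S.smult_l_distr S.smult_r_distr S.smult_assoc S.smult_one S.smult_comp
  note ax' = ax[unfolded inflate_gmod_simps]
  show "graded_left_module G RJ S"
  proof (intro graded_left_module.intro graded_left_module_axioms.intro graded_ring_RJ; (unfold RJ_carrier RJ_one RJ_rcomp)?; (elim imageE)?)
    show "abelian_group S"
      using abelian_group_ring_cong[of "infl S" S] S.M.abelian_group_axioms by simp
    show "internal_direct_sum S (carrier G) (mcomp S)"
      using S.module_decomp unfolding internal_direct_sum_ring_cong[of "infl S" S, simplified] by simp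
  qed (simp_all add: ax' RJ_add RJ_mult)
qed

lemma inflate_graded_submodule_iff: "graded_submodule G R (infl S) N \<longleftrightarrow> graded_submodule G RJ S N"
  unfolding graded_submodule_def restrict_inflate inflate_graded_left_module_iff by simp

lemma inflate_gr_simple_iff: "gr_simple G R (infl S) \<longleftrightarrow> gr_simple G RJ S"
  unfolding gr_simple_def inflate_graded_submodule_iff inflate_graded_left_module_iff by simp

lemma inflate_gr_hom: "gr_hom G R (infl S) (infl T) = gr_hom G RJ S T"
  unfolding gr_hom_def RJ_carrier by simp

lemma inflate_gr_iso_iff: "gr_iso G R (infl S) (infl T) \<longleftrightarrow> gr_iso G RJ S T"
  unfolding gr_iso_def inflate_gr_hom by simp

lemma inflate_gr_isoshift_iff: "gr_isoshift G R (infl S) (infl T) \<longleftrightarrow> gr_isoshift G RJ S T"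
  unfolding gr_isoshift_def shift_inflate inflate_gr_iso_iff by simp

text \<open>As \<open>J\<close> kills \<open>T\<close>, all elements of a coset \<open>cs a\<close>
  act alike on \<open>x\<close>; so \<open>the_elem\<close> in the deflated action is applied to a
  singleton.\<close>

lemma inflate_deflate_agree:
  assumes T: "graded_left_module G R T" and J0: "\<And>a x. a \<in> J \<Longrightarrow> x \<in> carrier T \<Longrightarrow> a \<odot>\<^bsub>T\<^esub> x = \<zero>\<^bsub>T\<^esub>"
  shows "gmod_agree R (infl (deflate_gmod T)) T"
proof -
  interpret T: graded_left_module G R T by fact
  have "the_elem ((\<lambda>b. b \<odot>\<^bsub>T\<^esub> x) ` cs a) = a \<odot>\<^bsub>T\<^esub> x" if a: "a \<in> carrier R" and x: "x \<in> carrier T" for a x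
  proof -
    have "b \<odot>\<^bsub>T\<^esub> x = a \<odot>\<^bsub>T\<^esub> x" if b: "b \<in> cs a" for b
    proof -
      obtain j where j: "j \<in> J" "b = j \<oplus> a" using b unfolding a_r_coset_def' by blast
      then show ?thesis using T.smult_l_distr[OF J_closed[OF j(1)] a x] J0[OF j(1) x] T.smult_closed[OF a x] by simp
    qed
    moreover have "a \<in> cs a"
      using a_rcosI[OF gli_zero[OF gli_J] gli_subset[OF gli_J] a] a by simp
    ultimately have "(\<lambda>b. b \<odot>\<^bsub>T\<^esub> x) ` cs a = {a \<odot>\<^bsub>T\<^esub> x}" by blast
    then show ?thesis by simp
  qed
  then show ?thesis unfolding gmod_agree_def by simp
qed

end

section \<open>The correspondence\<close>

context graded_left_module
begin

lemma coset_eq_zero_iff: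
  assumes N: "gr_closed G R M N" and x: "x \<in> carrier M"
  shows "N +>\<^bsub>M\<^esub> x = N \<longleftrightarrow> x \<in> N"
  using M.a_coset_eq_iff[OF gr_closed_subgroup[OF N] x M.zero_closed] M.a_coset_zero[OF gr_closed_subgroup[OF N]] x
  by (simp add: M.minus_zero_right)

lemma coset_gr_hom:
  assumes N: "gr_closed G R M N"
  shows "(\<lambda>x. N +>\<^bsub>M\<^esub> x) \<in> gr_hom G R M (quot_gmod M N)"
proof (rule gr_homI)
  show "a \<in> carrier R \<Longrightarrow> x \<in> carrier M \<Longrightarrow> N +>\<^bsub>M\<^esub> (a \<odot>\<^bsub>M\<^esub> x) = a \<odot>\<^bsub>quot_gmod M N\<^esub> (N +>\<^bsub>M\<^esub> x)" for a x
    by (rule quot_smult[OF N, symmetric])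
qed (auto simp: M.a_rcosets_eq_image M.a_coset_add[OF gr_closed_subgroup[OF N]])

lemma gr_closed_smult_image:
  assumes C: "graded_left_ideal G R C" and h: "h \<in> carrier G" "x \<in> mcomp M h"
  shows "gr_closed G R M ((\<lambda>r. r \<odot>\<^bsub>M\<^esub> x) ` C)"
proof -
  have x: "x \<in> carrier M" using mcomp_closed[OF h] .
  note c = gli_closed[OF C]
  show ?thesis unfolding gr_closed_def
  proof (intro conjI ballI; (elim imageE)?)
    show "\<zero>\<^bsub>M\<^esub> \<in> (\<lambda>r. r \<odot>\<^bsub>M\<^esub> x) ` C"
      using smult_l_null[OF x] gli_zero[OF C] by (intro image_eqI[of _ _ \<zero>]) auto
  next
    fix u v r s assume "u = r \<odot>\<^bsub>M\<^esub> x" "v = s \<odot>\<^bsub>M\<^esub> x" "r \<in> C" "s \<in> C"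
    then show "u \<oplus>\<^bsub>M\<^esub> v \<in> (\<lambda>r. r \<odot>\<^bsub>M\<^esub> x) ` C"
      using smult_l_distr[OF c c x] gli_add[OF C] by (intro image_eqI[of _ _ "r \<oplus> s"]) auto
  next
    fix a u r assume "a \<in> carrier R" "u = r \<odot>\<^bsub>M\<^esub> x" "r \<in> C"
    then show "a \<odot>\<^bsub>M\<^esub> u \<in> (\<lambda>r. r \<odot>\<^bsub>M\<^esub> x) ` C"
      using smult_assoc[OF _ c x] gli_mult[OF C] by (intro image_eqI[of _ _ "a \<otimes> r"]) auto
  next
    fix g u r assume "g \<in> carrier G" "u = r \<odot>\<^bsub>M\<^esub> x" "r \<in> C"
    then show "mproj G M g u \<in> (\<lambda>r. r \<odot>\<^bsub>M\<^esub> x) ` C"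
      using mproj_smult[OF c h] gli_proj[OF C] h
      by (intro image_eqI[of _ _ "rproj G R (g \<otimes>\<^bsub>G\<^esub> inv\<^bsub>G\<^esub> h) r"]) auto
  qed (use smult_closed[OF c x] in auto)
qed

text \<open>Multiplying by \<open>x\<close> takes degree \<open>g\<close> to degree
  \<open>g h\<close>, which is degree \<open>g\<close> of the shift by \<open>h\<close>.\<close>

lemma gr_hom_smult:
  assumes h: "h \<in> carrier G" "x \<in> mcomp M h"
  shows "(\<lambda>r. r \<odot>\<^bsub>M\<^esub> x) \<in> gr_hom G R (regular_gmod R) (gr_shift G M h)"
  using mcomp_closed[OF h] smult_comp[OF _ h(1) _ h(2)]
  by (intro gr_homI) (simp_all add: smult_closed smult_l_distr smult_assoc)

lemma gli_annihilator:
  assumes h: "h \<in> carrier G" "x \<in> mcomp M h"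
  shows "graded_left_ideal G R {r \<in> carrier R. r \<odot>\<^bsub>M\<^esub> x = \<zero>\<^bsub>M\<^esub>}"
proof -
  interpret reg: graded_left_module G R "regular_gmod R" by (rule graded_left_module_regular)
  interpret sh: graded_left_module G R "gr_shift G M h"
    by (rule graded_left_module_shift[OF _ h(1)]) (rule graded_left_module_axioms)
  interpret hp: gr_hom_pair G R "regular_gmod R" "gr_shift G M h" "\<lambda>r. r \<odot>\<^bsub>M\<^esub> x"
    by unfold_locales (rule gr_hom_smult[OF h])
  show ?thesis using hp.gr_closed_ker reg.graded_submodule_iff by simp
qed

lemma gr_simple_submodule:
  assumes "gr_simple G R M" "gr_closed G R M N" "x \<in> N" "x \<noteq> \<zero>\<^bsub>M\<^esub>"
  shows "N = carrier M"
  using assms graded_submodule_iff unfolding gr_simple_def by blast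

lemma gr_simple_homogeneous:
  assumes "gr_simple G R M"
  obtains g x where "g \<in> carrier G" "x \<in> mcomp M g" "x \<noteq> \<zero>\<^bsub>M\<^esub>"
proof -
  have "\<exists>g\<in>carrier G. \<exists>x\<in>mcomp M g. x \<noteq> \<zero>\<^bsub>M\<^esub>"
  proof (rule ccontr)
    assume n: "\<not> ?thesis"
    have "x = \<zero>\<^bsub>M\<^esub>" if "x \<in> carrier M" for x
      using module_decomp that by (induction rule: M.dsum_induct) (use n in auto)
    then have "carrier M = {\<zero>\<^bsub>M\<^esub>}" by auto
    then show False using assms unfolding gr_simple_def by simp
  qed
  then show ?thesis using that by blast
qed

text \<open>It suffices that the annihilator of a nonzero homogeneous \<open>x\<close> is a maximal
  graded left ideal. If \<open>K\<close> is strictly larger, then \<open>K x\<close> is a nonzero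
  graded submodule, so \<open>x = l x\<close> for some \<open>l \<in> K\<close>; thus
  \<open>\<one> - l\<close> annihilates \<open>x\<close> and \<open>\<one> \<in> K\<close>.\<close>

lemma gr_simple_annihilated:
  assumes simple: "gr_simple G R M" and a: "a \<in> J" and x: "x \<in> carrier M"
  shows "a \<odot>\<^bsub>M\<^esub> x = \<zero>\<^bsub>M\<^esub>"
  using module_decomp x
proof (induction rule: M.dsum_induct)
  case zero
  then show ?case using smult_r_null a J_closed by simp
next
  case (add x y)
  then show ?case using smult_r_distr a J_closed by simp
next
  case (comp h x)
  have xc: "x \<in> carrier M" using mcomp_closed[OF comp] .
  let ?I = "{r \<in> carrier R. r \<odot>\<^bsub>M\<^esub> x = \<zero>\<^bsub>M\<^esub>}"
  show ?case
  proof (cases "x = \<zero>\<^bsub>M\<^esub>")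
    case True
    then show ?thesis using smult_r_null a J_closed by simp
  next
    case False
    have I: "graded_left_ideal G R ?I" by (rule gli_annihilator[OF comp])
    have "maximal_graded_left_ideal G R ?I"
      unfolding maximal_graded_left_ideal_def
    proof (intro conjI allI impI I)
      have "\<one> \<notin> ?I" using smult_one[OF xc] False by simp
      then show "?I \<noteq> carrier R" using one_closed by blast
      fix K assume K: "graded_left_ideal G R K \<and> ?I \<subseteq> K"
      then have K': "graded_left_ideal G R K" by blast
      show "K = ?I \<or> K = carrier R"
      proof (cases "K \<subseteq> ?I")
        case False
        then obtain k where k: "k \<in> K" "k \<odot>\<^bsub>M\<^esub> x \<noteq> \<zero>\<^bsub>M\<^esub>" using gli_closed[OF K'] by blast
        then have "(\<lambda>r. r \<odot>\<^bsub>M\<^esub> x) ` K = carrier M"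
          using gr_simple_submodule[OF simple gr_closed_smult_image[OF K' comp]] by blast
        then obtain l where l: "l \<in> K" "x = l \<odot>\<^bsub>M\<^esub> x" using xc by blast
        have lc: "l \<in> carrier R" using gli_closed[OF K' l(1)] .
        have "(\<one> \<ominus> l) \<odot>\<^bsub>M\<^esub> x = \<zero>\<^bsub>M\<^esub>"
          using smult_l_minus[OF one_closed lc xc] smult_one[OF xc] M.minus_self[OF xc] l(2) by metis
        then have "\<one> \<ominus> l \<in> K" using K lc by auto
        then have "(\<one> \<ominus> l) \<oplus> l \<in> K" using gli_add[OF K'] l by blast
        then show ?thesis using gli_one[OF K'] minus_add_cancel[OF one_closed lc] by simp
      qed (use K in blast)
    qed
    then show ?thesis using J_subset_maximal a by blast
  qed
qed

end

section \<open>Tops of the modules \<open>R e\<close>\<close>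

context graded_ring
begin

abbreviation pmod where "pmod e \<equiv> restrict_gmod (regular_gmod R) (lgen R e)"
text \<open>The top as an \<open>R\<close>-module. The denominator \<open>J \<inter> R e\<close> is
  the submodule \<open>J (R e)\<close> by \<open>ideal_times_J\<close>, in a form where membership
  is easy to decide.\<close>

abbreviation ptop where "ptop e \<equiv> quot_gmod (pmod e) (J \<inter> lgen R e)"

context
  fixes e assumes prim: "primitive_idem G R e"
begin

lemmas eD = primitive_idemD[OF prim]

lemma lgen_iff: "x \<in> lgen R e \<longleftrightarrow> x \<in> carrier R \<and> x \<otimes> e = x"
  by (rule lgen_idem_iff[OF eD(2,3)])

lemma graded_left_module_pmod: "graded_left_module G R (pmod e)"
  using eD(5) unfolding graded_submodule_def by blast

lemma pmod_closed_iff: "gr_closed G R (pmod e) A \<longleftrightarrow> A \<subseteq> lgen R e \<and> graded_left_ideal G R A"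
  unfolding graded_left_module.graded_submodule_iff[OF graded_left_module_pmod, symmetric]
  by (rule graded_submodule_restrict) (use gli_subset[OF eD(5)] in simp)

lemma pmod_closed_J: "gr_closed G R (pmod e) (J \<inter> lgen R e)"
  unfolding pmod_closed_iff using gli_Int[OF gli_J eD(5)] by blast

lemma graded_left_module_ptop: "graded_left_module G R (ptop e)"
  by (rule graded_left_module.graded_left_module_quot[OF graded_left_module_pmod pmod_closed_J])

lemma ptop_carrier: "carrier (ptop e) = (\<lambda>x. (J \<inter> lgen R e) +>\<^bsub>pmod e\<^esub> x) ` lgen R e"
proof -
  interpret P: graded_left_module G R "pmod e" by (rule graded_left_module_pmod)
  show ?thesis by (simp add: P.M.a_rcosets_eq_image)
qed

lemma ptop_zero_iff:
  "x \<in> lgen R e \<Longrightarrow> (J \<inter> lgen R e) +>\<^bsub>pmod e\<^esub> x = J \<inter> lgen R e \<longleftrightarrow> x \<in> J"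
  using graded_left_module.coset_eq_zero_iff[OF graded_left_module_pmod pmod_closed_J, of x] by simp

lemma ptop_hom: "(\<lambda>x. (J \<inter> lgen R e) +>\<^bsub>pmod e\<^esub> x) \<in> gr_hom G R (pmod e) (ptop e)"
  by (rule graded_left_module.coset_gr_hom[OF graded_left_module_pmod pmod_closed_J])

text \<open>An \<open>x\<close> in \<open>J \<inter> R e\<close> equals \<open>x e\<close>, which is
  one of the generators of \<open>J (R e)\<close>; the other inclusion uses that \<open>J\<close> is
  closed under right multiplication.\<close>

lemma ideal_times_J: "ideal_times J (pmod e) = J \<inter> lgen R e"
proof
  interpret P: graded_left_module G R "pmod e" by (rule graded_left_module_pmod)
  have "subgroup (J \<inter> lgen R e) (add_monoid (pmod e))"
    using P.gr_closed_subgroup[OF pmod_closed_J] by (rule additive_subgroup.a_subgroup)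
  moreover have "{a \<odot>\<^bsub>pmod e\<^esub> x | a x. a \<in> J \<and> x \<in> carrier (pmod e)} \<subseteq> J \<inter> lgen R e"
    using J_mult_right gli_closed[OF eD(5)] gli_mult[OF eD(5)] J_closed by auto
  ultimately show "ideal_times J (pmod e) \<subseteq> J \<inter> lgen R e"
    unfolding ideal_times_def using group.generate_subgroup_incl[OF P.M.a_group] by blast
  show "J \<inter> lgen R e \<subseteq> ideal_times J (pmod e)"
  proof
    fix x assume x: "x \<in> J \<inter> lgen R e"
    then have "x = x \<odot>\<^bsub>pmod e\<^esub> e" using lgen_iff by simp
    then show "x \<in> ideal_times J (pmod e)"
      unfolding ideal_times_def using x eD(6) by (intro generate.incl) auto
  qed
qed

text \<open>Links the \<open>R/J\<close>-module \<open>gr_top\<close> to \<open>ptop\<close>, so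
  that everything about tops can be proved over \<open>R\<close>.\<close>

lemma gr_top_agree: "gmod_agree R (infl (gr_top G R (pmod e))) (ptop e)"
  unfolding gr_top_def ideal_times_J
proof (rule inflate_deflate_agree[OF graded_left_module_ptop])
  interpret P: graded_left_module G R "pmod e" by (rule graded_left_module_pmod)
  fix a X assume a: "a \<in> J" and "X \<in> carrier (ptop e)"
  then obtain x where x: "x \<in> lgen R e" "X = (J \<inter> lgen R e) +>\<^bsub>pmod e\<^esub> x" unfolding ptop_carrier by blast
  have "a \<odot>\<^bsub>ptop e\<^esub> X = (J \<inter> lgen R e) +>\<^bsub>pmod e\<^esub> (a \<otimes> x)"
    unfolding x(2) using P.quot_smult[OF pmod_closed_J J_closed[OF a], of x] x(1) by simp
  also have "\<dots> = J \<inter> lgen R e"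
    using ptop_zero_iff[of "a \<otimes> x"] gli_mult[OF eD(5) J_closed[OF a] x(1)] J_mult_right[OF a] gli_closed[OF eD(5) x(1)] by simp
  finally show "a \<odot>\<^bsub>ptop e\<^esub> X = \<zero>\<^bsub>ptop e\<^esub>" by simp
qed

text \<open>Pull a graded submodule back to \<open>R e\<close>: by \<open>primitive_local\<close>
  the preimage lies in \<open>J\<close>, making the submodule zero, or is all of
  \<open>R e\<close>.\<close>

lemma ptop_simple:
  assumes art: "gr_left_artinian G R"
  shows "gr_simple G R (ptop e)"
  unfolding gr_simple_def
proof (intro conjI allI impI graded_left_module_ptop)
  interpret P: graded_left_module G R "pmod e" by (rule graded_left_module_pmod)
  interpret Q: graded_left_module G R "ptop e" by (rule graded_left_module_ptop)
  let ?c = "\<lambda>x. (J \<inter> lgen R e) +>\<^bsub>pmod e\<^esub> x"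
  interpret h: gr_hom_pair G R "pmod e" "ptop e" ?c by unfold_locales (rule ptop_hom)
  have "?c e \<noteq> J \<inter> lgen R e" using ptop_zero_iff[OF eD(6)] idem_notin_J[OF eD(1,3,4)] by simp
  moreover have "?c e \<in> carrier (ptop e)" unfolding ptop_carrier using eD(6) by (rule imageI)
  ultimately show "carrier (ptop e) \<noteq> {\<zero>\<^bsub>ptop e\<^esub>}" unfolding quot_gmod_simps(3) by (metis singletonD)
  fix N assume "graded_submodule G R (ptop e) N"
  then have N: "gr_closed G R (ptop e) N" using Q.graded_submodule_iff by blast
  let ?U = "{x \<in> lgen R e. ?c x \<in> N}"
  have "gr_closed G R (pmod e) ?U" using h.gr_closed_preimage[OF N] unfolding restrict_gmod_simps .
  then have U: "graded_left_ideal G R ?U" unfolding pmod_closed_iff by blast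
  show "N = {\<zero>\<^bsub>ptop e\<^esub>} \<or> N = carrier (ptop e)"
  proof (cases "?U \<subseteq> J")
    case True
    have "X = \<zero>\<^bsub>ptop e\<^esub>" if X: "X \<in> N" for X
    proof -
      have "X \<in> carrier (ptop e)" using X N unfolding gr_closed_def by blast
      then obtain x where x: "x \<in> lgen R e" "X = ?c x" unfolding ptop_carrier by blast
      then have "x \<in> J" using X True by blast
      then show ?thesis using x ptop_zero_iff by simp
    qed
    then show ?thesis using N unfolding gr_closed_def by blast
  next
    case False
    then have "?U = lgen R e" using primitive_local[OF art prim U] by blast
    then have "carrier (ptop e) \<subseteq> N" unfolding ptop_carrier by blast
    then show ?thesis using N unfolding gr_closed_def by blast
  qed
qed

lemma gr_top_simple: "gr_left_artinian G R \<Longrightarrow> gr_simple G RJ (gr_top G R (pmod e))"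
  using ptop_simple gmod_agree_gr_simple[OF gr_top_agree] inflate_gr_simple_iff by blast

text \<open>The projection \<open>R \<rightarrow> R/J\<close>, restricted to \<open>R e\<close>, has
  kernel \<open>J \<inter> R e\<close>.\<close>

lemma gr_top_embeds: "gr_embeds G RJ (gr_top G R (pmod e)) (regular_gmod RJ)"
proof -
  interpret P: graded_left_module G R "pmod e" by (rule graded_left_module_pmod)
  interpret T: graded_left_module G R "infl (regular_gmod RJ)"
    unfolding inflate_graded_left_module_iff
    by (rule graded_ring.graded_left_module_regular[OF graded_ring_RJ])
  have c: "x \<in> carrier R" if "x \<in> lgen R e" for x using gli_closed[OF eD(5) that] .
  interpret h: gr_hom_pair G R "pmod e" "infl (regular_gmod RJ)" cs
    by unfold_locales (rule gr_homI; auto simp: c RJ_add RJ_mult RJ_carrier RJ_rcomp)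
  have ker: "{x \<in> carrier (pmod e). cs x = \<zero>\<^bsub>infl (regular_gmod RJ)\<^esub>} = J \<inter> lgen R e"
    using c cs_eq_iff[OF _ zero_closed] by (auto simp: RJ_zero a_minus_def)
  obtain k where k: "k \<in> gr_hom G R (ptop e) (infl (regular_gmod RJ))" "inj_on k (carrier (ptop e))"
    using h.quotient_embedding unfolding ker by (elim exE conjE)
  have "carrier (gr_top G R (pmod e)) = carrier (ptop e)"
    using gr_top_agree unfolding gmod_agree_def by simp
  moreover have "k \<in> gr_hom G RJ (gr_top G R (pmod e)) (regular_gmod RJ)"
    using k(1) gmod_agree_gr_hom[OF gr_top_agree gmod_agree_refl] unfolding inflate_gr_hom[symmetric] by blast
  ultimately show ?thesis unfolding gr_embeds_def using k(2) by (intro bexI[of _ k]) simp_all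
qed

end

text \<open>The isomorphism \<open>h\<close> descends once it matches \<open>J \<inter> R e\<close>
  with \<open>J \<inter> R f\<close>. Both \<open>h\<close> and its inverse are right
  multiplications, \<open>h x = x h(e)\<close> and \<open>x = h(x) p\<close> with
  \<open>h p = f\<close>, and \<open>J\<close> is two-sided.\<close>

lemma ptop_iso_of_pmod_iso:
  assumes e: "primitive_idem G R e" and f: "primitive_idem G R f" and \<sigma>: "\<sigma> \<in> carrier G"
    and iso: "gr_iso G R (pmod e) (gr_shift G (pmod f) \<sigma>)"
  shows "gr_iso G R (ptop e) (gr_shift G (ptop f) \<sigma>)"
proof -
  note eD = primitive_idemD[OF e] and fD = primitive_idemD[OF f]
  interpret P: graded_left_module G R "pmod e" by (rule graded_left_module_pmod[OF e])
  interpret T: graded_left_module G R "gr_shift G (ptop f) \<sigma>"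
    by (rule graded_left_module_shift[OF graded_left_module_ptop[OF f] \<sigma>])
  let ?c = "\<lambda>x. (J \<inter> lgen R f) +>\<^bsub>pmod f\<^esub> x"
  obtain h where h: "h \<in> gr_hom G R (pmod e) (gr_shift G (pmod f) \<sigma>)" and bij: "bij_betw h (lgen R e) (lgen R f)"
    using iso unfolding gr_iso_def by auto
  note hD = gr_homD[OF h, simplified]
  note cD = gr_homD[OF ptop_hom[OF f], simplified restrict_gmod_simps regular_gmod_simps]
  have im: "h ` lgen R e = lgen R f" using bij by (rule bij_betw_imp_surj_on)
  have "(\<lambda>x. ?c (h x)) \<in> gr_hom G R (pmod e) (gr_shift G (ptop f) \<sigma>)"
    by (rule gr_homI; (unfold restrict_gmod_simps regular_gmod_simps gr_shift_simps)?)
      (use hD cD \<sigma> in \<open>auto simp del: quot_gmod_simps\<close>)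
  then interpret k: gr_hom_pair G R "pmod e" "gr_shift G (ptop f) \<sigma>" "\<lambda>x. ?c (h x)"
    by unfold_locales
  have "h x \<in> J \<longleftrightarrow> x \<in> J" if x: "x \<in> lgen R e" for x
  proof
    have xc: "x \<in> carrier R" and xe: "x \<otimes> e = x" using x lgen_iff[OF e] by auto
    assume "x \<in> J"
    moreover have "h x = x \<otimes> h e" using hD(3)[OF xc eD(6)] xe by simp
    moreover have "h e \<in> carrier R" using hD(1)[OF eD(6)] gli_closed[OF fD(5)] by blast
    ultimately show "h x \<in> J" using J_mult_right by simp
  next
    assume hx: "h x \<in> J"
    obtain p where p: "p \<in> lgen R e" "h p = f" using im fD(6) by (metis imageE)
    have hc: "h x \<in> carrier R" and hf: "h x \<otimes> f = h x" using hD(1)[OF x] lgen_iff[OF f] by auto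
    have "h (h x \<otimes> p) = h x" using hD(3)[OF hc p(1)] p(2) hf by simp
    then have "h x \<otimes> p = x"
      using bij x gli_mult[OF eD(5) hc p(1)] unfolding bij_betw_def inj_on_def by blast
    then show "x \<in> J" using J_mult_right[OF hx] gli_closed[OF eD(5) p(1)] by metis
  qed
  then have ker: "{x \<in> carrier (pmod e). ?c (h x) = \<zero>\<^bsub>gr_shift G (ptop f) \<sigma>\<^esub>} = J \<inter> lgen R e"
    using ptop_zero_iff[OF f hD(1)] by auto
  obtain l where l: "l \<in> gr_hom G R (ptop e) (gr_shift G (ptop f) \<sigma>)" "inj_on l (carrier (ptop e))"
    and lc: "\<forall>x\<in>carrier (pmod e). l ((J \<inter> lgen R e) +>\<^bsub>pmod e\<^esub> x) = ?c (h x)"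
    using k.quotient_embedding unfolding ker by (elim exE conjE)
  have "l ` carrier (ptop e) = (\<lambda>x. l ((J \<inter> lgen R e) +>\<^bsub>pmod e\<^esub> x)) ` lgen R e"
    unfolding ptop_carrier[OF e] by (rule image_image)
  also have "\<dots> = (\<lambda>x. ?c (h x)) ` lgen R e"
    by (rule image_cong[OF refl]) (rule lc[rule_format, unfolded restrict_gmod_simps])
  also have "\<dots> = ?c ` (h ` lgen R e)" by (rule image_image[symmetric])
  finally have "l ` carrier (ptop e) = carrier (ptop f)" unfolding im ptop_carrier[OF f] .
  then show ?thesis unfolding gr_iso_def using l by (auto simp: bij_betw_def)
qed

lemma pmod_iso_of_ptop_iso:
  assumes art: "gr_left_artinian G R"
    and e: "primitive_idem G R e" and f: "primitive_idem G R f" and \<sigma>: "\<sigma> \<in> carrier G"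
    and iso: "gr_iso G R (ptop e) (gr_shift G (ptop f) \<sigma>)"
  shows "gr_iso G R (pmod e) (gr_shift G (pmod f) \<sigma>)"
proof -
  note eD = primitive_idemD[OF e] and fD = primitive_idemD[OF f]
  interpret P: graded_left_module G R "pmod e" by (rule graded_left_module_pmod[OF e])
  interpret Q: graded_left_module G R "pmod f" by (rule graded_left_module_pmod[OF f])
  interpret TP: graded_left_module G R "ptop e" by (rule graded_left_module_ptop[OF e])
  interpret T: graded_left_module G R "gr_shift G (ptop f) \<sigma>"
    by (rule graded_left_module_shift[OF graded_left_module_ptop[OF f] \<sigma>])
  let ?c = "\<lambda>x. (J \<inter> lgen R e) +>\<^bsub>pmod e\<^esub> x"
  let ?d = "\<lambda>x. (J \<inter> lgen R f) +>\<^bsub>pmod f\<^esub> x"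
  obtain h where h: "h \<in> gr_hom G R (ptop e) (gr_shift G (ptop f) \<sigma>)"
    and bij: "bij_betw h (carrier (ptop e)) (carrier (ptop f))"
    using iso unfolding gr_iso_def by auto
  interpret h: gr_hom_pair G R "ptop e" "gr_shift G (ptop f) \<sigma>" h by unfold_locales (rule h)
  have ce: "?c e \<in> carrier (ptop e)" unfolding ptop_carrier[OF e] using eD(6) by blast
  have "?c e \<in> mcomp (ptop e) \<one>\<^bsub>G\<^esub>" using eD(1,6) by simp
  then have "h (?c e) \<in> mcomp (gr_shift G (ptop f) \<sigma>) \<one>\<^bsub>G\<^esub>" by (rule h.fD(4)[OF G.one_closed])
  then have "h (?c e) \<in> ?d ` (lgen R f \<inter> rcomp R \<sigma>)" using \<sigma> by simp
  then obtain y where y: "y \<in> lgen R f" "y \<in> rcomp R \<sigma>" "h (?c e) = ?d y" by blast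
  have yc: "y \<in> carrier R" using gli_closed[OF fD(5) y(1)] .
  \<comment> \<open>Left multiplication by \<open>e\<close> fixes the coset of \<open>e\<close>,
    hence also its image; so the lift \<open>y\<close> may be replaced by \<open>e y\<close>, which
    lies in \<open>e R f\<close>.\<close>
  define x where "x = e \<otimes> y"
  have xf: "x \<in> lgen R f" unfolding x_def using gli_mult[OF fD(5) eD(2) y(1)] .
  have x\<sigma>: "x \<in> rcomp R \<sigma>" unfolding x_def using ring_comp_mult[OF G.one_closed \<sigma> eD(1) y(2)] \<sigma> by simp
  have xc: "x \<in> carrier R" using gli_closed[OF fD(5) xf] .
  have ex: "e \<otimes> x = x" unfolding x_def using eD(2,3) yc by (simp flip: m_assoc)
  have xf': "x \<otimes> f = x" using xf lgen_iff[OF f] by blast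
  have cee: "e \<odot>\<^bsub>ptop e\<^esub> ?c e = ?c e"
    using P.quot_smult[OF pmod_closed_J[OF e] eD(2), of e] eD(3,6) by simp
  have dey: "e \<odot>\<^bsub>gr_shift G (ptop f) \<sigma>\<^esub> ?d y = ?d x"
    using Q.quot_smult[OF pmod_closed_J[OF f] eD(2), of y] y(1) unfolding x_def by simp
  have hx: "h (?c e) = ?d x"
    using h.fD(3)[OF eD(2) ce] unfolding cee y(3) dey .
  have "x \<notin> J"
  proof
    assume "x \<in> J"
    then have "h (?c e) = h (\<zero>\<^bsub>ptop e\<^esub>)" unfolding hx h.f_zero using ptop_zero_iff[OF f xf] by simp
    then have "?c e = \<zero>\<^bsub>ptop e\<^esub>"
      using bij ce TP.M.zero_closed unfolding bij_betw_def inj_on_def by blast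
    then show False using ptop_zero_iff[OF e eD(6)] idem_notin_J[OF eD(1,3,4)] by simp
  qed
  moreover have "x \<in> lgen R x" using xc by (intro image_eqI[of _ _ \<one>]) auto
  moreover have "lgen R x \<subseteq> lgen R f" using gli_mult[OF fD(5) _ xf] by blast
  ultimately have "lgen R x = lgen R f"
    using primitive_local[OF art f gli_lgen[OF \<sigma> x\<sigma>]] by blast
  then obtain r where r: "r \<in> carrier R" "f = r \<otimes> x" using fD(6) by (metis imageE)
  \<comment> \<open>From \<open>f = r x\<close> only the component of \<open>r\<close> of degree
    \<open>\<sigma>^-1\<close> contributes in degree one. Cutting it down to \<open>f R e\<close>
    keeps the product \<open>s x = f\<close> and brings \<open>x s\<close> into
    \<open>e R e\<close>.\<close>
  define s where "s = f \<otimes> rproj G R (inv\<^bsub>G\<^esub> \<sigma>) r \<otimes> e"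
  have r': "rproj G R (inv\<^bsub>G\<^esub> \<sigma>) r \<in> carrier R" "rproj G R (inv\<^bsub>G\<^esub> \<sigma>) r \<in> rcomp R (inv\<^bsub>G\<^esub> \<sigma>)"
    using rproj_closed rproj_in r \<sigma> by auto
  have sc: "s \<in> carrier R" unfolding s_def using r' eD fD by simp
  have s\<sigma>: "s \<in> rcomp R (inv\<^bsub>G\<^esub> \<sigma>)"
    unfolding s_def using ring_comp_mult[OF _ _ ring_comp_mult[OF _ _ fD(1) r'(2)] eD(1)] \<sigma> by simp
  have se: "s \<otimes> e = s" unfolding s_def using r' eD fD by (simp add: m_assoc)
  have fs: "f \<otimes> s = s" unfolding s_def using r' eD fD by (simp flip: m_assoc)
  have "f = rproj G R \<one>\<^bsub>G\<^esub> f" using rproj_comp[OF _ _ fD(1)] by simp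
  also have "\<dots> = rproj G R (inv\<^bsub>G\<^esub> \<sigma>) r \<otimes> x"
    unfolding r(2) using rproj_mult_right[OF r(1) \<sigma> x\<sigma> G.one_closed] \<sigma> by simp
  finally have f': "rproj G R (inv\<^bsub>G\<^esub> \<sigma>) r \<otimes> x = f" by simp
  have "s \<otimes> x = f \<otimes> (rproj G R (inv\<^bsub>G\<^esub> \<sigma>) r \<otimes> (e \<otimes> x))"
    unfolding s_def using r' eD(2) fD(2) xc by (simp add: m_assoc)
  then have sx: "s \<otimes> x = f" unfolding ex f' using fD(3) by simp
  have xs1: "x \<otimes> s \<in> rcomp R \<one>\<^bsub>G\<^esub>" using ring_comp_mult[OF \<sigma> _ x\<sigma> s\<sigma>] \<sigma> by simp
  have "(x \<otimes> s) \<otimes> (x \<otimes> s) = x \<otimes> (s \<otimes> x) \<otimes> s" using xc sc by (simp add: m_assoc)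
  then have xsxs: "(x \<otimes> s) \<otimes> (x \<otimes> s) = x \<otimes> s" unfolding sx xf' .
  have "e \<otimes> (x \<otimes> s) = x \<otimes> s" using ex eD(2) xc sc by (simp flip: m_assoc)
  moreover have "(x \<otimes> s) \<otimes> e = x \<otimes> s" using se eD(2) xc sc by (simp add: m_assoc)
  ultimately have "x \<otimes> s = \<zero> \<or> x \<otimes> s = e" using primitive_idem_cases[OF e xs1 xsxs] by blast
  \<comment> \<open>Otherwise \<open>f = f f = s (x s) x\<close> would vanish.\<close>
  moreover have "x \<otimes> s \<noteq> \<zero>"
  proof
    assume "x \<otimes> s = \<zero>"
    then have "(s \<otimes> x) \<otimes> (s \<otimes> x) = \<zero>" using xc sc by (simp add: m_assoc) (simp flip: m_assoc)
    then show False unfolding sx using fD(3,4) by simp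
  qed
  ultimately have xs: "x \<otimes> s = e" by blast
  have "(\<lambda>p. p \<otimes> x) \<in> gr_hom G R (pmod e) (gr_shift G (pmod f) \<sigma>)"
  proof (rule gr_homI; simp only: restrict_gmod_simps regular_gmod_simps gr_shift_simps)
    fix p assume "p \<in> lgen R e" then show "p \<otimes> x \<in> lgen R f"
      using gli_mult[OF fD(5) _ xf] gli_closed[OF eD(5)] by blast
  next
    fix p q assume "p \<in> lgen R e" "q \<in> lgen R e"
    then show "(p \<oplus> q) \<otimes> x = p \<otimes> x \<oplus> q \<otimes> x" using gli_closed[OF eD(5)] xc l_distr by simp
  next
    fix a p assume "a \<in> carrier R" "p \<in> lgen R e"
    then show "a \<otimes> p \<otimes> x = a \<otimes> (p \<otimes> x)" using gli_closed[OF eD(5)] xc m_assoc by simp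
  next
    fix g p assume "g \<in> carrier G" "p \<in> lgen R e \<inter> rcomp R g"
    then show "p \<otimes> x \<in> lgen R f \<inter> rcomp R (g \<otimes>\<^bsub>G\<^esub> \<sigma>)"
      using gli_mult[OF fD(5) _ xf] gli_closed[OF eD(5)] ring_comp_mult[OF _ \<sigma> _ x\<sigma>] by blast
  qed
  \<comment> \<open>Right multiplication by \<open>s\<close> is the inverse, by
    \<open>x s = e\<close> and \<open>s x = f\<close>.\<close>
  moreover have "bij_betw (\<lambda>p. p \<otimes> x) (lgen R e) (lgen R f)"
  proof (rule bij_betw_byWitness[where f' = "\<lambda>q. q \<otimes> s"])
    show "\<forall>p\<in>lgen R e. p \<otimes> x \<otimes> s = p" using lgen_iff[OF e] xs xc sc m_assoc by metis
    show "\<forall>q\<in>lgen R f. q \<otimes> s \<otimes> x = q" using lgen_iff[OF f] sx xc sc m_assoc by metis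
    show "(\<lambda>p. p \<otimes> x) ` lgen R e \<subseteq> lgen R f"
      using gli_mult[OF fD(5) _ xf] gli_closed[OF eD(5)] by blast
    have "s \<in> lgen R e" using lgen_iff[OF e] se sc by blast
    then show "(\<lambda>q. q \<otimes> s) ` lgen R f \<subseteq> lgen R e"
      using gli_mult[OF eD(5)] gli_closed[OF fD(5)] by blast
  qed
  ultimately show ?thesis unfolding gr_iso_def by auto
qed

lemma simple_iso_ptop:
  assumes art: "gr_left_artinian G R" and simple: "gr_simple G R T"
    and \<sigma>: "\<sigma> \<in> carrier G" "s \<in> mcomp T \<sigma>" and s0: "s \<noteq> \<zero>\<^bsub>T\<^esub>"
  obtains e where "primitive_idem G R e" "pmod e \<in> principal_gr_indecs G R"
    "gr_iso G R (ptop e) (gr_shift G T \<sigma>)"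
proof -
  interpret T: graded_left_module G R T using simple unfolding gr_simple_def by blast
  obtain n :: nat and E where E: "\<And>k. k < n \<Longrightarrow> primitive_idem G R (E k)"
    "\<And>k. k < n \<Longrightarrow> pmod (E k) \<in> principal_gr_indecs G R"
    and Egen: "\<And>I. graded_left_ideal G R I \<Longrightarrow> (\<And>k. k < n \<Longrightarrow> E k \<in> I) \<Longrightarrow> I = carrier R"
    using exists_principal_decomposition[OF art] by blast
  have sc: "s \<in> carrier T" using T.mcomp_closed[OF \<sigma>] .
  let ?I = "{r \<in> carrier R. r \<odot>\<^bsub>T\<^esub> s = \<zero>\<^bsub>T\<^esub>}"
  have I: "graded_left_ideal G R ?I" by (rule T.gli_annihilator[OF \<sigma>])
  have "\<one> \<notin> ?I" using T.smult_one[OF sc] s0 by simp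
  then have "?I \<noteq> carrier R" using one_closed by blast
  \<comment> \<open>The annihilator of \<open>s\<close> is a proper graded left ideal, so it cannot
    contain every \<open>E k\<close>.\<close>
  then obtain k where k: "k < n" "E k \<notin> ?I" using Egen[OF I] by metis
  define e where "e = E k"
  have e: "primitive_idem G R e" "pmod e \<in> principal_gr_indecs G R" unfolding e_def using E k by auto
  note eD = primitive_idemD[OF e(1)]
  have es: "e \<odot>\<^bsub>T\<^esub> s \<noteq> \<zero>\<^bsub>T\<^esub>" using k eD(2) unfolding e_def by blast
  interpret P: graded_left_module G R "pmod e" by (rule graded_left_module_pmod[OF e(1)])
  interpret S: graded_left_module G R "gr_shift G T \<sigma>"
    by (rule graded_left_module_shift[OF T.graded_left_module_axioms \<sigma>(1)])
  note hom = gr_homD[OF T.gr_hom_smult[OF \<sigma>], simplified]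
  interpret h: gr_hom_pair G R "pmod e" "gr_shift G T \<sigma>" "\<lambda>r. r \<odot>\<^bsub>T\<^esub> s"
    by unfold_locales (rule gr_homI; use hom gli_closed[OF eD(5)] in simp)
  have im: "(\<lambda>r. r \<odot>\<^bsub>T\<^esub> s) ` lgen R e = carrier T"
    by (rule T.gr_simple_submodule[OF simple T.gr_closed_smult_image[OF eD(5) \<sigma>] _ es]) (use eD(6) in blast)
  have ker: "{r \<in> carrier (pmod e). r \<odot>\<^bsub>T\<^esub> s = \<zero>\<^bsub>gr_shift G T \<sigma>\<^esub>} = J \<inter> lgen R e" (is "?K = _")
  proof
    have K: "?K \<subseteq> lgen R e \<and> graded_left_ideal G R ?K"
      using h.gr_closed_ker unfolding pmod_closed_iff[OF e(1)] .
    \<comment> \<open>The kernel misses \<open>e\<close>, so locality of \<open>R e\<close> confines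
      it to \<open>J\<close>; conversely \<open>J\<close> kills the simple module
      \<open>T\<close>.\<close>
    have "e \<notin> ?K" using es by simp
    then have "?K \<noteq> lgen R e" using eD(6) by metis
    then show "?K \<subseteq> J \<inter> lgen R e" using primitive_local[OF art e(1), of ?K] K by blast
    show "J \<inter> lgen R e \<subseteq> ?K"
    proof
      fix x assume "x \<in> J \<inter> lgen R e"
      then show "x \<in> ?K" using T.gr_simple_annihilated[OF simple _ sc, of x] by simp
    qed
  qed
  obtain l where l: "l \<in> gr_hom G R (ptop e) (gr_shift G T \<sigma>)" "inj_on l (carrier (ptop e))"
    and lc: "\<forall>x\<in>carrier (pmod e). l ((J \<inter> lgen R e) +>\<^bsub>pmod e\<^esub> x) = x \<odot>\<^bsub>T\<^esub> s"
    using h.quotient_embedding unfolding ker by (elim exE conjE)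
  have "l ` carrier (ptop e) = (\<lambda>x. l ((J \<inter> lgen R e) +>\<^bsub>pmod e\<^esub> x)) ` lgen R e"
    unfolding ptop_carrier[OF e(1)] by (rule image_image)
  moreover have "(\<lambda>x. l ((J \<inter> lgen R e) +>\<^bsub>pmod e\<^esub> x)) ` lgen R e = (\<lambda>r. r \<odot>\<^bsub>T\<^esub> s) ` lgen R e"
    by (rule image_cong[OF refl]) (rule lc[rule_format, unfolded restrict_gmod_simps])
  ultimately have "l ` carrier (ptop e) = carrier T" unfolding im by (rule trans)
  then have "gr_iso G R (ptop e) (gr_shift G T \<sigma>)" unfolding gr_iso_def using l by (auto simp: bij_betw_def)
  with e show ?thesis by (rule that)
qed

text \<open>A nonzero homogeneous \<open>s\<close> of degree \<open>h\<close> goes to a coset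
  \<open>a + J\<close> with \<open>a\<close> of degree \<open>h\<close> outside some maximal graded
  left ideal \<open>I\<close>. Then \<open>\<one> = r a + i\<close> with \<open>i \<in> I\<close>,
  and the degree-one part of this equation produces a multiple of \<open>s\<close> that is nonzero
  of degree one.\<close>

lemma embedded_degree_one:
  assumes simple: "gr_simple G RJ S" and emb: "gr_embeds G RJ S (regular_gmod RJ)"
  obtains s where "s \<in> mcomp S \<one>\<^bsub>G\<^esub>" "s \<noteq> \<zero>\<^bsub>S\<^esub>"
proof -
  have simple': "gr_simple G R (infl S)" using simple inflate_gr_simple_iff by blast
  interpret S: graded_left_module G R "infl S" using simple' unfolding gr_simple_def by blast
  interpret T: graded_left_module G R "infl (regular_gmod RJ)"
    unfolding inflate_graded_left_module_iff
    by (rule graded_ring.graded_left_module_regular[OF graded_ring_RJ])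
  obtain \<phi> where \<phi>: "\<phi> \<in> gr_hom G R (infl S) (infl (regular_gmod RJ))" and inj: "inj_on \<phi> (carrier S)"
    using emb unfolding gr_embeds_def inflate_gr_hom by blast
  interpret p: gr_hom_pair G R "infl S" "infl (regular_gmod RJ)" \<phi> by unfold_locales (rule \<phi>)
  obtain h s where h: "h \<in> carrier G" and s: "s \<in> mcomp S h" "s \<noteq> \<zero>\<^bsub>S\<^esub>"
    using S.gr_simple_homogeneous[OF simple'] by auto
  have sc: "s \<in> carrier S" using S.mcomp_closed[OF h] s by simp
  have "\<phi> s \<in> cs ` rcomp R h" using p.fD(4)[OF h] s by (simp add: RJ_rcomp)
  then obtain a where a: "a \<in> rcomp R h" "\<phi> s = cs a" by blast
  have ac: "a \<in> carrier R" using rcomp_closed[OF h a(1)] .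
  have z: "cs b = \<zero>\<^bsub>RJ\<^esub> \<longleftrightarrow> b \<in> J" if "b \<in> carrier R" for b
    using cs_eq_iff[OF that zero_closed] that by (simp add: RJ_zero a_minus_def)
  have "\<phi> s \<noteq> \<phi> \<zero>\<^bsub>S\<^esub>" using inj_onD[OF inj _ sc] s(2) S.M.zero_closed by auto
  then have "a \<notin> J" using p.f_zero a(2) z[OF ac] by auto
  then obtain I where I: "maximal_graded_left_ideal G R I" "a \<notin> I" using not_in_J ac by blast
  note I' = maximal_gli_D[OF I(1)]
  have "a \<in> lgen R a" using ac by (intro image_eqI[of _ _ \<one>]) auto
  then have "\<not> lgen R a \<subseteq> I" using I(2) by blast
  then obtain u i where u: "u \<in> lgen R a" "i \<in> I" "\<one> = u \<oplus> i"
    using maximal_gli_sum[OF I(1) gli_lgen[OF h a(1)] _ one_closed] by blast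
  then obtain r where r: "r \<in> carrier R" "u = r \<otimes> a" by blast
  \<comment> \<open>Degree \<open>h^-1\<close> makes \<open>?r a\<close> the degree-one component of
    \<open>r a\<close>. It is not in \<open>I\<close>, since otherwise \<open>\<one>\<close> would
    be.\<close>
  let ?r = "rproj G R (inv\<^bsub>G\<^esub> h) r"
  have rc: "?r \<in> carrier R" "?r \<in> rcomp R (inv\<^bsub>G\<^esub> h)" using rproj_closed rproj_in r h by auto
  have ic: "i \<in> carrier R" using gli_closed[OF I'(1) u(2)] .
  have "\<one> = rproj G R \<one>\<^bsub>G\<^esub> (u \<oplus> i)" unfolding u(3)[symmetric] using rproj_comp[OF _ _ one_in_rcomp] by simp
  also have "\<dots> = ?r \<otimes> a \<oplus> rproj G R \<one>\<^bsub>G\<^esub> i"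
    using rproj_add[of u i "\<one>\<^bsub>G\<^esub>"] rproj_mult_right[OF r(1) h a(1), of "\<one>\<^bsub>G\<^esub>"] r ic ac h by simp
  finally have one: "\<one> = ?r \<otimes> a \<oplus> rproj G R \<one>\<^bsub>G\<^esub> i" .
  have "?r \<otimes> a \<notin> I"
  proof
    assume "?r \<otimes> a \<in> I"
    then have "?r \<otimes> a \<oplus> rproj G R \<one>\<^bsub>G\<^esub> i \<in> I"
      using gli_add[OF I'(1)] gli_proj[OF I'(1) G.one_closed u(2)] by blast
    then show False using I'(2) one by simp
  qed
  then have "?r \<otimes> a \<notin> J" using J_subset_maximal[OF I(1)] by blast
  moreover have "\<phi> (?r \<odot>\<^bsub>infl S\<^esub> s) = cs (?r \<otimes> a)"
    using p.fD(3)[OF rc(1), of s] sc a(2) RJ_mult[OF rc(1) ac] by simp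
  ultimately have "\<phi> (?r \<odot>\<^bsub>infl S\<^esub> s) \<noteq> \<zero>\<^bsub>RJ\<^esub>" using z[of "?r \<otimes> a"] rc ac by simp
  moreover have "\<phi> \<zero>\<^bsub>S\<^esub> = \<zero>\<^bsub>RJ\<^esub>" using p.f_zero by simp
  ultimately have "?r \<odot>\<^bsub>infl S\<^esub> s \<noteq> \<zero>\<^bsub>S\<^esub>" by metis
  moreover have "?r \<odot>\<^bsub>infl S\<^esub> s \<in> mcomp S \<one>\<^bsub>G\<^esub>"
    using S.smult_comp[OF _ h rc(2), of s] s h by simp
  ultimately show ?thesis by (intro that)
qed

end

lemma gr_simple_module: "gr_simple G R M \<Longrightarrow> graded_left_module G R M"
  by (simp add: gr_simple_def)

section \<open>The correspondence for principal modules\<close>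

context graded_ring
begin

lemma principal_graded_left_module: "P \<in> principal_gr_indecs G R \<Longrightarrow> graded_left_module G R P"
  by (elim principal_gr_indecsE) (simp add: graded_left_module_pmod)

lemma gr_top_principal:
  assumes "gr_left_artinian G R" "P \<in> principal_gr_indecs G R"
  shows "gr_simple G RJ (gr_top G R P)" "gr_embeds G RJ (gr_top G R P) (regular_gmod RJ)"
  using assms(2) by (elim principal_gr_indecsE; simp add: gr_top_simple gr_top_embeds assms(1))+

lemma gr_top_shift_iso_iff:
  assumes art: "gr_left_artinian G R"
    and P: "P \<in> principal_gr_indecs G R" and Q: "Q \<in> principal_gr_indecs G R" and \<sigma>: "\<sigma> \<in> carrier G"
  shows "gr_iso G R P (gr_shift G Q \<sigma>) \<longleftrightarrow> gr_iso G RJ (gr_top G R P) (gr_shift G (gr_top G R Q) \<sigma>)"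
proof -
  obtain e where e: "primitive_idem G R e" "P = pmod e" using P by (rule principal_gr_indecsE)
  obtain f where f: "primitive_idem G R f" "Q = pmod f" using Q by (rule principal_gr_indecsE)
  have "gr_iso G RJ (gr_top G R P) (gr_shift G (gr_top G R Q) \<sigma>) \<longleftrightarrow> gr_iso G R (ptop e) (gr_shift G (ptop f) \<sigma>)"
    unfolding inflate_gr_iso_iff[symmetric] shift_inflate[symmetric] e(2) f(2)
    by (rule gmod_agree_gr_iso[OF gr_top_agree[OF e(1)] gmod_agree_shift[OF gr_top_agree[OF f(1)]]])
  then show ?thesis
    using ptop_iso_of_pmod_iso[OF e(1) f(1) \<sigma>] pmod_iso_of_ptop_iso[OF art e(1) f(1) \<sigma>] unfolding e(2) f(2) by blast
qed

lemma gr_top_iso_iff: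
  assumes "gr_left_artinian G R" "P \<in> principal_gr_indecs G R" "Q \<in> principal_gr_indecs G R"
  shows "gr_iso G R P Q \<longleftrightarrow> gr_iso G RJ (gr_top G R P) (gr_top G R Q)"
  using gr_top_shift_iso_iff[OF assms G.one_closed]
  unfolding gr_iso_shift_one graded_ring.gr_iso_shift_one[OF graded_ring_RJ] .

lemma gr_top_isoshift_iff:
  assumes "gr_left_artinian G R" "P \<in> principal_gr_indecs G R" "Q \<in> principal_gr_indecs G R"
  shows "gr_isoshift G R P Q \<longleftrightarrow> gr_isoshift G RJ (gr_top G R P) (gr_top G R Q)"
  unfolding gr_isoshift_def using gr_top_shift_iso_iff[OF assms] by blast

lemma simple_covered_by_principal:
  assumes art: "gr_left_artinian G R" and simple: "gr_simple G RJ S"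
    and \<sigma>: "\<sigma> \<in> carrier G" "s \<in> mcomp S \<sigma>" "s \<noteq> \<zero>\<^bsub>S\<^esub>"
  shows "\<exists>P\<in>principal_gr_indecs G R. gr_iso G RJ (gr_top G R P) (gr_shift G S \<sigma>)"
proof -
  have "gr_simple G R (infl S)" using simple inflate_gr_simple_iff by blast
  then obtain e where e: "primitive_idem G R e" "pmod e \<in> principal_gr_indecs G R"
    "gr_iso G R (ptop e) (gr_shift G (infl S) \<sigma>)"
    by (rule simple_iso_ptop[OF art _ \<sigma>(1), of "infl S" s]) (use \<sigma> in simp_all)
  have "gr_iso G RJ (gr_top G R (pmod e)) (gr_shift G S \<sigma>)"
    using e(3) gmod_agree_gr_iso[OF gr_top_agree[OF e(1)] gmod_agree_refl]
    unfolding inflate_gr_iso_iff[symmetric] shift_inflate by blast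
  then show ?thesis using e(2) by blast
qed

lemma simple_isoshift_gr_top:
  assumes art: "gr_left_artinian G R" and simple: "gr_simple G RJ S"
  shows "\<exists>P\<in>principal_gr_indecs G R. gr_isoshift G RJ S (gr_top G R P)"
proof -
  interpret S: graded_left_module G RJ S using simple unfolding gr_simple_def by blast
  obtain \<sigma> s where \<sigma>: "\<sigma> \<in> carrier G" "s \<in> mcomp S \<sigma>" "s \<noteq> \<zero>\<^bsub>S\<^esub>"
    by (rule S.gr_simple_homogeneous[OF simple])
  then obtain P where P: "P \<in> principal_gr_indecs G R" "gr_iso G RJ (gr_top G R P) (gr_shift G S \<sigma>)"
    using simple_covered_by_principal[OF art simple] by blast
  then have iso: "gr_isoshift G RJ (gr_top G R P) S" unfolding gr_isoshift_def using \<sigma>(1) by blast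
  have "graded_left_module G RJ (gr_top G R P)"
    using gr_top_principal(1)[OF art P(1)] unfolding gr_simple_def by blast
  from graded_ring.gr_isoshift_sym[OF graded_ring_RJ this S.graded_left_module_axioms iso]
  have "gr_isoshift G RJ S (gr_top G R P)" .
  then show ?thesis using P(1) by blast
qed

lemma embedded_simple_iso_gr_top:
  assumes art: "gr_left_artinian G R" and simple: "gr_simple G RJ S"
    and emb: "gr_embeds G RJ S (regular_gmod RJ)"
  shows "\<exists>P\<in>principal_gr_indecs G R. gr_iso G RJ S (gr_top G R P)"
proof -
  interpret S: graded_left_module G RJ S using simple unfolding gr_simple_def by blast
  obtain s where s: "s \<in> mcomp S \<one>\<^bsub>G\<^esub>" "s \<noteq> \<zero>\<^bsub>S\<^esub>"
    by (rule embedded_degree_one[OF simple emb])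
  then obtain P where P: "P \<in> principal_gr_indecs G R" "gr_iso G RJ (gr_top G R P) (gr_shift G S \<one>\<^bsub>G\<^esub>)"
    using simple_covered_by_principal[OF art simple G.one_closed] by blast
  then have iso: "gr_iso G RJ (gr_top G R P) S"
    unfolding graded_ring.gr_iso_shift_one[OF graded_ring_RJ] by blast
  have "graded_left_module G RJ (gr_top G R P)"
    using gr_top_principal(1)[OF art P(1)] unfolding gr_simple_def by blast
  from graded_ring.gr_iso_sym[OF graded_ring_RJ this S.graded_left_module_axioms iso]
  have "gr_iso G RJ S (gr_top G R P)" .
  then show ?thesis using P(1) by blast
qed

text \<open>\<open>J\<close> kills \<open>T\<close>, so \<open>T\<close> is deflated to an
  \<open>R/J\<close>-module whose inflation agrees with \<open>T\<close> on the carriers.\<close>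

lemma inflate_isoshift_surj:
  fixes T :: "('r, 'm, 'g) gmod"
  assumes "gr_simple G R T"
  shows "\<exists>S\<in>{S :: ('r set, 'm, 'g) gmod. gr_simple G RJ S}. gr_isoshift G R T (infl S)"
proof -
  interpret T: graded_left_module G R T using assms unfolding gr_simple_def by blast
  have agree: "gmod_agree R (infl (deflate_gmod T)) T"
    by (rule inflate_deflate_agree[OF T.graded_left_module_axioms T.gr_simple_annihilated[OF assms]])
  have "gr_simple G RJ (deflate_gmod T)"
    using gmod_agree_gr_simple[OF agree] assms inflate_gr_simple_iff by blast
  moreover have "gr_isoshift G R T (infl (deflate_gmod T))"
    using gmod_agree_gr_isoshift[OF agree gmod_agree_refl] gr_isoshift_refl by blast
  ultimately show ?thesis by blast
qed

end

text \<open>Types are formed among modules on a fixed carrier type. Since \<open>P/J P\<close>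
  consists of cosets, the two bijections for tops are stated on \<open>'r set\<close>; the clauses
  with arbitrary \<open>'m\<close> add that simple modules on any other carrier type are covered as
  well.\<close>

theorem proposition4p6:
  fixes G :: "('g, 'y) monoid_scheme" and R :: "('r, 'g) gring"
  assumes "group G"
    and "graded_ring G R"
    and "gr_left_artinian G R"
  shows
    "induces_bijection (gr_top G R)
       (principal_gr_indecs G R) (gr_iso G R)
       {S :: ('r set, 'r set, 'g) gmod.
          gr_simple G (gr_jacobson_quot G R) S \<and>
          gr_embeds G (gr_jacobson_quot G R) S (regular_gmod (gr_jacobson_quot G R))}
       (gr_iso G (gr_jacobson_quot G R)) \<and>
     (\<forall>S :: ('r set, 'm, 'g) gmod.
        gr_simple G (gr_jacobson_quot G R) S \<and>
        gr_embeds G (gr_jacobson_quot G R) S (regular_gmod (gr_jacobson_quot G R)) \<longrightarrow>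
        (\<exists>P\<in>principal_gr_indecs G R. gr_iso G (gr_jacobson_quot G R) S (gr_top G R P))) \<and>
     induces_bijection (gr_top G R)
       (principal_gr_indecs G R) (gr_isoshift G R)
       {S :: ('r set, 'r set, 'g) gmod. gr_simple G (gr_jacobson_quot G R) S}
       (gr_isoshift G (gr_jacobson_quot G R)) \<and>
     (\<forall>S :: ('r set, 'm, 'g) gmod.
        gr_simple G (gr_jacobson_quot G R) S \<longrightarrow>
        (\<exists>P\<in>principal_gr_indecs G R. gr_isoshift G (gr_jacobson_quot G R) S (gr_top G R P))) \<and>
     induces_bijection (inflate_gmod R (gr_jacobson G R))
       {S :: ('r set, 'm, 'g) gmod. gr_simple G (gr_jacobson_quot G R) S}
       (gr_isoshift G (gr_jacobson_quot G R))
       {T :: ('r, 'm, 'g) gmod. gr_simple G R T}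
       (gr_isoshift G R)"
proof -
  interpret graded_ring G R by (rule assms(2))
  interpret Q: graded_ring G RJ by (rule graded_ring_RJ)
  note art = assms(3)
  note mod = principal_graded_left_module gr_simple_module
  have "induces_bijection (gr_top G R) (principal_gr_indecs G R) (gr_iso G R)
      {S :: ('r set, 'r set, 'g) gmod. gr_simple G RJ S \<and> gr_embeds G RJ S (regular_gmod RJ)} (gr_iso G RJ)"
    (is "induces_bijection _ ?A _ ?B _")
  proof (rule induces_bijectionI)
    fix P assume "P \<in> ?A"
    then show "gr_top G R P \<in> ?B" using gr_top_principal[OF art] by blast
  next
    fix P Q assume "P \<in> ?A" "Q \<in> ?A"
    then show "gr_iso G R P Q \<longleftrightarrow> gr_iso G RJ (gr_top G R P) (gr_top G R Q)"
      by (rule gr_top_iso_iff[OF art])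
  next
    fix S assume "S \<in> ?B"
    then show "\<exists>P\<in>?A. gr_iso G RJ S (gr_top G R P)" using embedded_simple_iso_gr_top[OF art, of S] by blast
  next
    fix P Q assume "P \<in> ?A" "Q \<in> ?A" "gr_iso G R P Q"
    then show "gr_iso G R Q P" using gr_iso_sym[OF mod(1) mod(1)] by blast
  next
    fix S T assume "S \<in> ?B" "T \<in> ?B" "gr_iso G RJ S T"
    then show "gr_iso G RJ T S" using Q.gr_iso_sym[OF mod(2) mod(2)] by blast
  qed (rule gr_iso_refl Q.gr_iso_refl | erule (1) gr_iso_trans | erule (1) Q.gr_iso_trans)+
  moreover have "\<forall>S :: ('r set, 'm, 'g) gmod. gr_simple G RJ S \<and> gr_embeds G RJ S (regular_gmod RJ) \<longrightarrow>
      (\<exists>P\<in>principal_gr_indecs G R. gr_iso G RJ S (gr_top G R P))"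
    using embedded_simple_iso_gr_top[OF art] by blast
  moreover have "induces_bijection (gr_top G R) (principal_gr_indecs G R) (gr_isoshift G R)
      {S :: ('r set, 'r set, 'g) gmod. gr_simple G RJ S} (gr_isoshift G RJ)"
    (is "induces_bijection _ ?A _ ?B _")
  proof (rule induces_bijectionI)
    fix P assume "P \<in> ?A"
    then show "gr_top G R P \<in> ?B" using gr_top_principal[OF art] by blast
  next
    fix P Q assume "P \<in> ?A" "Q \<in> ?A"
    then show "gr_isoshift G R P Q \<longleftrightarrow> gr_isoshift G RJ (gr_top G R P) (gr_top G R Q)"
      by (rule gr_top_isoshift_iff[OF art])
  next
    fix S assume "S \<in> ?B"
    then show "\<exists>P\<in>?A. gr_isoshift G RJ S (gr_top G R P)" using simple_isoshift_gr_top[OF art, of S] by blast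
  next
    fix P Q assume "P \<in> ?A" "Q \<in> ?A" "gr_isoshift G R P Q"
    then show "gr_isoshift G R Q P" using gr_isoshift_sym[OF mod(1) mod(1)] by blast
  next
    fix S T assume "S \<in> ?B" "T \<in> ?B" "gr_isoshift G RJ S T"
    then show "gr_isoshift G RJ T S" using Q.gr_isoshift_sym[OF mod(2) mod(2)] by blast
  qed (rule gr_isoshift_refl Q.gr_isoshift_refl | erule (1) gr_isoshift_trans | erule (1) Q.gr_isoshift_trans)+
  moreover have "\<forall>S :: ('r set, 'm, 'g) gmod. gr_simple G RJ S \<longrightarrow>
      (\<exists>P\<in>principal_gr_indecs G R. gr_isoshift G RJ S (gr_top G R P))"
    using simple_isoshift_gr_top[OF art] by blast
  moreover have "induces_bijection infl {S :: ('r set, 'm, 'g) gmod. gr_simple G RJ S} (gr_isoshift G RJ)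
      {T :: ('r, 'm, 'g) gmod. gr_simple G R T} (gr_isoshift G R)"
    (is "induces_bijection _ ?A _ ?B _")
  proof (rule induces_bijectionI)
    fix S assume "S \<in> ?A"
    then show "infl S \<in> ?B" by (simp add: inflate_gr_simple_iff)
  next
    fix S T assume "S \<in> ?A" "T \<in> ?A"
    show "gr_isoshift G RJ S T \<longleftrightarrow> gr_isoshift G R (infl S) (infl T)" by (rule inflate_gr_isoshift_iff[symmetric])
  next
    fix T assume "T \<in> ?B"
    then show "\<exists>S\<in>?A. gr_isoshift G R T (infl S)" by (intro inflate_isoshift_surj) simp
  next
    fix S T assume "S \<in> ?A" "T \<in> ?A" "gr_isoshift G RJ S T"
    then show "gr_isoshift G RJ T S" using Q.gr_isoshift_sym[OF mod(2) mod(2)] by blast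
  next
    fix S T assume "S \<in> ?B" "T \<in> ?B" "gr_isoshift G R S T"
    then show "gr_isoshift G R T S" using gr_isoshift_sym[OF mod(2) mod(2)] by blast
  qed (rule gr_isoshift_refl Q.gr_isoshift_refl | erule (1) Q.gr_isoshift_trans | erule (1) gr_isoshift_trans)+
  ultimately show ?thesis by (intro conjI)
qed

end
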